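(* Let $t>0$ and let $(q_m)$ be a sequence of positive numbers. (a) If $q_m\sim cm^\gamma$ as $m\to\infty$ with $c>0$ and $0\le\gamma<1$, then $$\frac{\log\mathcal E_m^{\rm rat}(t,q_m)}{m^{(2+\gamma)/3}}\longrightarrow-\frac32(tc)^{1/3}.$$ (b) If $tq_m/m\to\alpha\in(0,\alpha_c)$, where $\alpha_c=\frac{3\sqrt3}2$, then $$\bigl(\mathcal E_m^{\rm rat}(t,q_m)\bigr)^{1/m}\longrightarrow H_e(\alpha).$$ (c) If $q_m=(\alpha/t)m$ exactly, with $\alpha\in(0,\alpha_c)$, then $$\mathcal E_m^{\rm rat}(t,q_m)\asymp m^{-1/2}H_e(\alpha)^m .$$ (d) If $q_m=m/(\sqrt2\,t)$, then $$\mathcal E_m^{\rm rat}(t,q_m)\asymp m^{-1/2}(\sqrt2-1)^m .$$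
   Context: For $q>0$ and an integer $m\ge0$, $\mathcal R_m(q)=\left\{\frac{P_m(z)}{(q-z)^m}:\ P_m\text{ a polynomial},\ \deg P_m\le m\right\}$. For $t>0$, $$\mathcal E_m^{\rm rat}(t,q)=\inf_{r\in\mathcal R_m(q)}\ \sup_{z\le0}|e^{tz}-r(z)| .$$ For $0<\alpha<\alpha_c$, $\zeta_\alpha$ is the unique root of $\alpha(\zeta^3-\zeta)+1=0$ in the open first quadrant, and $H_e(\alpha)=\left|\frac{\zeta_\alpha-1}{\zeta_\alpha+1}\right|\exp\bigl(\alpha\operatorname{Re}(\zeta_\alpha^2)\bigr)$. The notation $f_m\sim g_m$ means $f_m/g_m\to1$; $f_m\asymp g_m$ means that $f_m/g_m$ lies between two positive constants for all sufficiently large $m$. *)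

theory Defs
  imports
    "HOL-Analysis.Analysis"
    "HOL-Computational_Algebra.Polynomial"
    "HOL-Library.Landau_Symbols"
begin

text \<open>
  Coefficients may be complex. Since the approximated function is real on the negative half-line,
  replacing the coefficients of a candidate by their real parts does not increase its error, so
  real coefficients would give the same best error. The only totalization is at the pole
  \<^term>\<open>z = q\<close>, which is off the half-line because \<^term>\<open>q > 0\<close>.
\<close>
definition rat_class :: "nat \<Rightarrow> real \<Rightarrow> (complex \<Rightarrow> complex) set" where
  "rat_class m q = {\<lambda>z. poly P z / (of_real q - z) ^ m | P :: complex poly. degree P \<le> m}"

text \<open>
  The supremum is over a bounded set of reals when \<^term>\<open>t > 0\<close> and \<^term>\<open>q > 0\<close>, because
  the numerator has degree at most \<^term>\<open>m\<close>.
\<close>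
definition rat_error :: "nat \<Rightarrow> real \<Rightarrow> real \<Rightarrow> real" where
  "rat_error m t q =
     (INF r \<in> rat_class m q. SUP z \<in> {..0::real}. cmod (exp (of_real (t * z)) - r (of_real z)))"

definition alpha_c :: real where
  "alpha_c = 3 * sqrt 3 / 2"

text \<open>Meaningful for \<^term>\<open>0 < \<alpha>\<close> and \<^term>\<open>\<alpha> < alpha_c\<close>, where the root exists and is unique.\<close>
definition zeta :: "real \<Rightarrow> complex" where
  "zeta \<alpha> = (THE z. of_real \<alpha> * (z ^ 3 - z) + 1 = 0 \<and> Re z > 0 \<and> Im z > 0)"

definition H_e :: "real \<Rightarrow> real" where
  "H_e \<alpha> = cmod ((zeta \<alpha> - 1) / (zeta \<alpha> + 1)) * exp (\<alpha> * Re ((zeta \<alpha>)\<^sup>2))"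

end

theory Submission
  imports
    Defs
    "HOL-Complex_Analysis.Complex_Analysis"
    "HOL-Probability.Probability"
    "HOL-Real_Asymp.Real_Asymp"
begin

text \<open>
  Put \<^term>\<open>s = t * q\<close> and substitute \<open>z = - q u\<^sup>2\<close> with real \<open>u\<close>. With the Cayley transform
  \<open>v = (1 + i u) / (1 - i u)\<close>, a point of the unit circle, the class of rational functions becomes the
  class of polynomials of degree at most \<open>m\<close> in \<open>(v + 1/v) / 2\<close>, so the best error is that of polynomial
  approximation on \<open>[-1, 1]\<close>, and \<open>exp (t z)\<close> becomes \<open>exp (- s u\<^sup>2)\<close>. Its Chebyshev coefficients are
  integrals of \<open>exp (- s u\<^sup>2) v^k / (1 + u\<^sup>2)\<close> over the real line, which may be shifted to any horizontal
  line \<open>Im u = a > 0\<close>, because \<open>v\<close> is holomorphic and of modulus below 1 in the upper half-plane.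

  Upper bound. The tail of the Chebyshev series sums to a geometric kernel, and on the line \<open>Im u = a\<close> that
  kernel is at most \<open>|v|^m / a\<close>. Hence the error is at most \<open>1 / (\<pi> a)\<close> times the integral of
  \<open>|exp (- s u\<^sup>2) v^m|\<close> over the line (\<open>rat_error_upper\<close>).

  Lower bound. For every constant \<open>c\<close>, integration against \<open>v^(m+1) (v - c) / (1 + u\<^sup>2)\<close> over the real line
  kills the whole class, since there the integrand extends holomorphically to the upper half-plane and decays
  like \<open>u^(-2)\<close>; its norm as a functional is at most \<open>\<pi> (1 + |c|)\<close>. Applied to \<open>exp (- s u\<^sup>2)\<close> it is again an
  integral over the line \<open>Im u = a\<close> (\<open>rat_error_lower\<close>).

  Both integrals are governed by the critical points of \<open>- s u\<^sup>2 + m log v\<close>. With \<open>\<alpha> = s / m\<close> and \<open>u = i \<zeta>\<close> they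
  solve \<open>\<alpha> (\<zeta>^3 - \<zeta>) + 1 = 0\<close>. Below the critical value of \<open>\<alpha>\<close> there are two of them in the upper half-plane,
  mirror images of each other, and one horizontal line carries both. On that line the logarithm of the modulus,
  as a function of \<open>(Re u)\<^sup>2\<close>, has a single peak, at the saddles. So the modulus lies below a Gaussian around
  each saddle (\<open>line_wave_bound\<close>), and this gives the upper bound with its factor \<open>m^(-1/2)\<close>. The two saddles
  interfere, and single Chebyshev coefficients may nearly vanish; choosing \<open>c\<close> as the value of \<open>v\<close> at one saddle
  removes that saddle from the lower bound, and Laplace's method at the other one
  (\<open>line_wave_gaussian_approx\<close>, \<open>weighted_wave_integral_lower\<close>) shows that the upper bound is sharp up to a
  factor \<open>d\<^sup>2\<close>, with \<open>d\<close> as follows.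

  The cubic is parametrized rationally by \<open>d = 1 / Re \<zeta>\<close>, which runs through \<open>(0, \<surd>3)\<close>: then
  \<open>\<alpha> = d^3 / (2 (4 - d\<^sup>2))\<close>, \<open>\<zeta> = (1 + i b) / d\<close> with \<open>b = \<surd>(3 - d\<^sup>2)\<close>, and after the rescaling \<open>u = y / d\<close> the line
  is \<open>Im y = 1\<close>. In these coordinates nothing degenerates as \<open>d\<close> tends to 0: the large parameter is
  \<open>N = m d\<close>, and all constants are uniform as long as \<open>b\<close> stays away from 0 (\<open>rat_error_two_sided\<close>). The cases
  where \<open>\<alpha>\<close> has a positive limit and where it tends to 0 therefore follow from the same estimate: up to
  powers of \<open>m\<close> the error is \<open>H^m\<close> with \<open>log H = saddle_rate d\<close>, which is \<open>- 3 d / 4\<close> to first order, while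
  \<open>d \<approx> 2 \<alpha>^(1/3)\<close>; and for a fixed \<open>\<alpha>\<close> the two bounds differ by a constant factor.
\<close>

section \<open>Integrals along horizontal lines\<close>

lemma contour_integral_linepath_same_Im:
  assumes "a < b"
  shows "contour_integral (linepath (Complex a c) (Complex b c)) f =
         integral {a..b} (\<lambda>x. f (Complex x c))"
proof -
  let ?g = "\<lambda>z. f (z + Complex 0 c)"
  have "contour_integral (linepath (Complex a c) (Complex b c)) f =
        contour_integral (linepath (of_real a) (of_real b)) ?g"
  proof -
    have "linepath (Complex a c) (Complex b c) x = linepath (of_real a) (of_real b) x + Complex 0 c" for x
      by (auto simp: linepath_def complex_eq_iff algebra_simps)
    moreover have "Complex b c - Complex a c = of_real b - of_real a"
      by (simp add: complex_eq_iff)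
    ultimately show ?thesis by (simp add: contour_integral_integral)
  qed
  also have "\<dots> = integral {a..b} (\<lambda>x. f (Complex x c))"
  proof -
    have "complex_of_real x + Complex 0 c = Complex x c" for x
      by (simp add: complex_eq_iff)
    then show ?thesis
      using assms by (subst contour_integral_linepath_Reals_eq) auto
  qed
  finally show ?thesis .
qed

lemma integral_symmetric_intervals_tendsto:
  fixes f :: "real \<Rightarrow> complex"
  assumes "integrable lborel f"
  shows "(\<lambda>n. integral {-real n..real n} f) \<longlonglongrightarrow> (LINT x|lborel. f x)"
proof -
  have eq: "integral {-real n..real n} f = (LINT x|lborel. indicator {-real n..real n} x *\<^sub>R f x)" for n
  proof -
    have "set_integrable lborel {-real n..real n} f"
      using assms unfolding set_integrable_def by (intro integrable_mult_indicator) auto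
    from set_borel_integral_eq_integral(2)[OF this] show ?thesis
      by (simp add: set_lebesgue_integral_def)
  qed
  have [measurable]: "f \<in> borel_measurable borel"
    using borel_measurable_integrable[OF assms] by simp
  show ?thesis unfolding eq
  proof (rule integral_dominated_convergence[where w = "\<lambda>x. norm (f x)"])
    show "AE x in lborel. (\<lambda>n. indicator {-real n..real n} x *\<^sub>R f x) \<longlonglongrightarrow> f x"
    proof (intro AE_I2 tendsto_eventually)
      fix x :: real
      have "eventually (\<lambda>n. real n \<ge> \<bar>x\<bar>) sequentially"
        using filterlim_real_sequentially filterlim_at_top by blast
      then show "eventually (\<lambda>n. indicator {-real n..real n} x *\<^sub>R f x = f x) sequentially"
        by eventually_elim (auto simp: indicator_def)
    qed
  qed (use assms in \<open>auto simp: indicator_def\<close>)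
qed

text \<open>
  The vertical sides of the rectangle contribute at most \<open>2 (d - c) B R\<close>, which vanishes in the limit. With
  \<open>V = 0\<close> this moves the line of integration; with a pole between the lines, \<open>V\<close> is its residue term.
\<close>
lemma line_integrals_difference:
  fixes F :: "complex \<Rightarrow> complex"
  assumes cd: "c < d"
    and int: "integrable lborel (\<lambda>x. F (Complex x c))" "integrable lborel (\<lambda>x. F (Complex x d))"
    and B: "(B \<longlongrightarrow> 0) at_top"
    and bound: "\<And>R y. R \<ge> R0 \<Longrightarrow> c \<le> y \<Longrightarrow> y \<le> d \<Longrightarrow>
                  norm (F (Complex R y)) \<le> B R \<and> norm (F (Complex (-R) y)) \<le> B R"
    and rect: "\<And>R. R \<ge> R0 \<Longrightarrow> R > 0 \<Longrightarrow> (F has_contour_integral V) (rectpath (Complex (-R) c) (Complex R d))"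
  shows "(LINT x|lborel. F (Complex x c)) - (LINT x|lborel. F (Complex x d)) = V"
proof -
  let ?I = "\<lambda>h n. integral {-real n..real n} (\<lambda>x. F (Complex x h))"
  have lim: "(\<lambda>n. ?I c n - ?I d n - V) \<longlonglongrightarrow>
     (LINT x|lborel. F (Complex x c)) - (LINT x|lborel. F (Complex x d)) - V"
    by (intro tendsto_intros integral_symmetric_intervals_tendsto int)
  have ev: "eventually (\<lambda>n. norm (?I c n - ?I d n - V) \<le> 2 * (d - c) * B (real n)) sequentially"
  proof -
    have "eventually (\<lambda>n. real n \<ge> max R0 1) sequentially"
      using filterlim_real_sequentially filterlim_at_top by blast
    then show ?thesis
    proof eventually_elim
      case (elim n)
      define R where "R = real n"
      have R: "R \<ge> R0" "R > 0" using elim by (auto simp: R_def)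
      have B0: "B R \<ge> 0" using bound[OF R(1), of c] cd norm_ge_zero[of "F (Complex R c)"] by linarith
      define p1 p2 p3 p4 where "p1 = Complex (-R) c" and "p2 = Complex R c"
        and "p3 = Complex R d" and "p4 = Complex (-R) d"
      have seg: "\<exists>y. z = Complex R y \<and> c \<le> y \<and> y \<le> d" if "z \<in> closed_segment p2 p3" for z
        using that cd by (cases z) (auto simp: p2_def p3_def closed_segment_same_Re closed_segment_eq_real_ivl)
      have seg': "\<exists>y. z = Complex (-R) y \<and> c \<le> y \<and> y \<le> d" if "z \<in> closed_segment p4 p1" for z
        using that cd by (cases z) (auto simp: p1_def p4_def closed_segment_same_Re closed_segment_eq_real_ivl)
      have V: "(F has_contour_integral V)
          (linepath p1 p2 +++ linepath p2 p3 +++ linepath p3 p4 +++ linepath p4 p1)"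
        using rect[OF R] by (simp add: rectpath_def Let_def p1_def p2_def p3_def p4_def)
      then have "F contour_integrable_on
          (linepath p1 p2 +++ linepath p2 p3 +++ linepath p3 p4 +++ linepath p4 p1)"
        by (auto simp: contour_integrable_on_def)
      then have ci: "F contour_integrable_on linepath p1 p2" "F contour_integrable_on linepath p2 p3"
         "F contour_integrable_on linepath p3 p4" "F contour_integrable_on linepath p4 p1"
        by (auto simp: contour_integrable_join)
      have "V = contour_integral (linepath p1 p2) F + (contour_integral (linepath p2 p3) F +
            (contour_integral (linepath p3 p4) F + contour_integral (linepath p4 p1) F))"
        using contour_integral_unique[OF V] ci by (simp add: contour_integral_join contour_integrable_join)
      moreover have "contour_integral (linepath p1 p2) F = ?I c n"
        using R unfolding p1_def p2_def by (subst contour_integral_linepath_same_Im) (auto simp: R_def)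
      moreover have "contour_integral (linepath p3 p4) F = - ?I d n"
      proof -
        have "contour_integral (linepath p3 p4) F = - contour_integral (linepath p4 p3) F"
          using ci(3) by (metis contour_integral_reversepath reversepath_linepath valid_path_linepath)
        also have "contour_integral (linepath p4 p3) F = ?I d n"
          using R unfolding p3_def p4_def by (subst contour_integral_linepath_same_Im) (auto simp: R_def)
        finally show ?thesis .
      qed
      moreover have "norm (contour_integral (linepath p2 p3) F) \<le> B R * norm (p3 - p2)"
        by (rule contour_integral_bound_linepath[OF ci(2) B0])
           (use seg bound[OF R(1)] in blast)
      moreover have "norm (contour_integral (linepath p4 p1) F) \<le> B R * norm (p1 - p4)"
        by (rule contour_integral_bound_linepath[OF ci(4) B0])
           (use seg' bound[OF R(1)] in blast)
      moreover have "norm (p3 - p2) = d - c" "norm (p1 - p4) = d - c"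
        using cd by (auto simp: p1_def p2_def p3_def p4_def complex_diff cmod_def)
      ultimately have "?I c n - ?I d n - V = - (contour_integral (linepath p2 p3) F + contour_integral (linepath p4 p1) F)"
        and *: "norm (contour_integral (linepath p2 p3) F) \<le> B R * (d - c)"
           "norm (contour_integral (linepath p4 p1) F) \<le> B R * (d - c)"
        by (auto simp: algebra_simps)
      then have "norm (?I c n - ?I d n - V) \<le> norm (contour_integral (linepath p2 p3) F) + norm (contour_integral (linepath p4 p1) F)"
        by (metis norm_minus_cancel norm_triangle_ineq)
      with * show ?case by (simp add: R_def algebra_simps)
    qed
  qed
  have "(\<lambda>n. 2 * (d - c) * B (real n)) \<longlonglongrightarrow> 2 * (d - c) * 0"
    by (intro tendsto_intros filterlim_compose[OF B] filterlim_real_sequentially)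
  then have "(\<lambda>n. ?I c n - ?I d n - V) \<longlonglongrightarrow> 0"
    by (intro Lim_null_comparison[OF ev]) simp
  with lim have "(LINT x|lborel. F (Complex x c)) - (LINT x|lborel. F (Complex x d)) - V = 0"
    using LIMSEQ_unique by blast
  then show ?thesis by simp
qed


section \<open>Gaussian integrals\<close>

lemma gaussian_eq_normal_density:
  fixes p c :: real
  assumes "p > 0"
  shows "exp (- p * (x - c)\<^sup>2) = sqrt (pi / p) * normal_density c (1 / sqrt (2 * p)) x"
proof -
  have "- (x - c)\<^sup>2 / (2 * (1 / sqrt (2 * p))\<^sup>2) = - p * (x - c)\<^sup>2"
    using assms by (simp add: power_divide)
  moreover have "2 * pi * (1 / sqrt (2 * p))\<^sup>2 = pi / p"
    using assms by (simp add: power_divide)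
  ultimately show ?thesis using assms by (simp add: normal_density_def)
qed

lemma gaussian_integral:
  fixes p c :: real
  assumes "p > 0"
  shows "integrable lborel (\<lambda>x. exp (- p * (x - c)\<^sup>2))"
    and "(LINT x|lborel. exp (- p * (x - c)\<^sup>2)) = sqrt (pi / p)"
  unfolding gaussian_eq_normal_density[OF assms]
  using integrable_normal_density[of "1 / sqrt (2 * p)" c] integral_normal_density[of "1 / sqrt (2 * p)" c] assms
  by simp_all

lemma gaussian_abs_moment:
  fixes p c :: real
  assumes "p > 0"
  shows "integrable lborel (\<lambda>x. \<bar>x - c\<bar> * exp (- p * (x - c)\<^sup>2))"
    and "(LINT x|lborel. \<bar>x - c\<bar> * exp (- p * (x - c)\<^sup>2)) = 1 / p"
proof -
  let ?\<sigma> = "1 / sqrt (2 * p)"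
  have eq: "\<bar>x - c\<bar> * exp (- p * (x - c)\<^sup>2) = sqrt (pi / p) * (normal_density c ?\<sigma> x * \<bar>x - c\<bar>)" for x
    unfolding gaussian_eq_normal_density[OF assms] by (simp only: mult_ac)
  have *: "has_bochner_integral lborel (\<lambda>x. normal_density c ?\<sigma> x * \<bar>x - c\<bar>) (?\<sigma> * sqrt (2 / pi))"
    using normal_moment_abs_odd[of ?\<sigma> c 0] assms by simp
  show "integrable lborel (\<lambda>x. \<bar>x - c\<bar> * exp (- p * (x - c)\<^sup>2))"
    unfolding eq using * by (auto simp: has_bochner_integral_iff)
  have "sqrt (pi / p) * (?\<sigma> * sqrt (2 / pi)) = 1 / p"
    using assms by (simp add: real_sqrt_divide real_sqrt_mult field_simps)
  then show "(LINT x|lborel. \<bar>x - c\<bar> * exp (- p * (x - c)\<^sup>2)) = 1 / p"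
    unfolding eq using * by (auto simp: has_bochner_integral_iff)
qed

lemma gaussian_fourier:
  fixes p \<tau> :: real
  assumes p: "p > 0"
  shows "(LINT x|lborel. exp (of_real (- p * x\<^sup>2) + \<i> * of_real (\<tau> * x)))
         = complex_of_real (sqrt (pi / p) * exp (- \<tau>\<^sup>2 / (4 * p)))"
proof -
  define \<sigma> where "\<sigma> = 1 / sqrt (2 * p)"
  have \<sigma>: "\<sigma> > 0" "2 * \<sigma>\<^sup>2 = 1 / p" using assms by (auto simp: \<sigma>_def power_divide)
  have "complex_of_real (exp (- (\<tau> * \<sigma>)\<^sup>2 / 2)) = char std_normal_distribution (\<tau> * \<sigma>)"
    by (simp add: char_std_normal_distribution)
  also have "\<dots> = (LINT x|lborel. std_normal_density x *\<^sub>R iexp (\<tau> * \<sigma> * x))"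
    unfolding char_def by (subst integral_density) (auto intro!: AE_I2)
  also have "\<dots> = (LINT x|lborel. (1 / sqrt (2 * pi)) *\<^sub>R exp (of_real (- p * (\<sigma> * x)\<^sup>2) + \<i> * of_real (\<tau> * (\<sigma> * x))))"
  proof (intro Bochner_Integration.integral_cong refl)
    fix x :: real
    have "p * (\<sigma> * x)\<^sup>2 = x\<^sup>2 / 2" using \<sigma> p by (simp add: power_mult_distrib field_simps)
    then have e: "exp (complex_of_real (- p * (\<sigma> * x)\<^sup>2)) = of_real (exp (- x\<^sup>2 / 2))"
      by (simp only: exp_of_real) simp
    show "std_normal_density x *\<^sub>R iexp (\<tau> * \<sigma> * x)
       = (1 / sqrt (2 * pi)) *\<^sub>R exp (of_real (- p * (\<sigma> * x)\<^sup>2) + \<i> * of_real (\<tau> * (\<sigma> * x)))"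
      unfolding exp_add e by (simp add: std_normal_density_def scaleR_conv_of_real mult_ac)
  qed
  also have "\<dots> = (1 / sqrt (2 * pi)) *\<^sub>R (LINT x|lborel. exp (of_real (- p * (\<sigma> * x)\<^sup>2) + \<i> * of_real (\<tau> * (\<sigma> * x))))"
    by simp
  finally have 1: "(LINT x|lborel. exp (of_real (- p * (\<sigma> * x)\<^sup>2) + \<i> * of_real (\<tau> * (\<sigma> * x))))
     = of_real (sqrt (2 * pi) * exp (- (\<tau> * \<sigma>)\<^sup>2 / 2))"
    by (simp add: scaleR_conv_of_real field_simps)
  have "(LINT x|lborel. exp (of_real (- p * x\<^sup>2) + \<i> * of_real (\<tau> * x)))
    = \<sigma> *\<^sub>R (LINT x|lborel. exp (of_real (- p * (\<sigma> * x)\<^sup>2) + \<i> * of_real (\<tau> * (\<sigma> * x))))"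
    using lborel_integral_real_affine[of \<sigma> "\<lambda>x. exp (of_real (- p * x\<^sup>2) + \<i> * of_real (\<tau> * x))" 0] \<sigma>(1)
    by simp
  also have "\<dots> = of_real (\<sigma> * (sqrt (2 * pi) * exp (- (\<tau> * \<sigma>)\<^sup>2 / 2)))"
    unfolding 1 by (simp add: scaleR_conv_of_real)
  also have "\<sigma> * (sqrt (2 * pi) * exp (- (\<tau> * \<sigma>)\<^sup>2 / 2)) = sqrt (pi / p) * exp (- \<tau>\<^sup>2 / (4 * p))"
  proof -
    have "\<sigma> * sqrt (2 * pi) = sqrt (pi / p)"
      using p by (simp add: \<sigma>_def real_sqrt_divide real_sqrt_mult field_simps)
    moreover have "(\<tau> * \<sigma>)\<^sup>2 / 2 = \<tau>\<^sup>2 / (4 * p)"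
      using \<sigma> p by (simp add: power_mult_distrib field_simps)
    ultimately show ?thesis by (metis mult.assoc minus_divide_left)
  qed
  finally show ?thesis .
qed

lemma complex_gaussian_integrable:
  assumes "Re k > 0"
  shows "integrable lborel (\<lambda>x::real. exp (- k * of_real (x\<^sup>2) / 2))"
proof (rule Bochner_Integration.integrable_bound[OF gaussian_integral(1)[of "Re k / 2" 0]])
  show "AE x in lborel. norm (exp (- k * of_real (x\<^sup>2) / 2)) \<le> norm (exp (- (Re k / 2) * (x - 0)\<^sup>2))"
    by (intro AE_I2) (simp add: norm_exp_eq_Re)
qed (use assms in auto)

text \<open>
  The integral is a square root of \<open>2 \<pi> / k\<close>; passing to the modulus avoids the choice of a branch. The squared
  modulus is a double integral over a product. After a shear, completing the square in one variable
  leaves the Fourier transform of a real Gaussian.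
\<close>
lemma norm_complex_gaussian_integral:
  assumes k: "Re k > 0"
  shows "(norm (LINT x|lborel. exp (- k * of_real (x\<^sup>2) / 2)))\<^sup>2 = 2 * pi / norm k"
proof -
  define J where "J = (LINT x|lborel. exp (- k * of_real (x\<^sup>2) / 2))"
  define p q where "p = Re k" and "q = Im k"
  have p: "p > 0" and kpq: "k = of_real p + \<i> * of_real q" "cnj k = of_real p - \<i> * of_real q"
    using k by (auto simp: p_def q_def complex_eq_iff)
  (* the shear x \<mapsto> x + y does not change the inner integral over x *)
  define f where "f = (\<lambda>y x::real. exp (- k * of_real ((x + y)\<^sup>2) / 2) * exp (- cnj k * of_real (y\<^sup>2) / 2))"
  have f_meas: "case_prod f \<in> borel_measurable (lborel \<Otimes>\<^sub>M lborel)"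
    unfolding f_def by measurable
  have int_x: "integrable lborel (\<lambda>x. exp (- k * of_real ((x + y)\<^sup>2) / 2))" for y
    using lborel_integrable_real_affine[OF complex_gaussian_integrable[OF k], of 1 y] by (simp add: add.commute)
  have x_val: "(LINT x|lborel. exp (- k * of_real ((x + y)\<^sup>2) / 2)) = J" for y
    using lborel_integral_real_affine[of 1 "\<lambda>x. exp (- k * of_real (x\<^sup>2) / 2)" y] by (simp add: J_def add.commute)
  have fnorm: "norm (f y x) = exp (- (p / 2) * (x - (-y))\<^sup>2) * exp (- (p / 2) * (y - 0)\<^sup>2)" for x y
    by (simp add: f_def norm_mult norm_exp_eq_Re p_def)
  have f_int: "integrable (lborel \<Otimes>\<^sub>M lborel) (case_prod f)"
  proof (rule lborel_pair.Fubini_integrable[OF f_meas])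
    have "(LINT x|lborel. norm (f y x)) = sqrt (pi / (p / 2)) * exp (- (p / 2) * (y - 0)\<^sup>2)" for y
      unfolding fnorm using gaussian_integral(2)[of "p / 2" "-y"] p by simp
    then show "integrable lborel (\<lambda>y. LINT x|lborel. norm (case (y, x) of (y, x) \<Rightarrow> f y x))"
      using gaussian_integral(1)[of "p / 2" 0] p by simp
    show "AE y in lborel. integrable lborel (\<lambda>x. case (y, x) of (y, x) \<Rightarrow> f y x)"
      using int_x by (auto simp: f_def)
  qed
  have cnjJ: "(LINT y|lborel. exp (- cnj k * of_real (y\<^sup>2) / 2)) = cnj J"
  proof -
    have "cnj (exp (- k * of_real (y\<^sup>2) / 2)) = exp (- cnj k * of_real (y\<^sup>2) / 2)" for y :: real
      by (simp add: exp_cnj)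
    moreover have "cnj J = (LINT x|lborel. cnj (exp (- k * of_real (x\<^sup>2) / 2)))"
      unfolding J_def by (rule integral_bounded_linear[OF bounded_linear_cnj complex_gaussian_integrable[OF k], symmetric])
    ultimately show ?thesis by simp
  qed
  have "J * cnj J = (LINT y|lborel. LINT x|lborel. f y x)"
  proof -
    have "(LINT x|lborel. f y x) = J * exp (- cnj k * of_real (y\<^sup>2) / 2)" for y
      by (simp only: f_def integral_mult_left_zero x_val)
    then show ?thesis by (simp only: integral_mult_right_zero cnjJ)
  qed
  also have "\<dots> = (LINT x|lborel. LINT y|lborel. f y x)"
    using lborel_pair.Fubini_integral[OF f_int] by simp
  also have "\<dots> = (LINT x|lborel. of_real (sqrt (pi / p) * exp (- ((p + q\<^sup>2 / p) / 4) * (x - 0)\<^sup>2)))"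
  proof (intro Bochner_Integration.integral_cong refl)
    fix x :: real
    have "(LINT y|lborel. f y x) = (LINT w|lborel. f (w - x / 2) x)"
      using lborel_integral_real_affine[of 1 "\<lambda>y. f y x" "- x / 2"] by simp
    also have "\<dots> = (LINT w|lborel. of_real (exp (- p * x\<^sup>2 / 4)) *
        exp (of_real (- p * w\<^sup>2) + \<i> * of_real ((- q * x) * w)))"
    proof (intro Bochner_Integration.integral_cong refl)
      fix w :: real
      have "- k * of_real ((x + (w - x / 2))\<^sup>2) / 2 + - cnj k * of_real ((w - x / 2)\<^sup>2) / 2
         = of_real (- p * x\<^sup>2 / 4) + (of_real (- p * w\<^sup>2) + \<i> * of_real ((- q * x) * w))"
        unfolding kpq by (simp add: complex_eq_iff power2_eq_square field_simps)
      then show "f (w - x / 2) x = of_real (exp (- p * x\<^sup>2 / 4)) *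
        exp (of_real (- p * w\<^sup>2) + \<i> * of_real ((- q * x) * w))"
        unfolding f_def mult_exp_exp by (simp only: exp_add exp_of_real)
    qed
    also have "\<dots> = of_real (exp (- p * x\<^sup>2 / 4)) * of_real (sqrt (pi / p) * exp (- (- q * x)\<^sup>2 / (4 * p)))"
      unfolding gaussian_fourier[OF p, symmetric] by simp
    also have "\<dots> = of_real (sqrt (pi / p) * (exp (- p * x\<^sup>2 / 4) * exp (- (- q * x)\<^sup>2 / (4 * p))))"
      by simp
    also have "exp (- p * x\<^sup>2 / 4) * exp (- (- q * x)\<^sup>2 / (4 * p)) = exp (- ((p + q\<^sup>2 / p) / 4) * (x - 0)\<^sup>2)"
      using p by (simp add: mult_exp_exp power_mult_distrib field_simps)
    finally show "(LINT y|lborel. f y x) = of_real (sqrt (pi / p) * exp (- ((p + q\<^sup>2 / p) / 4) * (x - 0)\<^sup>2))" .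
  qed
  also have "\<dots> = of_real (sqrt (pi / p) * sqrt (pi / ((p + q\<^sup>2 / p) / 4)))"
    using gaussian_integral(2)[of "(p + q\<^sup>2 / p) / 4" 0] p
    by (subst integral_complex_of_real) (simp add: add_pos_nonneg)
  also have "sqrt (pi / p) * sqrt (pi / ((p + q\<^sup>2 / p) / 4)) = 2 * pi / norm k"
  proof -
    have nk: "(norm k)\<^sup>2 = p\<^sup>2 + q\<^sup>2" by (simp add: cmod_def p_def q_def)
    have "sqrt (pi / p) * sqrt (pi / ((p + q\<^sup>2 / p) / 4)) = sqrt ((pi / p) * (pi / ((p + q\<^sup>2 / p) / 4)))"
      by (rule real_sqrt_mult[symmetric])
    also have "(pi / p) * (pi / ((p + q\<^sup>2 / p) / 4)) = (2 * pi / norm k)\<^sup>2"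
      using p nk by (simp add: power_divide power_mult_distrib field_simps power2_eq_square)
    finally show ?thesis using k by simp
  qed
  finally have "J * cnj J = of_real (2 * pi / norm k)" .
  then have "complex_of_real ((norm J)\<^sup>2) = of_real (2 * pi / norm k)"
    by (metis complex_norm_square)
  then show ?thesis unfolding J_def by (metis of_real_eq_iff)
qed


section \<open>The Cayley transform and the Cauchy formula for the Gaussian\<close>

text \<open>
  For \<open>z = - q y\<^sup>2\<close> with real \<open>y\<close>, the value \<open>w = cayley y\<close> lies on the unit circle and
  \<open>(w + 1/w) / 2 = (q + z) / (q - z)\<close>; this is the variable in which the rational class consists of polynomials.
\<close>
definition cayley :: "complex \<Rightarrow> complex" where
  "cayley u = (1 + \<i> * u) / (1 - \<i> * u)"

lemma cayley_den:
  assumes "Im u \<ge> 0"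
  shows "norm (1 - \<i> * u) \<ge> 1" "1 - \<i> * u \<noteq> 0"
proof -
  show "norm (1 - \<i> * u) \<ge> 1" using complex_Re_le_cmod[of "1 - \<i> * u"] assms by simp
  then show "1 - \<i> * u \<noteq> 0" by auto
qed

lemma norm_cayley_parts:
  "(norm (1 - \<i> * u))\<^sup>2 = (1 + Im u)\<^sup>2 + (Re u)\<^sup>2" "(norm (1 + \<i> * u))\<^sup>2 = (1 - Im u)\<^sup>2 + (Re u)\<^sup>2"
  by (auto simp: cmod_power2)

lemma norm_cayley_le_1: "Im u \<ge> 0 \<Longrightarrow> norm (cayley u) \<le> 1"
proof -
  assume u: "Im u \<ge> 0"
  have "norm (1 + \<i> * u) \<le> norm (1 - \<i> * u)"
  proof (rule power2_le_imp_le)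
    show "(norm (1 + \<i> * u))\<^sup>2 \<le> (norm (1 - \<i> * u))\<^sup>2"
      unfolding norm_cayley_parts using u by (simp add: power2_eq_square algebra_simps)
  qed simp
  then show ?thesis using cayley_den[OF u] by (simp add: cayley_def norm_divide)
qed

lemma norm_cayley_real: "norm (cayley (of_real y)) = 1"
proof -
  have "(norm (1 + \<i> * of_real y))\<^sup>2 = (norm (1 - \<i> * of_real y))\<^sup>2"
    by (simp add: norm_cayley_parts)
  then have "norm (1 + \<i> * of_real y) = norm (1 - \<i> * of_real y)" by simp
  then show ?thesis using cayley_den[of "of_real y"] by (simp add: cayley_def norm_divide)
qed

lemma cayley_minus_real: "cayley (- of_real y) = 1 / cayley (of_real y)"
  by (simp add: cayley_def)

text \<open>
  The geometric kernel \<open>1 / (1 - |v|)\<close> costs no more than a factor \<open>1 / Im u\<close>, since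
  \<open>|1 - i u|\<^sup>2 - |1 + i u|\<^sup>2 = 4 Im u\<close>.
\<close>
lemma cayley_gap:
  assumes "Im u > 0"
  shows "(norm (1 - \<i> * u))\<^sup>2 * (1 - norm (cayley u)) \<ge> 2 * Im u"
proof -
  let ?p = "norm (1 - \<i> * u)" and ?n = "norm (1 + \<i> * u)"
  have p: "?p \<noteq> 0" using cayley_den[of u] assms by simp
  have "?p\<^sup>2 - ?n\<^sup>2 = 4 * Im u" unfolding norm_cayley_parts by (simp add: power2_eq_square algebra_simps)
  then have d: "(?p - ?n) * (?p + ?n) = 4 * Im u" by (simp add: power2_eq_square algebra_simps)
  have "?n \<le> ?p" using norm_cayley_le_1[of u] assms p by (simp add: cayley_def norm_divide)
  then have "(?p - ?n) * (?p + ?n) \<le> (?p - ?n) * (2 * ?p)" by (intro mult_left_mono) auto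
  moreover have "?p\<^sup>2 * (1 - norm (cayley u)) = ?p * (?p - ?n)"
    using p by (simp add: cayley_def norm_divide power2_eq_square right_diff_distrib)
  ultimately show ?thesis using d by (simp add: mult_ac)
qed

lemma norm_exp_square: "norm (exp (- of_real s * (Complex x y)\<^sup>2)) = exp (s * y\<^sup>2) * exp (- s * x\<^sup>2)"
  by (simp add: norm_exp_eq_Re mult_exp_exp power2_eq_square algebra_simps)

lemma complex_line_continuous: "continuous_on A (\<lambda>x. Complex x a)"
  unfolding Complex_eq by (intro continuous_intros)

lemma gaussian_line_integrable:
  fixes h :: "complex \<Rightarrow> complex"
  assumes s: "s > 0" and h: "continuous_on UNIV (\<lambda>x. h (Complex x a))" and C: "\<And>x. norm (h (Complex x a)) \<le> C"
  shows "integrable lborel (\<lambda>x. exp (- of_real s * (Complex x a)\<^sup>2) * h (Complex x a))"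
proof (rule Bochner_Integration.integrable_bound[OF integrable_mult_right[OF gaussian_integral(1)[OF s, of 0], of "exp (s * a\<^sup>2) * C"]])
  show "(\<lambda>x. exp (- of_real s * (Complex x a)\<^sup>2) * h (Complex x a)) \<in> borel_measurable lborel"
    using h by (auto intro!: borel_measurable_continuous_onI continuous_intros complex_line_continuous)
  have C0: "C \<ge> 0" using C[of 0] norm_ge_zero order_trans by blast
  show "AE x in lborel. norm (exp (- of_real s * (Complex x a)\<^sup>2) * h (Complex x a)) \<le> norm (exp (s * a\<^sup>2) * C * exp (- s * (x - 0)\<^sup>2))"
  proof (intro AE_I2)
    fix x
    have "norm (exp (- of_real s * (Complex x a)\<^sup>2) * h (Complex x a)) \<le> exp (s * a\<^sup>2) * exp (- s * x\<^sup>2) * C"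
      unfolding norm_mult norm_exp_square using C by (intro mult_left_mono) auto
    then show "norm (exp (- of_real s * (Complex x a)\<^sup>2) * h (Complex x a)) \<le> norm (exp (s * a\<^sup>2) * C * exp (- s * (x - 0)\<^sup>2))"
      using C0 by (simp add: mult_ac)
  qed
qed

lemma gaussian_decay: "s > 0 \<Longrightarrow> ((\<lambda>R. K * exp (- s * R\<^sup>2)) \<longlongrightarrow> 0) at_top" for K s :: real
  by real_asymp

text \<open>
  Cauchy's formula for the strip \<open>|Im u| \<le> a\<close>. The reflection \<open>u \<mapsto> - u\<close> carries the lower line to the upper one and
  the pole \<open>y\<close> to \<open>- y\<close>, so that a single line remains, with a kernel that is even in \<open>y\<close>.
\<close>
lemma gaussian_cauchy_formula:
  assumes s: "s > 0" and a: "a > 0"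
  shows "(LINT x|lborel. exp (- of_real s * (Complex x a)\<^sup>2) * (1 / (Complex x a - of_real y) + 1 / (Complex x a + of_real y)))
         = - 2 * pi * \<i> * exp (- of_real (s * y\<^sup>2))"
proof -
  let ?e = "\<lambda>u. exp (- complex_of_real s * u\<^sup>2)"
  define F where "F = (\<lambda>u. ?e u / (u - of_real y))"
  have den: "norm (Complex x c - of_real y) \<ge> \<bar>c\<bar>" for x c
    using abs_Im_le_cmod[of "Complex x c - of_real y"] by simp
  have int: "integrable lborel (\<lambda>x. ?e (Complex x c) * (1 / (Complex x c - of_real y')))" if "c \<noteq> 0" for c y'
  proof (rule gaussian_line_integrable[OF s, where C = "1 / \<bar>c\<bar>"])
    have den': "norm (Complex x c - of_real y') \<ge> \<bar>c\<bar>" for x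
      using abs_Im_le_cmod[of "Complex x c - of_real y'"] by simp
    show "continuous_on UNIV (\<lambda>x. 1 / (Complex x c - of_real y'))"
      using that by (intro continuous_intros complex_line_continuous) (auto simp: complex_eq_iff)
    show "norm (1 / (Complex x c - of_real y')) \<le> 1 / \<bar>c\<bar>" for x
      using den'[of x] that by (simp add: norm_divide frac_le)
  qed
  have diff: "(LINT x|lborel. F (Complex x (- a))) - (LINT x|lborel. F (Complex x a)) = 2 * pi * \<i> * exp (- of_real (s * y\<^sup>2))"
  proof (rule line_integrals_difference[where B = "\<lambda>R. exp (s * a\<^sup>2) * exp (- s * R\<^sup>2)" and ?R0.0 = "\<bar>y\<bar> + 1"])
    show "integrable lborel (\<lambda>x. F (Complex x (- a)))" "integrable lborel (\<lambda>x. F (Complex x a))"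
      using int[of "-a" y] int[of a y] a by (simp_all add: F_def)
    show "((\<lambda>R. exp (s * a\<^sup>2) * exp (- s * R\<^sup>2)) \<longlongrightarrow> 0) at_top" using gaussian_decay[OF s] .
  next
    fix R c assume R: "\<bar>y\<bar> + 1 \<le> R" and c: "- a \<le> c" "c \<le> a"
    have "c\<^sup>2 \<le> a\<^sup>2" using c by (metis abs_le_iff abs_le_square_iff abs_of_pos a minus_le_iff)
    then have e: "exp (s * c\<^sup>2) * exp (- s * R\<^sup>2) \<le> exp (s * a\<^sup>2) * exp (- s * R\<^sup>2)"
      using s by simp
    have "norm (F (Complex r c)) \<le> exp (s * a\<^sup>2) * exp (- s * R\<^sup>2)" if r: "\<bar>r - y\<bar> \<ge> 1" "r\<^sup>2 = R\<^sup>2" for r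
    proof -
      have "norm (Complex r c - of_real y) \<ge> 1"
        using abs_Re_le_cmod[of "Complex r c - of_real y"] r by simp
      then have "norm (F (Complex r c)) \<le> norm (?e (Complex r c)) / 1"
        unfolding F_def norm_divide by (intro divide_left_mono) auto
      also have "\<dots> \<le> exp (s * a\<^sup>2) * exp (- s * R\<^sup>2)"
        unfolding norm_exp_square r(2) using e by simp
      finally show ?thesis .
    qed
    then show "norm (F (Complex R c)) \<le> exp (s * a\<^sup>2) * exp (- s * R\<^sup>2) \<and>
               norm (F (Complex (- R) c)) \<le> exp (s * a\<^sup>2) * exp (- s * R\<^sup>2)"
      using R by auto
  next
    fix R :: real assume R: "\<bar>y\<bar> + 1 \<le> R" "R > 0"
    have box: "of_real y \<in> box (Complex (-R) (-a)) (Complex R a)"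
      using R a by (auto simp: in_box_complex_iff)
    have "(F has_contour_integral 2 * pi * \<i> * winding_number (rectpath (Complex (-R) (-a)) (Complex R a)) (of_real y) * ?e (of_real y))
          (rectpath (Complex (-R) (-a)) (Complex R a))"
      unfolding F_def
    proof (rule Cauchy_integral_formula_convex_simple[of UNIV])
      show "path_image (rectpath (Complex (-R) (-a)) (Complex R a)) \<subseteq> UNIV - {of_real y}"
        using R a box path_image_rectpath_inter_box[of "Complex (-R) (-a)" "Complex R a"] by auto
    qed (auto intro!: holomorphic_intros)
    then show "(F has_contour_integral 2 * pi * \<i> * exp (- of_real (s * y\<^sup>2))) (rectpath (Complex (-R) (-a)) (Complex R a))"
      using winding_number_rectpath[OF box] by simp
  qed (use a in auto)
  have flip: "(LINT x|lborel. F (Complex x (- a))) = - (LINT x|lborel. ?e (Complex x a) * (1 / (Complex x a + of_real y)))"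
  proof -
    have "(LINT x|lborel. F (Complex x (- a))) = (LINT x|lborel. F (Complex (- x) (- a)))"
      using lborel_integral_real_affine[of "-1" "\<lambda>x. F (Complex x (- a))" 0] by simp
    also have "\<dots> = (LINT x|lborel. - (?e (Complex x a) * (1 / (Complex x a + of_real y))))"
    proof (intro Bochner_Integration.integral_cong refl)
      fix x
      have minus_quotient: "E / (- D) = - (E * (1 / D))" for E D :: complex by simp
      have "Complex (- x) (- a) = - Complex x a" by (simp add: complex_eq_iff)
      moreover have "- Complex x a - of_real y = - (Complex x a + of_real y)" by simp
      ultimately show "F (Complex (- x) (- a)) = - (?e (Complex x a) * (1 / (Complex x a + of_real y)))"
        unfolding F_def by (simp only: power2_minus minus_quotient)
    qed
    finally show ?thesis by simp
  qed
  have "(LINT x|lborel. ?e (Complex x a) * (1 / (Complex x a - of_real y) + 1 / (Complex x a + of_real y)))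
      = (LINT x|lborel. F (Complex x a)) + (LINT x|lborel. ?e (Complex x a) * (1 / (Complex x a + of_real y)))"
    using int[of a y] int[of a "-y"] a
    by (subst Bochner_Integration.integral_add[symmetric]) (simp_all add: F_def distrib_left)
  also have "\<dots> = - ((LINT x|lborel. F (Complex x (- a))) - (LINT x|lborel. F (Complex x a)))"
    unfolding flip by simp
  finally show ?thesis unfolding diff by simp
qed

text \<open>
  The Cauchy kernel as a truncated geometric series in the product of the two Cayley transforms. Adding the
  formulas for \<open>y\<close> and \<open>- y\<close>, which exchanges \<open>w = cayley y\<close> with \<open>1/w\<close>, turns the powers of \<open>w\<close> into Chebyshev
  polynomials; the last summand is the truncation error.
\<close>
lemma cayley_geometric:
  assumes u: "Im u > 0"
  shows "\<i> / (2 * (u + of_real y)) = 1 / (2 * (1 - \<i> * u))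
     + (\<Sum>k<m. cayley u ^ k / (1 - \<i> * u)\<^sup>2 * cayley (of_real y) ^ Suc k)
     + cayley u ^ m * (cayley (of_real y) ^ Suc m / ((1 - cayley u * cayley (of_real y)) * (1 - \<i> * u)\<^sup>2))"
proof -
  let ?v = "cayley u" and ?w = "cayley (of_real y)" and ?p = "1 - \<i> * u" and ?r = "1 - \<i> * complex_of_real y"
  have p: "?p \<noteq> 0" using cayley_den[of u] u by simp
  have r: "?r \<noteq> 0" using cayley_den[of "of_real y"] by simp
  have uy: "u + of_real y \<noteq> 0" using u by (auto simp: complex_eq_iff)
  have one_minus: "1 - ?v * ?w = - 2 * \<i> * (u + of_real y) / (?p * ?r)"
  proof -
    have "1 - ?v * ?w = (?p * ?r - (1 + \<i> * u) * (1 + \<i> * of_real y)) / (?p * ?r)"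
      using p r unfolding cayley_def by (simp add: diff_divide_distrib)
    also have "?p * ?r - (1 + \<i> * u) * (1 + \<i> * of_real y) = - 2 * \<i> * (u + of_real y)"
      by (simp add: algebra_simps)
    finally show ?thesis .
  qed
  then have nz: "1 - ?v * ?w \<noteq> 0" using p r uy by simp
  have "?w / (1 - ?v * ?w) = \<i> * (1 + \<i> * of_real y) * ?p / (2 * (u + of_real y))"
  proof -
    have "(A / R) / (- 2 * \<i> * U / (P * R)) = \<i> * A * P / (2 * U)" if "R \<noteq> 0" "P \<noteq> 0" "U \<noteq> 0" for A R U P :: complex
      using that by (simp add: field_simps)
    from this[OF r p uy] show ?thesis unfolding one_minus unfolding cayley_def[of "of_real y"] .
  qed
  moreover have "\<i> / (2 * U) = 1 / (2 * P) + \<i> * (1 + \<i> * Y) * P / (2 * U) / P\<^sup>2"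
    if "P \<noteq> 0" "U \<noteq> 0" "P = 1 - \<i> * (U - Y)" for P U Y :: complex
  proof -
    have e: "\<i> * P = U + \<i> - Y"
      unfolding that(3) by (simp add: algebra_simps)
    have "1 / (2 * P) + A * P / (2 * U) / P\<^sup>2 = (U + A) / (2 * U * P)" for A
      using that(1,2) by (simp add: field_simps power2_eq_square)
    moreover have "U + \<i> * (1 + \<i> * Y) = \<i> * P" unfolding e by (simp add: algebra_simps)
    ultimately show ?thesis using that(1) by simp
  qed
  from this[OF p uy] have "\<i> / (2 * (u + of_real y)) = 1 / (2 * ?p) + \<i> * (1 + \<i> * of_real y) * ?p / (2 * (u + of_real y)) / ?p\<^sup>2"
    by simp
  ultimately have 1: "\<i> / (2 * (u + of_real y)) = 1 / (2 * ?p) + ?w / (1 - ?v * ?w) / ?p\<^sup>2" by simp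
  have "?w / (1 - ?v * ?w) = (\<Sum>k<m. ?v ^ k * ?w ^ Suc k) + ?v ^ m * ?w ^ Suc m / (1 - ?v * ?w)"
  proof -
    have "(1 - ?v * ?w) * (\<Sum>k<m. (?v * ?w) ^ k) = 1 - (?v * ?w) ^ m"
      by (rule one_diff_power_eq[symmetric])
    then have S: "(\<Sum>k<m. (?v * ?w) ^ k) = (1 - (?v * ?w) ^ m) / (1 - ?v * ?w)"
      using nz by (simp add: eq_divide_eq mult.commute)
    have gen: "W * ((1 - Z) / D) + W * Z / D = W / D" for W Z D :: complex
      by (simp add: add_divide_distrib[symmetric] algebra_simps)
    have pw: "?v ^ m * ?w ^ Suc m = ?w * (?v * ?w) ^ m" by (simp add: power_mult_distrib)
    have "?w * (\<Sum>k<m. (?v * ?w) ^ k) + ?v ^ m * ?w ^ Suc m / (1 - ?v * ?w) = ?w / (1 - ?v * ?w)"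
      unfolding S pw by (rule gen)
    moreover have "?w * (\<Sum>k<m. (?v * ?w) ^ k) = (\<Sum>k<m. ?v ^ k * ?w ^ Suc k)"
      by (simp add: sum_distrib_left power_mult_distrib mult_ac)
    ultimately show ?thesis by simp
  qed
  then have "?w / (1 - ?v * ?w) / ?p\<^sup>2 = (\<Sum>k<m. ?v ^ k / ?p\<^sup>2 * ?w ^ Suc k) + ?v ^ m * (?w ^ Suc m / ((1 - ?v * ?w) * ?p\<^sup>2))"
    by (simp add: add_divide_distrib sum_divide_distrib)
  with 1 show ?thesis by simp
qed


section \<open>Upper bound: truncating the Chebyshev expansion\<close>

lemma poly_altdef_upto:
  fixes p :: "complex poly"
  assumes "degree p \<le> m"
  shows "poly p x = (\<Sum>i\<le>m. coeff p i * x ^ i)"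
  unfolding poly_altdef using assms
  by (intro sum.mono_neutral_left) (auto simp: coeff_eq_0)

text \<open>
  Twice the Chebyshev polynomial, obtained from the three-term recurrence.
\<close>
lemma chebyshev_exists:
  "\<exists>T :: complex poly. degree T \<le> k \<and> (\<forall>w. w \<noteq> 0 \<longrightarrow> poly T ((w + 1 / w) / 2) = w ^ k + (1 / w) ^ k)"
proof (induction k rule: less_induct)
  case (less k)
  consider "k = 0" | "k = 1" | j where "k = Suc (Suc j)" by (metis One_nat_def not0_implies_Suc)
  then show ?case
  proof cases
    case 1
    then show ?thesis by (intro exI[of _ "[:2:]"]) auto
  next
    case 2
    then show ?thesis by (intro exI[of _ "[:0, 2:]"]) auto
  next
    case 3
    obtain T1 where T1: "degree T1 \<le> Suc j" "\<And>w :: complex. w \<noteq> 0 \<Longrightarrow> poly T1 ((w + 1 / w) / 2) = w ^ Suc j + (1 / w) ^ Suc j"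
      using less[of "Suc j"] 3 by auto
    obtain T0 where T0: "degree T0 \<le> j" "\<And>w :: complex. w \<noteq> 0 \<Longrightarrow> poly T0 ((w + 1 / w) / 2) = w ^ j + (1 / w) ^ j"
      using less[of j] 3 by auto
    let ?T = "[:0, 2:] * T1 - T0"
    have "degree ([:0, 2:] * T1) \<le> Suc (Suc j)"
      using degree_mult_le[of "[:0, 2:]" T1] T1(1) by simp
    then have "degree ?T \<le> k"
      using T0(1) 3 by (intro degree_diff_le) auto
    moreover have "poly ?T ((w + 1 / w) / 2) = w ^ k + (1 / w) ^ k" if "w \<noteq> 0" for w
      using that unfolding poly_diff poly_mult T1(2)[OF that] T0(2)[OF that] 3
      by (simp add: field_simps)
    ultimately show ?thesis by blast
  qed
qed

text \<open>
  Homogenize: each power \<open>j\<close> of the fraction is brought to the denominator \<open>(q - z)^m\<close> by a factor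
  \<open>(q - z)^(m - j)\<close> in the numerator.
\<close>
lemma rat_class_of_cayley_poly:
  assumes "degree S \<le> m"
  shows "\<exists>r \<in> rat_class m q. \<forall>z. z \<noteq> of_real q \<longrightarrow> r z = poly S ((of_real q + z) / (of_real q - z))"
proof -
  let ?c = "complex_of_real q"
  define P where "P = (\<Sum>j\<le>m. smult (coeff S j) ([:?c, 1:] ^ j * [:?c, - 1:] ^ (m - j)))"
  have lin: "degree ([:?c, e:] ^ j) \<le> j" for e j
    using degree_power_le[of "[:?c, e:]" j] by (simp split: if_splits)
  have "degree P \<le> m" unfolding P_def
  proof (intro degree_sum_le)
    fix j assume j: "j \<in> {..m}"
    have "degree ([:?c, 1:] ^ j * [:?c, - 1:] ^ (m - j)) \<le> j + (m - j)"
      by (intro order_trans[OF degree_mult_le] add_mono lin)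
    then show "degree (smult (coeff S j) ([:?c, 1:] ^ j * [:?c, - 1:] ^ (m - j))) \<le> m"
      using j degree_smult_le order_trans by fastforce
  qed simp
  moreover have "poly P z / (?c - z) ^ m = poly S ((?c + z) / (?c - z))" if "z \<noteq> ?c" for z
  proof -
    have nz: "?c - z \<noteq> 0" using that by simp
    have "poly P z / (?c - z) ^ m = (\<Sum>j\<le>m. coeff S j * ((?c + z) ^ j * (?c - z) ^ (m - j)) / (?c - z) ^ m)"
      by (simp add: P_def poly_sum sum_divide_distrib)
    also have "\<dots> = (\<Sum>j\<le>m. coeff S j * ((?c + z) / (?c - z)) ^ j)"
      using nz by (intro sum.cong refl) (simp add: power_diff power_divide)
    also have "\<dots> = poly S ((?c + z) / (?c - z))"
      by (rule poly_altdef_upto[OF assms, symmetric])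
    finally show ?thesis .
  qed
  ultimately show ?thesis
    by (intro bexI[of _ "\<lambda>z. poly P z / (?c - z) ^ m"]) (auto simp: rat_class_def)
qed

text \<open>
  On the negative half-line \<open>|z| \<le> q - z\<close>, so each monomial of the numerator is dominated by the denominator.
\<close>
lemma rat_class_bounded:
  assumes r: "r \<in> rat_class m q" and q: "q > 0"
  shows "\<exists>C. \<forall>z\<le>0. norm (r (complex_of_real z)) \<le> C"
proof -
  obtain P where P: "degree P \<le> m" "r = (\<lambda>z. poly P z / (of_real q - z) ^ m)"
    using r by (auto simp: rat_class_def)
  have "norm (r (complex_of_real z)) \<le> (\<Sum>i\<le>m. norm (coeff P i) * (1 / q ^ (m - i)))" if z: "z \<le> 0" for z
  proof -
    have qz: "q - z > 0" using q z by simp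
    have n: "norm (complex_of_real q - of_real z) = q - z"
      using qz by (metis abs_of_pos norm_of_real of_real_diff)
    have "r (of_real z) = (\<Sum>i\<le>m. coeff P i * of_real z ^ i / (of_real q - of_real z) ^ m)"
      unfolding P(2) poly_altdef_upto[OF P(1)] by (simp add: sum_divide_distrib)
    also have "norm \<dots> \<le> (\<Sum>i\<le>m. norm (coeff P i) * (1 / q ^ (m - i)))"
    proof (rule sum_norm_le)
      fix i assume i: "i \<in> {..m}"
      have "\<bar>z\<bar> ^ i / (q - z) ^ m \<le> (q - z) ^ i / (q - z) ^ m"
        using z q qz by (intro divide_right_mono power_mono) auto
      also have "\<dots> = 1 / (q - z) ^ (m - i)" using i qz by (simp add: power_diff)
      also have "\<dots> \<le> 1 / q ^ (m - i)" using z q by (intro divide_left_mono power_mono) auto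
      finally have "norm (coeff P i) * (\<bar>z\<bar> ^ i / (q - z) ^ m) \<le> norm (coeff P i) * (1 / q ^ (m - i))"
        by (intro mult_left_mono) auto
      then show "norm (coeff P i * of_real z ^ i / (of_real q - of_real z) ^ m) \<le> norm (coeff P i) * (1 / q ^ (m - i))"
        by (simp add: norm_mult norm_divide norm_power n)
    qed
    finally show ?thesis .
  qed
  then show ?thesis by blast
qed

lemma rat_error_terms_bdd:
  assumes "r \<in> rat_class m q" "q > 0" "t > 0"
  shows "bdd_above ((\<lambda>z. norm (exp (complex_of_real (t * z)) - r (of_real z))) ` {..0})"
proof -
  obtain C where C: "\<And>z. z \<le> 0 \<Longrightarrow> norm (r (complex_of_real z)) \<le> C"
    using rat_class_bounded[OF assms(1,2)] by blast
  have "norm (exp (complex_of_real (t * z)) - r (of_real z)) \<le> 1 + C" if "z \<le> 0" for z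
  proof -
    have "norm (exp (complex_of_real (t * z))) \<le> 1"
      using that assms(3) by (simp add: norm_exp_eq_Re mult_nonneg_nonpos)
    then show ?thesis using C[OF that] norm_triangle_ineq4[of "exp (complex_of_real (t * z))" "r (of_real z)"] by linarith
  qed
  then show ?thesis by (intro bdd_aboveI[of _ "1 + C"]) auto
qed

lemma rat_class_nonempty: "rat_class m q \<noteq> {}"
proof -
  have "(\<lambda>z. poly 0 z / (of_real q - z) ^ m) \<in> rat_class m q"
    unfolding rat_class_def by (rule CollectI, rule exI[of _ 0]) simp
  then show ?thesis by blast
qed

lemma rat_error_le:
  assumes r: "r \<in> rat_class m q" and qt: "q > 0" "t > 0"
    and M: "\<And>z. z \<le> 0 \<Longrightarrow> norm (exp (complex_of_real (t * z)) - r (of_real z)) \<le> M"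
  shows "rat_error m t q \<le> M"
proof -
  let ?err = "\<lambda>r. SUP z \<in> {..0::real}. norm (exp (complex_of_real (t * z)) - r (of_real z))"
  have "0 \<le> ?err r" if "r \<in> rat_class m q" for r
  proof -
    have "norm (exp (complex_of_real (t * 0)) - r (of_real 0)) \<le> ?err r"
      by (rule cSUP_upper[OF _ rat_error_terms_bdd[OF that qt]]) simp
    then show ?thesis using norm_ge_zero order_trans by blast
  qed
  then have "bdd_below (?err ` rat_class m q)"
    by (intro bdd_belowI2[where m = 0])
  then have "rat_error m t q \<le> (SUP z \<in> {..0::real}. norm (exp (complex_of_real (t * z)) - r (of_real z)))"
    unfolding rat_error_def using r by (intro cINF_lower)
  also have "\<dots> \<le> M" using M by (intro cSUP_least) auto
  finally show ?thesis .
qed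

lemma rat_error_ge:
  assumes qt: "q > 0" "t > 0"
    and M: "\<And>r E. r \<in> rat_class m q \<Longrightarrow> (\<And>z. z \<le> 0 \<Longrightarrow> norm (exp (complex_of_real (t * z)) - r (of_real z)) \<le> E) \<Longrightarrow> M \<le> E"
  shows "M \<le> rat_error m t q"
  unfolding rat_error_def
proof (rule cINF_greatest[OF rat_class_nonempty])
  fix r assume r: "r \<in> rat_class m q"
  show "M \<le> (SUP z \<in> {..0::real}. norm (exp (complex_of_real (t * z)) - r (of_real z)))"
    by (rule M[OF r], rule cSUP_upper[OF _ rat_error_terms_bdd[OF r qt]]) simp
qed

text \<open>
  The competitor is the Chebyshev series truncated at degree \<open>m\<close>. Its coefficients are read off from
  \<open>cayley_geometric\<close> after integration against the Gaussian on the line \<open>Im u = a\<close>, and \<open>cayley_gap\<close> bounds what was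
  cut off, uniformly in \<open>z\<close>.
\<close>
lemma rat_error_upper:
  assumes q: "q > 0" and t: "t > 0" and a: "a > 0"
  shows "rat_error m t q \<le>
    (LINT x|lborel. norm (exp (- of_real (t * q) * (Complex x a)\<^sup>2) * cayley (Complex x a) ^ m)) / (pi * a)"
proof -
  define s where "s = t * q"
  have s: "s > 0" using q t by (simp add: s_def)
  let ?u = "\<lambda>x. Complex x a"
  let ?e = "\<lambda>x. exp (- complex_of_real s * (?u x)\<^sup>2)"
  let ?p = "\<lambda>x. 1 - \<i> * ?u x"
  have p: "norm (?p x) \<ge> 1" "?p x \<noteq> 0" for x using cayley_den[of "?u x"] a by auto
  have v1: "norm (cayley (?u x)) \<le> 1" for x using norm_cayley_le_1[of "?u x"] a by simp
  have cont: "continuous_on UNIV (\<lambda>x. cayley (?u x))"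
    unfolding cayley_def using p(2) by (intro continuous_intros complex_line_continuous) auto
  define A where "A = (\<lambda>k. LINT x|lborel. ?e x * (cayley (?u x) ^ k / (?p x)\<^sup>2))"
  define A0 where "A0 = (LINT x|lborel. ?e x * (1 / ?p x))"
  have iA: "integrable lborel (\<lambda>x. ?e x * (cayley (?u x) ^ k / (?p x)\<^sup>2))" for k
  proof (rule gaussian_line_integrable[OF s, where C = 1 and h = "\<lambda>u. cayley u ^ k / (1 - \<i> * u)\<^sup>2"])
    show "continuous_on UNIV (\<lambda>x. cayley (?u x) ^ k / (?p x)\<^sup>2)"
      using p(2) cont by (intro continuous_intros complex_line_continuous) auto
    show "norm (cayley (?u x) ^ k / (?p x)\<^sup>2) \<le> 1" for x
      unfolding norm_divide norm_power using frac_le[of 1 "norm (cayley (?u x)) ^ k" 1 "(norm (?p x))\<^sup>2"] p(1)[of x] v1[of x]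
      by (simp add: power_le_one one_le_power)
  qed
  have iA0: "integrable lborel (\<lambda>x. ?e x * (1 / ?p x))"
  proof (rule gaussian_line_integrable[OF s, where C = 1 and h = "\<lambda>u. 1 / (1 - \<i> * u)"])
    show "continuous_on UNIV (\<lambda>x. 1 / ?p x)"
      using p(2) by (intro continuous_intros complex_line_continuous) auto
    show "norm (1 / ?p x) \<le> 1" for x using p(1)[of x] by (simp add: norm_divide divide_le_eq)
  qed
  have iC: "integrable lborel (\<lambda>x. ?e x * (\<i> / (2 * (?u x + of_real y))))" for y
  proof (rule gaussian_line_integrable[OF s, where C = "1 / (2 * a)" and h = "\<lambda>u. \<i> / (2 * (u + of_real y))"])
    have n: "norm (?u x + of_real y) \<ge> a" for x using abs_Im_le_cmod[of "?u x + of_real y"] a by simp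
    then have "?u x + of_real y \<noteq> 0" for x using a by (metis norm_zero not_le)
    then have "2 * (?u x + of_real y) \<noteq> 0" for x by (metis mult_eq_0_iff zero_neq_numeral)
    then show "continuous_on UNIV (\<lambda>x. \<i> / (2 * (?u x + of_real y)))"
      by (intro continuous_intros complex_line_continuous ballI)
    show "norm (\<i> / (2 * (?u x + of_real y))) \<le> 1 / (2 * a)" for x
    proof -
      have "norm (\<i> / (2 * (?u x + of_real y))) = 1 / (2 * norm (?u x + of_real y))"
        by (simp only: norm_divide norm_mult norm_ii norm_numeral)
      then show ?thesis using n[of x] a by (simp add: frac_le)
    qed
  qed
  define Rem where "Rem = (\<lambda>y x. cayley (?u x) ^ m * (cayley (of_real y) ^ Suc m / ((1 - cayley (?u x) * cayley (of_real y)) * (?p x)\<^sup>2)))"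
  have geo: "?e x * (\<i> / (2 * (?u x + of_real y))) = ?e x * (1 / ?p x) / 2
      + (\<Sum>k<m. ?e x * (cayley (?u x) ^ k / (?p x)\<^sup>2) * cayley (of_real y) ^ Suc k) + ?e x * Rem y x" for x y
  proof -
    have "Im (?u x) > 0" using a by simp
    then show ?thesis
      unfolding Rem_def cayley_geometric[OF \<open>Im (?u x) > 0\<close>, of y m]
      unfolding distrib_left sum_distrib_left
      by (intro arg_cong2[of _ _ _ _ "(+)"] sum.cong refl) simp_all
  qed
  have iS: "integrable lborel (\<lambda>x. \<Sum>k<m. ?e x * (cayley (?u x) ^ k / (?p x)\<^sup>2) * cayley (of_real y) ^ Suc k)" for y
    by (intro Bochner_Integration.integrable_sum integrable_mult_left iA)
  have iA0': "integrable lborel (\<lambda>x. ?e x * (1 / ?p x) / 2)"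
    by (intro integrable_divide iA0)
  have iR: "integrable lborel (\<lambda>x. ?e x * Rem y x)" for y
  proof -
    have solve: "R = X - A - S" if "X = A + S + R" for X A S R :: complex using that by simp
    have "(\<lambda>x. ?e x * Rem y x) = (\<lambda>x. ?e x * (\<i> / (2 * (?u x + of_real y))) - ?e x * (1 / ?p x) / 2
      - (\<Sum>k<m. ?e x * (cayley (?u x) ^ k / (?p x)\<^sup>2) * cayley (of_real y) ^ Suc k))"
      by (rule ext, rule solve, rule geo)
    then show ?thesis
      by (simp only:) (intro Bochner_Integration.integrable_diff iC iA0' iS)
  qed
  have half: "(LINT x|lborel. ?e x * (\<i> / (2 * (?u x + of_real y)))) = A0 / 2 + (\<Sum>k<m. A k * cayley (of_real y) ^ Suc k)
      + (LINT x|lborel. ?e x * Rem y x)" for y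
  proof -
    have "(LINT x|lborel. (\<Sum>k<m. ?e x * (cayley (?u x) ^ k / (?p x)\<^sup>2) * cayley (of_real y) ^ Suc k))
        = (\<Sum>k<m. A k * cayley (of_real y) ^ Suc k)"
      unfolding A_def by (subst Bochner_Integration.integral_sum) (intro integrable_mult_left iA, simp only: integral_mult_left_zero)
    moreover have "(LINT x|lborel. ?e x * (1 / ?p x) / 2) = A0 / 2"
      unfolding A0_def by (rule integral_divide_zero)
    ultimately show ?thesis
      unfolding geo by (simp only: Bochner_Integration.integral_add[OF Bochner_Integration.integrable_add[OF iA0' iS] iR]
          Bochner_Integration.integral_add[OF iA0' iS])
  qed
  have full: "of_real pi * exp (- of_real (s * y\<^sup>2)) = A0 + (\<Sum>k<m. A k * (cayley (of_real y) ^ Suc k + (1 / cayley (of_real y)) ^ Suc k))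
      + (LINT x|lborel. ?e x * Rem y x + ?e x * Rem (- y) x)" for y :: real
  proof -
    have "of_real pi * exp (- of_real (s * y\<^sup>2)) = \<i> / 2 * (- 2 * pi * \<i> * exp (- of_real (s * y\<^sup>2)))"
    proof -
      have gen: "of_real P * E = \<i> / 2 * (of_real (- 2 * P) * \<i> * E)" for P and E :: complex
        by (simp add: complex_eq_iff)
      show ?thesis by (rule gen)
    qed
    also have "\<dots> = \<i> / 2 * (LINT x|lborel. ?e x * (1 / (?u x - of_real y) + 1 / (?u x + of_real y)))"
      by (simp only: gaussian_cauchy_formula[OF s a])
    also have "\<dots> = (LINT x|lborel. \<i> / 2 * (?e x * (1 / (?u x - of_real y) + 1 / (?u x + of_real y))))"
      by (rule integral_mult_right_zero[symmetric])
    also have "\<dots> = (LINT x|lborel. ?e x * (\<i> / (2 * (?u x + of_real y))) + ?e x * (\<i> / (2 * (?u x + of_real (- y)))))"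
    proof -
      have "\<i> / 2 * (E * (1 / U + 1 / V)) = E * (\<i> / (2 * V)) + E * (\<i> / (2 * U))" for E U V :: complex
        by (simp add: distrib_left mult.commute add.commute)
      then show ?thesis by (simp only: of_real_minus add_uminus_conv_diff)
    qed
    also have "\<dots> = (LINT x|lborel. ?e x * (\<i> / (2 * (?u x + of_real y)))) + (LINT x|lborel. ?e x * (\<i> / (2 * (?u x + of_real (- y)))))"
      by (intro Bochner_Integration.integral_add iC)
    also have "\<dots> = (A0 / 2 + (\<Sum>k<m. A k * cayley (of_real y) ^ Suc k) + (LINT x|lborel. ?e x * Rem y x))
       + (A0 / 2 + (\<Sum>k<m. A k * (1 / cayley (of_real y)) ^ Suc k) + (LINT x|lborel. ?e x * Rem (- y) x))"
    proof -
      have "(LINT x|lborel. ?e x * (\<i> / (2 * (?u x + of_real (- y))))) =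
          A0 / 2 + (\<Sum>k<m. A k * (1 / cayley (of_real y)) ^ Suc k) + (LINT x|lborel. ?e x * Rem (- y) x)"
        using half[of "- y"] by (simp only: of_real_minus cayley_minus_real)
      then show ?thesis by (simp only: half[of y])
    qed
    also have "\<dots> = A0 + (\<Sum>k<m. A k * (cayley (of_real y) ^ Suc k + (1 / cayley (of_real y)) ^ Suc k))
      + ((LINT x|lborel. ?e x * Rem y x) + (LINT x|lborel. ?e x * Rem (- y) x))"
    proof -
      have "A / 2 + S + R + (A / 2 + S' + R') = A + (S + S') + (R + R')" for A S R S' R' :: complex by simp
      then show ?thesis by (simp only: distrib_left sum.distrib)
    qed
    also have "(LINT x|lborel. ?e x * Rem y x) + (LINT x|lborel. ?e x * Rem (- y) x) = (LINT x|lborel. ?e x * Rem y x + ?e x * Rem (- y) x)"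
      by (rule Bochner_Integration.integral_add[OF iR iR, symmetric])
    finally show ?thesis .
  qed
  let ?K = "\<lambda>x. norm (?e x * cayley (?u x) ^ m)"
  have iK: "integrable lborel ?K"
    by (intro integrable_norm gaussian_line_integrable[OF s, where C = 1 and h = "\<lambda>u. cayley u ^ m"] continuous_intros cont)
       (use v1 in \<open>auto simp: norm_power power_le_one\<close>)
  have rem_bound: "norm (LINT x|lborel. ?e x * Rem y x + ?e x * Rem (- y) x) \<le> (LINT x|lborel. ?K x) / a" for y
  proof -
    have w: "norm (cayley (complex_of_real y)) = 1" for y by (rule norm_cayley_real)
    have R: "norm (Rem y x) \<le> norm (cayley (?u x)) ^ m / (2 * a)" for y x
    proof -
      have "1 - norm (cayley (?u x)) \<le> norm (1 - cayley (?u x) * cayley (of_real y))"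
        using norm_triangle_ineq2[of 1 "cayley (?u x) * cayley (of_real y)"] w[of y] by (simp add: norm_mult)
      then have "(norm (?p x))\<^sup>2 * (1 - norm (cayley (?u x))) \<le> (norm (?p x))\<^sup>2 * norm (1 - cayley (?u x) * cayley (of_real y))"
        by (intro mult_left_mono) auto
      then have "2 * a \<le> norm ((1 - cayley (?u x) * cayley (of_real y)) * (?p x)\<^sup>2)"
        using cayley_gap[of "?u x"] a by (simp add: norm_mult norm_power mult.commute)
      then have "norm (cayley (?u x)) ^ m / norm ((1 - cayley (?u x) * cayley (of_real y)) * (?p x)\<^sup>2) \<le> norm (cayley (?u x)) ^ m / (2 * a)"
        using a by (intro divide_left_mono mult_pos_pos) auto
      then show ?thesis unfolding Rem_def by (simp only: norm_mult norm_divide norm_power w) simp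
    qed
    have "norm (LINT x|lborel. ?e x * Rem y x + ?e x * Rem (- y) x) \<le> (LINT x|lborel. norm (?e x * Rem y x + ?e x * Rem (- y) x))"
      by (rule integral_norm_bound)
    also have "\<dots> \<le> (LINT x|lborel. ?K x / a)"
    proof (rule integral_mono)
      show "integrable lborel (\<lambda>x. norm (?e x * Rem y x + ?e x * Rem (- y) x))"
        by (intro integrable_norm Bochner_Integration.integrable_add iR)
      show "integrable lborel (\<lambda>x. ?K x / a)" using iK by simp
      show "norm (?e x * Rem y x + ?e x * Rem (- y) x) \<le> ?K x / a" for x
      proof -
        have "norm (Rem y x + Rem (- y) x) \<le> norm (cayley (?u x)) ^ m / a"
          using R[of y x] R[of "-y" x] norm_triangle_ineq[of "Rem y x" "Rem (- y) x"] by simp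
        then have "norm (?e x) * norm (Rem y x + Rem (- y) x) \<le> norm (?e x) * (norm (cayley (?u x)) ^ m / a)"
          by (intro mult_left_mono) auto
        then show ?thesis by (simp only: norm_mult norm_power times_divide_eq_right flip: distrib_left)
      qed
    qed
    finally show ?thesis by simp
  qed
  obtain T :: "nat \<Rightarrow> complex poly" where T: "\<And>k. degree (T k) \<le> k"
      "\<And>k w. w \<noteq> 0 \<Longrightarrow> poly (T k) ((w + 1 / w) / 2) = w ^ k + (1 / w) ^ k"
    using chebyshev_exists by metis
  (* the truncated series as a polynomial in (q + z) / (q - z) *)
  define S where "S = smult (1 / of_real pi) ([:A0:] + (\<Sum>k<m. smult (A k) (T (Suc k))))"
  have "degree S \<le> m"
  proof -
    have "degree (smult (A k) (T (Suc k))) \<le> m" if "k < m" for k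
      using degree_smult_le[of "A k" "T (Suc k)"] T(1)[of "Suc k"] that by simp
    then have "degree (\<Sum>k<m. smult (A k) (T (Suc k))) \<le> m" by (intro degree_sum_le) auto
    then have "degree ([:A0:] + (\<Sum>k<m. smult (A k) (T (Suc k)))) \<le> m" by (intro degree_add_le) auto
    then show ?thesis unfolding S_def using degree_smult_le order_trans by blast
  qed
  then obtain r where r: "r \<in> rat_class m q" "\<And>z. z \<noteq> of_real q \<Longrightarrow> r z = poly S ((of_real q + z) / (of_real q - z))"
    using rat_class_of_cayley_poly by blast
  show ?thesis
  proof (rule rat_error_le[OF r(1) q t])
    fix z :: real assume z: "z \<le> 0"
    define y where "y = sqrt (- z / q)"
    have y2: "y\<^sup>2 = - z / q" using z q by (simp add: y_def divide_nonpos_pos)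
    have sy: "s * y\<^sup>2 = - (t * z)" unfolding y2 s_def using q by simp
    let ?w = "cayley (of_real y)"
    have w0: "?w \<noteq> 0" using norm_cayley_real[of y] by auto
    have X: "(of_real q + of_real z) / (of_real q - of_real z) = (?w + 1 / ?w) / 2"
    proof -
      have py: "1 - \<i> * complex_of_real y \<noteq> 0" "1 + \<i> * complex_of_real y \<noteq> 0" by (auto simp: complex_eq_iff)
      have "(?w + 1 / ?w) / 2 = (1 - of_real (y\<^sup>2)) / (1 + of_real (y\<^sup>2))"
      proof -
        have d: "(1 - \<i> * complex_of_real y) * (1 + \<i> * of_real y) = 1 + of_real (y\<^sup>2)"
          by (simp add: algebra_simps power2_eq_square)
        have "?w + 1 / ?w = ((1 + \<i> * of_real y)\<^sup>2 + (1 - \<i> * of_real y)\<^sup>2) / ((1 - \<i> * complex_of_real y) * (1 + \<i> * of_real y))"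
          unfolding cayley_def using py by (simp add: add_frac_eq power2_eq_square)
        also have "(1 + \<i> * complex_of_real y)\<^sup>2 + (1 - \<i> * of_real y)\<^sup>2 = 2 * (1 - of_real (y\<^sup>2))"
          by (simp add: algebra_simps power2_eq_square)
        finally have sum: "?w + 1 / ?w = 2 * (1 - of_real (y\<^sup>2)) / (1 + of_real (y\<^sup>2))" unfolding d .
        have "2 * A / D / 2 = A / D" for A D :: complex by simp
        then show ?thesis unfolding sum .
      qed
      also have "\<dots> = of_real ((1 - y\<^sup>2) / (1 + y\<^sup>2))" by simp
      also have "(1 - y\<^sup>2) / (1 + y\<^sup>2) = (q + z) / (q - z)"
        unfolding y2 using q z by (simp add: field_simps)
      finally show ?thesis by (simp only: of_real_divide of_real_add of_real_diff)
    qed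
    have "z \<noteq> q" using z q by simp
    then have rz: "r (of_real z) = 1 / of_real pi * (A0 + (\<Sum>k<m. A k * (?w ^ Suc k + (1 / ?w) ^ Suc k)))"
      unfolding r(2)[of "of_real z", unfolded of_real_eq_iff, OF \<open>z \<noteq> q\<close>] X
      by (simp only: S_def poly_smult poly_add poly_sum T(2)[OF w0] poly_pCons poly_0 mult_zero_right add_0_right)
    have "of_real pi * (exp (complex_of_real (t * z)) - r (of_real z)) = (LINT x|lborel. ?e x * Rem y x + ?e x * Rem (- y) x)"
      using full[of y] unfolding sy rz by (simp add: right_diff_distrib)
    then have "norm (of_real pi * (exp (complex_of_real (t * z)) - r (of_real z))) \<le> (LINT x|lborel. ?K x) / a"
      using rem_bound[of y] by simp
    then have "pi * norm (exp (complex_of_real (t * z)) - r (of_real z)) \<le> (LINT x|lborel. ?K x) / a"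
      by (simp add: norm_mult)
    then show "norm (exp (complex_of_real (t * z)) - r (of_real z))
       \<le> (LINT x|lborel. norm (exp (- of_real (t * q) * (Complex x a)\<^sup>2) * cayley (Complex x a) ^ m)) / (pi * a)"
      unfolding s_def using a by (simp add: field_simps)
  qed
qed


section \<open>Lower bound: functionals that annihilate the rational class\<close>

lemma integrable_inverse_one_plus_square: "integrable lborel (\<lambda>x::real. 1 / (1 + x\<^sup>2))"
  and integral_inverse_one_plus_square: "(LINT x|lborel. 1 / (1 + x\<^sup>2)) = pi"
  using integrable_inverse_1_plus_square LBINT_inverse_1_plus_square
  by (simp_all add: set_integrable_def interval_lebesgue_integral_def set_lebesgue_integral_def inverse_eq_divide)

lemma norm_one_minus_ii: "norm (1 - \<i> * complex_of_real x) = sqrt (1 + x\<^sup>2)"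
  by (simp add: cmod_def)

lemma one_minus_ii_nonzero: "1 - \<i> * complex_of_real x \<noteq> 0"
  using cayley_den[of "of_real x"] by simp

lemma integrable_inverse_power_line:
  assumes "n \<ge> 2"
  shows "integrable lborel (\<lambda>x. 1 / (1 - \<i> * complex_of_real x) ^ n)"
proof (rule Bochner_Integration.integrable_bound[OF integrable_inverse_one_plus_square])
  show "(\<lambda>x. 1 / (1 - \<i> * complex_of_real x) ^ n) \<in> borel_measurable lborel"
    using one_minus_ii_nonzero by (auto intro!: borel_measurable_continuous_onI continuous_intros)
  show "AE x in lborel. norm (1 / (1 - \<i> * complex_of_real x) ^ n) \<le> norm (1 / (1 + x\<^sup>2))"
  proof (intro AE_I2)
    fix x :: real
    let ?p = "norm (1 - \<i> * complex_of_real x)"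
    have "?p \<ge> 1" using cayley_den[of "of_real x"] by simp
    then have "?p ^ 2 \<le> ?p ^ n" using assms by (intro power_increasing)
    moreover have "?p ^ 2 = 1 + x\<^sup>2" unfolding norm_one_minus_ii by simp
    moreover have "1 + x\<^sup>2 > 0" by (simp add: add_pos_nonneg)
    ultimately have "1 / ?p ^ n \<le> 1 / (1 + x\<^sup>2)" by (intro divide_left_mono) auto
    then show "norm (1 / (1 - \<i> * complex_of_real x) ^ n) \<le> norm (1 / (1 + x\<^sup>2))"
      by (simp add: norm_divide norm_power)
  qed
qed

text \<open>
  The primitive is a multiple of the power with exponent \<open>n - 1\<close>, which is positive, and vanishes at both ends.
\<close>
lemma integral_inverse_power_line:
  assumes n: "n \<ge> 2"
  shows "(LINT x|lborel. 1 / (1 - \<i> * complex_of_real x) ^ n) = 0"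
proof -
  obtain k where k: "n = Suc (Suc k)" using n by (metis Suc_le_D numeral_2_eq_2 Suc_le_mono)
  define G where "G = (\<lambda>x::real. 1 / (of_nat (Suc k) * \<i> * (1 - \<i> * of_real x) ^ Suc k))"
  have deriv: "(G has_vector_derivative 1 / (1 - \<i> * of_real x) ^ n) (at x within S)" for x S
  proof -
    let ?p = "1 - \<i> * complex_of_real x"
    have p: "?p \<noteq> 0" by (rule one_minus_ii_nonzero)
    have D: "((\<lambda>z. (1 - \<i> * z) ^ Suc k) has_field_derivative (1 + of_nat k) * (- \<i> * ?p ^ k)) (at (of_real x))"
      by (rule DERIV_power_Suc) (auto intro!: derivative_eq_intros)
    have "((\<lambda>z. (1 / (of_nat (Suc k) * \<i>)) * inverse ((1 - \<i> * z) ^ Suc k)) has_field_derivative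
        (1 / (of_nat (Suc k) * \<i>)) * - (inverse (?p ^ Suc k) * ((1 + of_nat k) * (- \<i> * ?p ^ k)) * inverse (?p ^ Suc k))) (at (of_real x))"
      by (rule DERIV_cmult, rule DERIV_inverse'[OF D]) (use p in simp)
    moreover have "(1 / (of_nat (Suc k) * \<i>)) * - (inverse (?p ^ Suc k) * ((1 + of_nat k) * (- \<i> * ?p ^ k)) * inverse (?p ^ Suc k)) = 1 / ?p ^ n"
    proof -
      have gen: "(1 / (K * \<i>)) * - (inverse (P * Q) * (K * (- \<i> * Q)) * inverse (P * Q)) = 1 / (P * (P * Q))"
        if "K \<noteq> 0" "P \<noteq> 0" "Q \<noteq> 0" for K P Q :: complex
        using that by (simp add: field_simps)
      have K: "1 + of_nat k = (of_nat (Suc k) :: complex)" by simp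
      show ?thesis unfolding K k power_Suc by (rule gen) (use p in \<open>simp_all only: of_nat_neq_0 power_not_zero not_False_eq_True\<close>)
    qed
    ultimately have "((\<lambda>z. 1 / (of_nat (Suc k) * \<i> * (1 - \<i> * z) ^ Suc k)) has_field_derivative 1 / ?p ^ n) (at (of_real x))"
      by (simp add: divide_inverse mult_ac)
    from has_vector_derivative_real_field[OF this] show ?thesis unfolding G_def .
  qed
  have fin: "integral {- real j..real j} (\<lambda>x. 1 / (1 - \<i> * complex_of_real x) ^ n) = G (real j) - G (- real j)" for j
    by (intro integral_unique fundamental_theorem_of_calculus deriv) simp
  have Gbound: "norm (G x) \<le> 1 / \<bar>x\<bar>" if "\<bar>x\<bar> \<ge> 1" for x
  proof -
    have p: "norm (1 - \<i> * complex_of_real x) \<ge> \<bar>x\<bar>"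
      using abs_Im_le_cmod[of "1 - \<i> * complex_of_real x"] by simp
    then have "\<bar>x\<bar> \<le> norm (1 - \<i> * complex_of_real x) ^ Suc k"
      using that self_le_power[of "norm (1 - \<i> * complex_of_real x)" "Suc k"] by linarith
    then have "1 * \<bar>x\<bar> \<le> real (Suc k) * norm (1 - \<i> * complex_of_real x) ^ Suc k"
      by (intro mult_mono) auto
    then have "1 / (real (Suc k) * norm (1 - \<i> * complex_of_real x) ^ Suc k) \<le> 1 / \<bar>x\<bar>"
      using that by (intro divide_left_mono) auto
    moreover have "norm (G x) = 1 / (real (Suc k) * norm (1 - \<i> * complex_of_real x) ^ Suc k)"
      by (simp only: G_def norm_divide norm_mult norm_power norm_ii norm_of_nat norm_one mult_1_right)
    ultimately show ?thesis by simp
  qed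
  have "(\<lambda>j. G (real j) - G (- real j)) \<longlonglongrightarrow> 0"
  proof (rule Lim_null_comparison)
    show "eventually (\<lambda>j. norm (G (real j) - G (- real j)) \<le> 2 / real j) sequentially"
    proof (rule eventually_mono[OF eventually_ge_at_top[of 1]])
      fix j :: nat assume "1 \<le> j"
      then show "norm (G (real j) - G (- real j)) \<le> 2 / real j"
        using Gbound[of "real j"] Gbound[of "- real j"] norm_triangle_ineq4[of "G (real j)" "G (- real j)"] by simp
    qed
    show "(\<lambda>j. 2 / real j) \<longlonglongrightarrow> 0" by real_asymp
  qed
  moreover have "(\<lambda>j. G (real j) - G (- real j)) \<longlonglongrightarrow> (LINT x|lborel. 1 / (1 - \<i> * complex_of_real x) ^ n)"
    using integral_symmetric_intervals_tendsto[OF integrable_inverse_power_line[OF n]] unfolding fin .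
  ultimately show ?thesis using LIMSEQ_unique by blast
qed

text \<open>
  This is \<open>v^(m+1) (v - c) / (1 + u\<^sup>2)\<close> with \<open>v = cayley u\<close>; in this form the common factor \<open>1 + i u\<close> is cancelled, so
  that no singularity is left at \<open>u = i\<close>.
\<close>
definition annihilator :: "nat \<Rightarrow> complex \<Rightarrow> complex \<Rightarrow> complex" where
  "annihilator m c u = (1 + \<i> * u) ^ m / (1 - \<i> * u) ^ (m + 2) * (cayley u - c)"

lemma norm_annihilator:
  assumes "Im u \<ge> 0"
  shows "norm (annihilator m c u) \<le> (1 + norm c) / (norm (1 - \<i> * u))\<^sup>2"
proof -
  have p: "1 - \<i> * u \<noteq> 0" "norm (1 - \<i> * u) \<ge> 1" using cayley_den[OF assms] by auto
  have "norm (annihilator m c u) = norm (cayley u) ^ m / (norm (1 - \<i> * u))\<^sup>2 * norm (cayley u - c)"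
    by (simp add: annihilator_def norm_mult norm_divide norm_power cayley_def power_divide power_add power2_eq_square)
  also have "\<dots> \<le> 1 / (norm (1 - \<i> * u))\<^sup>2 * (1 + norm c)"
  proof (intro mult_mono divide_right_mono)
    show "norm (cayley u) ^ m \<le> 1" using norm_cayley_le_1[OF assms] by (simp add: power_le_one)
    show "norm (cayley u - c) \<le> 1 + norm c"
      using norm_triangle_ineq4[of "cayley u" c] norm_cayley_le_1[OF assms] by linarith
  qed auto
  finally show ?thesis by simp
qed

text \<open>
  With \<open>p = 1 - i x\<close>, one half of the denominator \<open>(1 + x\<^sup>2)^m\<close> of the rational function cancels against
  \<open>(1 + i x)^m\<close>, and \<open>- x\<^sup>2 = (1 - p)\<^sup>2\<close>. So the integrand is a combination of powers \<open>p^(-n)\<close>; the degree bound on the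
  numerator is what keeps \<open>n \<ge> 2\<close>.
\<close>
lemma annihilator_rat_class:
  assumes r: "r \<in> rat_class m q" and q: "q > 0"
  shows "integrable lborel (\<lambda>x. r (of_real (- q * x\<^sup>2)) * annihilator m c (of_real x))"
    and "(LINT x|lborel. r (of_real (- q * x\<^sup>2)) * annihilator m c (of_real x)) = 0"
proof -
  obtain P where P: "degree P \<le> m" "r = (\<lambda>z. poly P z / (of_real q - z) ^ m)"
    using r by (auto simp: rat_class_def)
  define Q where "Q = pcompose P (smult (of_real q) ([:1, - 1:] ^ 2))"
  have "degree Q \<le> degree P * degree (smult (complex_of_real q) ([:1, - 1:] ^ 2))"
    unfolding Q_def by (rule degree_pcompose_le)
  also have "degree (smult (complex_of_real q) ([:1, - 1:] ^ 2)) \<le> 2"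
    using degree_smult_le[of "complex_of_real q" "[:1, - 1:] ^ 2"] degree_power_le[of "[:1, - 1::complex:]" 2] by simp
  finally have dQ: "degree Q \<le> 2 * m" using P(1) by (simp add: mult.commute mult_le_mono)
  define f where "f = (\<lambda>i x. coeff Q i / of_real q ^ m * (2 * (1 / (1 - \<i> * complex_of_real x) ^ (2 * m + 3 - i))
        - (1 + c) * (1 / (1 - \<i> * complex_of_real x) ^ (2 * m + 2 - i))))"
  have eq: "r (of_real (- q * x\<^sup>2)) * annihilator m c (of_real x) = (\<Sum>i\<le>2*m. f i x)" for x
  proof -
    let ?p = "1 - \<i> * complex_of_real x" and ?n = "1 + \<i> * complex_of_real x"
    have p: "?p \<noteq> 0" by (rule one_minus_ii_nonzero)
    have n: "?n \<noteq> 0" using one_minus_ii_nonzero[of "-x"] by simp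
    have q0: "complex_of_real q \<noteq> 0" using q by simp
    have num: "poly P (of_real (- q * x\<^sup>2)) = poly Q ?p"
      by (simp add: Q_def poly_pcompose power2_eq_square algebra_simps)
    have den: "of_real q - of_real (- q * x\<^sup>2) = of_real q * (?p * ?n)"
      by (simp add: power2_eq_square algebra_simps)
    have v: "cayley (of_real x) - c = 2 / ?p - (1 + c)"
      using p by (simp add: cayley_def field_simps)
    have "r (of_real (- q * x\<^sup>2)) * annihilator m c (of_real x)
       = poly Q ?p / (of_real q * (?p * ?n)) ^ m * (?n ^ m / ?p ^ (m + 2) * (2 / ?p - (1 + c)))"
      unfolding P(2) num den annihilator_def v ..
    also have "\<dots> = poly Q ?p * (1 / of_real q ^ m * (2 / ?p ^ (2 * m + 3) - (1 + c) / ?p ^ (2 * m + 2)))"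
    proof -
      have "S / (K * (A * B)) * (B / (A * P\<^sup>2) * (2 / P - e)) = S * (1 / K * (2 / (A * A * P\<^sup>2 * P) - e / (A * A * P\<^sup>2)))"
        if "K \<noteq> 0" "A \<noteq> 0" "B \<noteq> 0" "P \<noteq> 0" for S K A B P e :: complex
        using that by (simp add: field_simps)
      from this[of "of_real q ^ m" "?p ^ m" "?n ^ m" ?p "poly Q ?p" "1 + c"]
      show ?thesis using p n q0
        by (simp only: power_mult_distrib power_add mult_2 power_not_zero simp_thms numeral_3_eq_3 power_Suc2 numeral_2_eq_2)
           (simp add: power_add mult_2 power3_eq_cube power2_eq_square mult.assoc)
    qed
    also have "\<dots> = (\<Sum>i\<le>2*m. coeff Q i * ?p ^ i * (1 / of_real q ^ m * (2 / ?p ^ (2 * m + 3) - (1 + c) / ?p ^ (2 * m + 2))))"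
      unfolding poly_altdef_upto[OF dQ] sum_distrib_right ..
    also have "\<dots> = (\<Sum>i\<le>2*m. f i x)"
    proof (intro sum.cong refl)
      fix i assume i: "i \<in> {..2 * m}"
      have a: "?p ^ i / ?p ^ (2 * m + 3) = 1 / ?p ^ (2 * m + 3 - i)" "?p ^ i / ?p ^ (2 * m + 2) = 1 / ?p ^ (2 * m + 2 - i)"
        using i p by (simp_all add: power_diff)
      have "C * X * (1 / K * (2 / Y - e / Z)) = C / K * (2 * (X / Y) - e * (X / Z))" for C X K Y Z e :: complex
        by (simp add: algebra_simps)
      then show "coeff Q i * ?p ^ i * (1 / of_real q ^ m * (2 / ?p ^ (2 * m + 3) - (1 + c) / ?p ^ (2 * m + 2))) = f i x"
        unfolding f_def a[symmetric] .
    qed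
    finally show ?thesis .
  qed
  have ex: "2 * m + 3 - i \<ge> 2" "2 * m + 2 - i \<ge> 2" if "i \<le> 2 * m" for i using that by auto
  have fi: "integrable lborel (f i)" if "i \<le> 2 * m" for i
    unfolding f_def by (intro integrable_mult_right Bochner_Integration.integrable_diff integrable_inverse_power_line ex that)
  have f0: "(LINT x|lborel. f i x) = 0" if "i \<le> 2 * m" for i
  proof -
    have i1: "integrable lborel (\<lambda>x. 2 * (1 / (1 - \<i> * complex_of_real x) ^ (2 * m + 3 - i)))"
      and i2: "integrable lborel (\<lambda>x. (1 + c) * (1 / (1 - \<i> * complex_of_real x) ^ (2 * m + 2 - i)))"
      by (intro integrable_mult_right integrable_inverse_power_line ex that)+
    show ?thesis
      unfolding f_def integral_mult_right_zero Bochner_Integration.integral_diff[OF i1 i2]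
        integral_inverse_power_line[OF ex(1)[OF that]] integral_inverse_power_line[OF ex(2)[OF that]] by simp
  qed
  show "integrable lborel (\<lambda>x. r (of_real (- q * x\<^sup>2)) * annihilator m c (of_real x))"
    unfolding eq by (intro Bochner_Integration.integrable_sum fi) simp
  show "(LINT x|lborel. r (of_real (- q * x\<^sup>2)) * annihilator m c (of_real x)) = 0"
    unfolding eq by (subst Bochner_Integration.integral_sum) (auto simp: fi f0)
qed

lemma annihilator_line_shift:
  assumes s: "s > 0" and a: "a > 0"
  shows "integrable lborel (\<lambda>x. exp (- of_real s * (of_real x)\<^sup>2) * annihilator m c (of_real x))"
    and "(LINT x|lborel. exp (- of_real s * (of_real x)\<^sup>2) * annihilator m c (of_real x))
       = (LINT x|lborel. exp (- of_real s * (Complex x a)\<^sup>2) * annihilator m c (Complex x a))"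
proof -
  define F where "F = (\<lambda>u. exp (- of_real s * u\<^sup>2) * annihilator m c u)"
  have ann: "norm (annihilator m c u) \<le> 1 + norm c" if "Im u \<ge> 0" for u
  proof -
    have "(1 + norm c) / (norm (1 - \<i> * u))\<^sup>2 \<le> (1 + norm c) / 1"
      using cayley_den(1)[OF that] by (intro divide_left_mono) (auto simp: one_le_power intro: add_nonneg_nonneg)
    then show ?thesis using norm_annihilator[OF that, of m c] by simp
  qed
  have int: "integrable lborel (\<lambda>x. F (Complex x d))" if d: "d \<ge> 0" for d
    unfolding F_def
  proof (rule gaussian_line_integrable[OF s, where C = "1 + norm c"])
    have "1 - \<i> * Complex x d \<noteq> 0" for x using cayley_den(2)[of "Complex x d"] d by simp
    then show "continuous_on UNIV (\<lambda>x. annihilator m c (Complex x d))"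
      unfolding annihilator_def cayley_def by (intro continuous_intros complex_line_continuous ballI) auto
    show "norm (annihilator m c (Complex x d)) \<le> 1 + norm c" for x using ann d by simp
  qed
  have "(LINT x|lborel. F (Complex x 0)) - (LINT x|lborel. F (Complex x a)) = 0"
  proof (rule line_integrals_difference[where B = "\<lambda>R. (1 + norm c) * exp (s * a\<^sup>2) * exp (- s * R\<^sup>2)" and ?R0.0 = 0])
    show "((\<lambda>R. (1 + norm c) * exp (s * a\<^sup>2) * exp (- s * R\<^sup>2)) \<longlongrightarrow> 0) at_top" using gaussian_decay[OF s] .
  next
    fix R y :: real assume R: "0 \<le> R" and y: "0 \<le> y" "y \<le> a"
    have "norm (F (Complex r y)) \<le> (1 + norm c) * exp (s * a\<^sup>2) * exp (- s * R\<^sup>2)" if "r\<^sup>2 = R\<^sup>2" for r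
    proof -
      have "y\<^sup>2 \<le> a\<^sup>2" using y by (intro power_mono) auto
      then have "exp (s * y\<^sup>2) * exp (- s * R\<^sup>2) \<le> exp (s * a\<^sup>2) * exp (- s * R\<^sup>2)" using s by simp
      then have "exp (s * y\<^sup>2) * exp (- s * R\<^sup>2) * norm (annihilator m c (Complex r y)) \<le> exp (s * a\<^sup>2) * exp (- s * R\<^sup>2) * (1 + norm c)"
        using ann[of "Complex r y"] y by (intro mult_mono) auto
      then show ?thesis unfolding F_def norm_mult norm_exp_square that by (simp add: mult_ac)
    qed
    then show "norm (F (Complex R y)) \<le> (1 + norm c) * exp (s * a\<^sup>2) * exp (- s * R\<^sup>2) \<and>
               norm (F (Complex (- R) y)) \<le> (1 + norm c) * exp (s * a\<^sup>2) * exp (- s * R\<^sup>2)"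
      by simp
  next
    fix R :: real assume R: "R > 0"
    show "(F has_contour_integral 0) (rectpath (Complex (- R) 0) (Complex R a))"
    proof (rule Cauchy_theorem_convex_simple[of _ "{u. Im u > - 1}"])
      have nz: "1 - \<i> * u \<noteq> 0" if "Im u > - 1" for u
        using that by (auto simp: complex_eq_iff)
      show "F holomorphic_on {u. Im u > - 1}"
        unfolding F_def annihilator_def cayley_def using nz by (intro holomorphic_intros) auto
      show "convex {u. Im u > - 1}" by (rule convex_halfspace_Im_gt)
      show "path_image (rectpath (Complex (- R) 0) (Complex R a)) \<subseteq> {u. Im u > - 1}"
        using R a by (auto simp: path_image_rectpath)
    qed auto
  qed (use int a in auto)
  moreover have "Complex x 0 = of_real x" for x by (simp add: complex_eq_iff)
  ultimately show "integrable lborel (\<lambda>x. exp (- of_real s * (of_real x)\<^sup>2) * annihilator m c (of_real x))"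
    "(LINT x|lborel. exp (- of_real s * (of_real x)\<^sup>2) * annihilator m c (of_real x))
       = (LINT x|lborel. exp (- of_real s * (Complex x a)\<^sup>2) * annihilator m c (Complex x a))"
    using int[of 0] by (simp_all add: F_def)
qed

text \<open>
  A functional that annihilates the class sees only the error of approximation. Its norm is bounded by the
  integral of \<open>(1 + |c|) / (1 + x\<^sup>2)\<close>, and its value at the Gaussian may be computed on any line above the real one.
\<close>
lemma rat_error_lower:
  assumes q: "q > 0" and t: "t > 0" and a: "a > 0"
  shows "norm (LINT x|lborel. exp (- of_real (t * q) * (Complex x a)\<^sup>2) * annihilator m c (Complex x a))
         \<le> pi * (1 + norm c) * rat_error m t q"
proof -
  define s where "s = t * q"
  have s: "s > 0" using q t by (simp add: s_def)
  let ?L = "LINT x|lborel. exp (- of_real s * (Complex x a)\<^sup>2) * annihilator m c (Complex x a)"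
  have c0: "pi * (1 + norm c) > 0" by (simp add: add_pos_nonneg)
  have "norm ?L / (pi * (1 + norm c)) \<le> rat_error m t q"
  proof (rule rat_error_ge[OF q t])
    fix r E assume r: "r \<in> rat_class m q"
      and E: "\<And>z. z \<le> 0 \<Longrightarrow> norm (exp (complex_of_real (t * z)) - r (of_real z)) \<le> E"
    let ?f = "\<lambda>x. exp (- of_real s * (of_real x)\<^sup>2) * annihilator m c (of_real x)"
    let ?g = "\<lambda>x. r (of_real (- q * x\<^sup>2)) * annihilator m c (of_real x)"
    have E0: "E \<ge> 0" using E[of 0] norm_ge_zero order_trans by blast
    have fi: "integrable lborel ?f" by (rule annihilator_line_shift(1)[OF s a])
    have gi: "integrable lborel ?g" by (rule annihilator_rat_class(1)[OF r q])
    have bound: "norm (?f x - ?g x) \<le> E * (1 + norm c) * (1 / (1 + x\<^sup>2))" for x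
    proof -
      have "- q * x\<^sup>2 \<le> 0" using q by simp
      from E[OF this] have "norm (exp (- of_real s * (complex_of_real x)\<^sup>2) - r (of_real (- q * x\<^sup>2))) \<le> E"
        by (simp add: s_def mult_ac)
      moreover have "norm (annihilator m c (of_real x)) \<le> (1 + norm c) / (1 + x\<^sup>2)"
        using norm_annihilator[of "of_real x" m c] unfolding norm_one_minus_ii by simp
      ultimately have "norm (exp (- of_real s * (complex_of_real x)\<^sup>2) - r (of_real (- q * x\<^sup>2))) * norm (annihilator m c (of_real x))
         \<le> E * ((1 + norm c) / (1 + x\<^sup>2))" using E0 by (intro mult_mono) auto
      then show ?thesis
        by (simp add: left_diff_distrib[symmetric] norm_mult del: of_real_minus of_real_mult)
    qed
    have L: "?L = (LINT x|lborel. ?f x - ?g x)"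
      unfolding Bochner_Integration.integral_diff[OF fi gi] annihilator_line_shift(2)[OF s a]
        annihilator_rat_class(2)[OF r q] by simp
    have "norm ?L \<le> (LINT x|lborel. norm (?f x - ?g x))"
      unfolding L by (rule integral_norm_bound)
    also have "\<dots> \<le> (LINT x|lborel. E * (1 + norm c) * (1 / (1 + x\<^sup>2)))"
      by (intro integral_mono bound integrable_norm Bochner_Integration.integrable_diff fi gi
          integrable_mult_right integrable_inverse_one_plus_square)
    also have "\<dots> = E * (pi * (1 + norm c))"
      unfolding integral_mult_right_zero integral_inverse_one_plus_square by simp
    finally show "norm ?L / (pi * (1 + norm c)) \<le> E" using c0 by (simp only: pos_divide_le_eq)
  qed
  then show ?thesis using c0 unfolding s_def by (simp only: pos_divide_le_eq mult.commute)
qed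


section \<open>The line through the two saddle points\<close>

lemma single_peak_bound:
  fixes f :: "real \<Rightarrow> real"
  assumes deriv: "\<And>x. x > 0 \<Longrightarrow> (f has_real_derivative - (x - c) * \<rho> x) (at x)"
    and \<rho>: "\<And>x. x > 0 \<Longrightarrow> \<rho> x \<ge> 0" and c: "c > 0" and x: "x > 0"
  shows "f x \<le> f c"
proof -
  consider "x = c" | "x < c" | "c < x" by linarith
  then show ?thesis
  proof cases
    case 2
    then obtain z where "x < z" "z < c" "f c - f x = (c - x) * (- (z - c) * \<rho> z)"
      using MVT2[of x c f "\<lambda>x. - (x - c) * \<rho> x"] deriv x by (meson order_less_le_trans)
    moreover have "(c - x) * (- (z - c) * \<rho> z) \<ge> 0"
      using \<rho>[of z] calculation x by (intro mult_nonneg_nonneg) auto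
    ultimately show ?thesis by linarith
  next
    case 3
    then obtain z where z: "c < z" "z < x" "f x - f c = (x - c) * (- (z - c) * \<rho> z)"
      using MVT2[of c x f "\<lambda>x. - (x - c) * \<rho> x"] deriv c by (meson order_less_le_trans)
    moreover have "(x - c) * ((z - c) * \<rho> z) \<ge> 0"
      using \<rho>[of z] calculation c by (intro mult_nonneg_nonneg) auto
    moreover have "(x - c) * (- (z - c) * \<rho> z) = - ((x - c) * ((z - c) * \<rho> z))"
      by (simp add: algebra_simps)
    ultimately show ?thesis by linarith
  qed simp
qed

text \<open>
  The critical point in the first quadrant is \<open>\<zeta> = (1 + i b) / d\<close>. In the coordinate \<open>y = d u\<close> the two saddles are
  \<open>\<plusminus> b + i\<close>, and the line through them is \<open>y = x + i\<close>.
\<close>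
locale saddle =
  fixes d b :: real
  assumes d_pos: "d > 0" and b_pos: "b > 0" and circle: "d\<^sup>2 + b\<^sup>2 = 3"
begin

text \<open>
  The function \<open>exp (- s u\<^sup>2) v^m\<close> in the coordinate \<open>y = d u\<close>, for the value of \<open>s\<close> that puts the saddles at
  \<open>\<plusminus> b + i\<close>.
\<close>
definition wave :: "nat \<Rightarrow> complex \<Rightarrow> complex" where
  "wave m y = exp (- of_real (real m * d / (2 * (4 - d\<^sup>2))) * y\<^sup>2)
              * ((of_real d + \<i> * y) / (of_real d - \<i> * y)) ^ m"

abbreviation line_wave :: "nat \<Rightarrow> real \<Rightarrow> complex" where
  "line_wave m x \<equiv> wave m (of_real x + \<i>)"

text \<open>
  An exponent, per unit of \<open>m d\<close>, for the Gaussian that bounds the wave. Any sufficiently small multiple of \<open>b\<^sup>2\<close>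
  would do; the factor leaves room for the crude estimates in \<open>logsize_bound\<close>.
\<close>
definition decay :: real where
  "decay = b\<^sup>2 / 400"

text \<open>
  The logarithm of the modulus of the wave, divided by \<open>m\<close>, as a function of \<open>X = x\<^sup>2\<close>.
\<close>
definition logsize :: "real \<Rightarrow> real" where
  "logsize X = - (d / (2 * (4 - d\<^sup>2))) * (X - 1) + (ln (X + (1 - d)\<^sup>2) - ln (X + (1 + d)\<^sup>2)) / 2"

lemma d_b_facts: "4 - d\<^sup>2 > 1" "d\<^sup>2 = 3 - b\<^sup>2" "d\<^sup>2 < 3" "b\<^sup>2 < 3" "d < 2" "b < 2"
proof -
  have "d\<^sup>2 > 0" "b\<^sup>2 > 0" using d_pos b_pos by auto
  then show *: "4 - d\<^sup>2 > 1" "d\<^sup>2 = 3 - b\<^sup>2" "d\<^sup>2 < 3" "b\<^sup>2 < 3" using circle by linarith+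
  have "d\<^sup>2 < 2\<^sup>2" "b\<^sup>2 < 2\<^sup>2" using *(3,4) by auto
  then show "d < 2" "b < 2" by (auto intro: power2_less_imp_less)
qed

lemma decay_pos: "decay > 0"
  using b_pos by (simp add: decay_def)

lemma den_nonzero: "of_real d - \<i> * (of_real x + \<i>) \<noteq> 0"
  using d_pos by (auto simp: complex_eq_iff)

lemma norm_line_wave:
  assumes "x \<noteq> 0"
  shows "norm (line_wave m x) = exp (real m * logsize (x\<^sup>2))"
proof -
  have pos: "x\<^sup>2 + (1 - d)\<^sup>2 > 0" "x\<^sup>2 + (1 + d)\<^sup>2 > 0"
    using assms by (auto intro: add_pos_nonneg)
  have n: "norm (of_real d + \<i> * (of_real x + \<i>)) = sqrt (x\<^sup>2 + (1 - d)\<^sup>2)"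
          "norm (of_real d - \<i> * (of_real x + \<i>)) = sqrt (x\<^sup>2 + (1 + d)\<^sup>2)"
    by (auto simp: cmod_def power2_eq_square algebra_simps)
  have s: "sqrt X = exp (ln X / 2)" if "X > 0" for X :: real
    using that by (simp add: ln_sqrt[symmetric])
  have "norm (exp (- of_real (real m * d / (2 * (4 - d\<^sup>2))) * (of_real x + \<i>)\<^sup>2))
      = exp (real m * (- (d / (2 * (4 - d\<^sup>2))) * (x\<^sup>2 - 1)))"
    unfolding norm_exp_eq_Re by (simp add: power2_eq_square)
  moreover have "norm ((of_real d + \<i> * (of_real x + \<i>)) / (of_real d - \<i> * (of_real x + \<i>)))
      = exp ((ln (x\<^sup>2 + (1 - d)\<^sup>2) - ln (x\<^sup>2 + (1 + d)\<^sup>2)) / 2)"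
    unfolding norm_divide n s[OF pos(1)] s[OF pos(2)] by (simp add: exp_diff diff_divide_distrib)
  ultimately show ?thesis
    unfolding wave_def norm_mult norm_power
    by (simp only: exp_of_nat_mult[symmetric] mult_exp_exp logsize_def distrib_left)
qed

text \<open>
  The derivative of \<open>logsize\<close> is \<open>- (X - b\<^sup>2)\<close> times a positive function that decays like \<open>1 / X\<close>. The derivative of
  \<open>(X - b\<^sup>2)\<^sup>2 / (X + b\<^sup>2)\<close> is \<open>X - b\<^sup>2\<close> times a function of the same decay, so a small multiple of it can be added
  without moving the peak. This comparison function is smooth down to \<open>X = 0\<close>, unlike \<open>(|x| - b)\<^sup>2\<close>, which it
  dominates.
\<close>
lemma logsize_bound:
  assumes X: "X > 0"
  shows "logsize X + d * decay * ((X - b\<^sup>2)\<^sup>2 / (X + b\<^sup>2)) \<le> logsize (b\<^sup>2)"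
proof -
  let ?A = "\<lambda>X. X + (1 - d)\<^sup>2" and ?B = "\<lambda>X. X + (1 + d)\<^sup>2"
  define f where "f = (\<lambda>X. logsize X + d * decay * ((X - b\<^sup>2)\<^sup>2 / (X + b\<^sup>2)))"
  define \<rho> where "\<rho> = (\<lambda>X. d * ((X + 5 + d\<^sup>2) / (2 * (4 - d\<^sup>2) * (?A X * ?B X))
                          - decay * (X + 3 * b\<^sup>2) / (X + b\<^sup>2)\<^sup>2))"
  have "f X \<le> f (b\<^sup>2)"
  proof (rule single_peak_bound[where \<rho> = \<rho>, OF _ _ _ X])
    fix x :: real assume x: "x > 0"
    have pos: "?A x > 0" "?B x > 0" "x + b\<^sup>2 > 0" "4 - d\<^sup>2 > 0"
      using x b_pos d_b_facts(1) by (auto intro: add_pos_nonneg)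
    have AB: "?A x * ?B x = x\<^sup>2 + 2 * (1 + d\<^sup>2) * x + (1 - d\<^sup>2)\<^sup>2"
      by (simp add: power2_eq_square algebra_simps)
    have l: "((\<lambda>X. ln (?A X)) has_real_derivative 1 / ?A x) (at x)"
            "((\<lambda>X. ln (?B X)) has_real_derivative 1 / ?B x) (at x)"
            "((\<lambda>X. (X - b\<^sup>2)\<^sup>2 / (X + b\<^sup>2)) has_real_derivative
               (2 * (x - b\<^sup>2) * (x + b\<^sup>2) - (x - b\<^sup>2)\<^sup>2) / (x + b\<^sup>2)\<^sup>2) (at x)"
      using pos by (auto intro!: derivative_eq_intros simp: power2_eq_square)
    have halves: "(2 / u - 2 / v) / 4 = (1 / u - 1 / v) / 2" for u v :: real
      by (cases "u = 0"; cases "v = 0") (auto simp: field_simps)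
    have D0: "(f has_real_derivative - (d / (2 * (4 - d\<^sup>2))) + (1 / ?A x - 1 / ?B x) / 2
        + d * decay * ((2 * (x - b\<^sup>2) * (x + b\<^sup>2) - (x - b\<^sup>2)\<^sup>2) / (x + b\<^sup>2)\<^sup>2)) (at x)"
      unfolding f_def logsize_def by ((rule l derivative_eq_intros refl | simp)+) (simp only: halves, simp add: mult_ac)
    have D1: "- (d / (2 * (4 - d\<^sup>2))) + (1 / ?A x - 1 / ?B x) / 2 =
        - (x - b\<^sup>2) * (d * (x + 5 + d\<^sup>2) / (2 * (4 - d\<^sup>2) * (?A x * ?B x)))"
    proof -
      have BA: "?B x - ?A x = 4 * d"
        by (simp add: power2_eq_square algebra_simps)
      have "(1 / ?A x - 1 / ?B x) / 2 = (?B x - ?A x) / (?A x * ?B x) / 2"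
        using pos by (simp add: diff_frac_eq)
      then have e1: "(1 / ?A x - 1 / ?B x) / 2 = 2 * d / (?A x * ?B x)"
        unfolding BA by simp
      have e2: "- (d / (2 * (4 - d\<^sup>2))) + 2 * d / (?A x * ?B x)
         = d * (4 * (4 - d\<^sup>2) - ?A x * ?B x) / (2 * (4 - d\<^sup>2) * (?A x * ?B x))"
        using pos by (simp add: divide_simps) (simp add: algebra_simps)
      have e3: "4 * (4 - d\<^sup>2) - ?A x * ?B x = - (x - b\<^sup>2) * (x + 5 + d\<^sup>2)"
        unfolding AB d_b_facts(2) by (simp add: power2_eq_square algebra_simps)
      show ?thesis unfolding e1 e2 e3 by (simp only: times_divide_eq_right) (simp only: mult_ac)
    qed
    have D2: "d * decay * ((2 * (x - b\<^sup>2) * (x + b\<^sup>2) - (x - b\<^sup>2)\<^sup>2) / (x + b\<^sup>2)\<^sup>2)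
       = (x - b\<^sup>2) * (d * (decay * (x + 3 * b\<^sup>2) / (x + b\<^sup>2)\<^sup>2))"
      by (simp add: power2_eq_square algebra_simps)
    have gen: "- u * (d * Z / W) + u * (d * Y) = - u * (d * (Z / W - Y))" for u Z W Y :: real
      by (simp add: algebra_simps)
    from D0 show "(f has_real_derivative - (x - b\<^sup>2) * \<rho> x) (at x)"
      unfolding D1 D2 \<rho>_def gen .
    have "decay * (x + 3 * b\<^sup>2) / (x + b\<^sup>2)\<^sup>2 \<le> decay * (3 * (x + b\<^sup>2)) / (x + b\<^sup>2)\<^sup>2"
      using x decay_pos by (intro divide_right_mono mult_left_mono) auto
    also have "\<dots> = 3 * decay / (x + b\<^sup>2)"
    proof -
      have "decay * (3 * X) / X\<^sup>2 = 3 * decay / X" for X :: real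
        by (simp add: power2_eq_square)
      then show ?thesis .
    qed
    also have "\<dots> \<le> 5 / (72 * (x + 9))"
    proof -
      have "3 * decay * (72 * (x + 9)) \<le> 5 * (x + b\<^sup>2)"
      proof -
        have "b\<^sup>2 * x \<le> 3 * x" using d_b_facts(4) x by (intro mult_right_mono) auto
        have eq: "3 * decay * (72 * (x + 9)) = 27 / 50 * (b\<^sup>2 * x) + 243 / 50 * b\<^sup>2"
          by (simp add: decay_def algebra_simps)
        have "b\<^sup>2 > 0" using b_pos by simp
        moreover have "27 / 50 * P + 243 / 50 * B \<le> 5 * (x + B)" if "P \<le> 3 * x" "B > 0" for P B :: real
          using that x by argo
        ultimately show ?thesis unfolding eq using \<open>b\<^sup>2 * x \<le> 3 * x\<close> by blast
      qed
      then show ?thesis using pos x by (simp add: divide_simps)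
    qed
    also have "\<dots> = (5 / 9 * (x + 9)) / (8 * ((x + 9) * (x + 9)))"
    proof -
      have gen: "5 / (72 * Y) = (5 / 9 * Y) / (8 * (Y * Y))" if "Y \<noteq> 0" for Y :: real
        using that by (simp add: field_simps)
      show ?thesis by (rule gen) (use x in simp)
    qed
    also have "\<dots> \<le> (x + 5 + d\<^sup>2) / (2 * (4 - d\<^sup>2) * (?A x * ?B x))"
    proof (rule frac_le)
      show "5 / 9 * (x + 9) \<le> x + 5 + d\<^sup>2" using x by (simp add: field_simps)
      have "(1 - d)\<^sup>2 \<le> 9" "(1 + d)\<^sup>2 \<le> 9"
        using d_b_facts(5) d_pos power_mono[of "1 + d" 3 2] abs_le_square_iff[of "1 - d" 3] by auto
      then have AB_le: "?A x * ?B x \<le> (x + 9) * (x + 9)"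
        using pos x by (intro mult_mono) auto
      have "2 * (4 - d\<^sup>2) \<le> 8" by simp
      then show "2 * (4 - d\<^sup>2) * (?A x * ?B x) \<le> 8 * ((x + 9) * (x + 9))"
        by (rule mult_mono[OF _ AB_le]) (use pos in auto)
    qed (use x pos in auto)
    finally show "\<rho> x \<ge> 0" using d_pos by (simp add: \<rho>_def)
  qed (use b_pos in auto)
  then show ?thesis by (simp add: f_def)
qed

text \<open>
  Only the centre \<open>x = 0\<close> is not covered by \<open>logsize_bound\<close>: there the wave may vanish, and the bound holds by
  continuity.
\<close>
lemma line_wave_bound:
  "norm (line_wave m x) \<le> norm (line_wave m b) * exp (- (real m * d * decay) * (\<bar>x\<bar> - b)\<^sup>2)"
proof -
  have off_centre: "norm (line_wave m x) \<le> norm (line_wave m b) * exp (- (real m * d * decay) * (\<bar>x\<bar> - b)\<^sup>2)"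
    if False: "x \<noteq> 0" for x
  proof -
    have "(\<bar>x\<bar> - b)\<^sup>2 \<le> (x\<^sup>2 - b\<^sup>2)\<^sup>2 / (x\<^sup>2 + b\<^sup>2)"
    proof -
      have "x\<^sup>2 - b\<^sup>2 = (\<bar>x\<bar> - b) * (\<bar>x\<bar> + b)"
        by (simp add: algebra_simps power2_eq_square)
      then have "(x\<^sup>2 - b\<^sup>2)\<^sup>2 = (\<bar>x\<bar> - b)\<^sup>2 * (\<bar>x\<bar> + b)\<^sup>2"
        by (simp only: power_mult_distrib)
      moreover have "(\<bar>x\<bar> + b)\<^sup>2 \<ge> x\<^sup>2 + b\<^sup>2"
        using b_pos by (simp add: power2_sum)
      ultimately have "(\<bar>x\<bar> - b)\<^sup>2 * (x\<^sup>2 + b\<^sup>2) \<le> (x\<^sup>2 - b\<^sup>2)\<^sup>2"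
        by (simp add: mult_left_mono)
      moreover have "x\<^sup>2 + b\<^sup>2 > 0" using b_pos by (simp add: add_nonneg_pos)
      ultimately show ?thesis by (simp add: pos_le_divide_eq)
    qed
    then have "d * decay * (\<bar>x\<bar> - b)\<^sup>2 \<le> d * decay * ((x\<^sup>2 - b\<^sup>2)\<^sup>2 / (x\<^sup>2 + b\<^sup>2))"
      using d_pos decay_pos by (intro mult_left_mono) auto
    with logsize_bound[of "x\<^sup>2"] False have "logsize (x\<^sup>2) \<le> logsize (b\<^sup>2) - d * decay * (\<bar>x\<bar> - b)\<^sup>2"
      by simp
    then have "real m * logsize (x\<^sup>2) \<le> real m * (logsize (b\<^sup>2) - d * decay * (\<bar>x\<bar> - b)\<^sup>2)"
      by (intro mult_left_mono) auto
    then show ?thesis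
      using b_pos unfolding norm_line_wave[OF False] norm_line_wave[OF less_imp_neq[OF b_pos, symmetric]] mult_exp_exp
      by (simp add: algebra_simps)
  qed
  show ?thesis
  proof (cases "x = 0")
    case True
  let ?f = "\<lambda>x. norm (line_wave m x) - norm (line_wave m b) * exp (- (real m * d * decay) * (\<bar>x\<bar> - b)\<^sup>2)"
  have "isCont ?f 0"
    unfolding wave_def using d_pos by (intro continuous_intros) (auto simp: complex_eq_iff)
  then have "(?f \<longlongrightarrow> ?f 0) (at 0)"
    by (simp add: isCont_def)
  moreover have "eventually (\<lambda>x. ?f x \<le> 0) (at 0)"
    using off_centre by (auto simp: eventually_at_filter)
  ultimately have "?f 0 \<le> 0"
    by (rule tendsto_upperbound) simp
  with True show ?thesis by simp
  qed (rule off_centre)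
qed

lemma line_wave_continuous: "continuous_on A (line_wave m)"
  unfolding wave_def using d_pos by (intro continuous_intros) (auto simp: complex_eq_iff)

lemma
  assumes "m \<ge> 1"
  shows line_wave_integrable: "integrable lborel (line_wave m)"
    and line_wave_integral_bound:
      "(LINT x|lborel. norm (line_wave m x)) \<le> 2 * norm (line_wave m b) * sqrt (pi / (real m * d * decay))"
proof -
  let ?c = "norm (line_wave m b)" and ?p = "real m * d * decay"
  let ?G = "\<lambda>x. ?c * exp (- ?p * (x - b)\<^sup>2) + ?c * exp (- ?p * (x - (- b))\<^sup>2)"
  have p: "?p > 0" using assms d_pos decay_pos by simp
  have le: "norm (line_wave m x) \<le> ?G x" for x
  proof (cases "x \<ge> 0")
    case True
    then have "norm (line_wave m x) \<le> ?c * exp (- ?p * (x - b)\<^sup>2)"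
      using line_wave_bound[of m x] by simp
    then show ?thesis by (rule order_trans) simp
  next
    case False
    then have "(\<bar>x\<bar> - b)\<^sup>2 = (x - (-b))\<^sup>2" by (simp add: power2_eq_square algebra_simps)
    then have "norm (line_wave m x) \<le> ?c * exp (- ?p * (x - (-b))\<^sup>2)"
      using line_wave_bound[of m x] by simp
    then show ?thesis by (rule order_trans) simp
  qed
  have G: "integrable lborel ?G"
    by (intro Bochner_Integration.integrable_add integrable_mult_right gaussian_integral(1) p)
  have G': "(LINT x|lborel. ?G x) = 2 * ?c * sqrt (pi / ?p)"
    using gaussian_integral[OF p, of b] gaussian_integral[OF p, of "-b"]
    by (subst Bochner_Integration.integral_add) (simp_all del: diff_minus_eq_add)
  have "AE x in lborel. norm (line_wave m x) \<le> norm (?G x)"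
    by (intro AE_I2 order_trans[OF le]) simp
  then show int: "integrable lborel (line_wave m)"
    by (intro Bochner_Integration.integrable_bound[OF G])
       (auto intro!: borel_measurable_continuous_onI line_wave_continuous)
  show "(LINT x|lborel. norm (line_wave m x)) \<le> 2 * ?c * sqrt (pi / ?p)"
    unfolding G'[symmetric] using int G le by (intro integral_mono) auto
qed

text \<open>
  The logarithmic derivative of the wave along the line is \<open>- m d (x - b) slope x\<close>. The factor \<open>x - b\<close> can be split
  off because the numerator of that derivative is a cubic with the roots \<open>b + i\<close>, \<open>- b + i\<close> and \<open>- 2 i\<close> in \<open>y\<close>.
\<close>
definition slope :: "real \<Rightarrow> complex" where
  "slope x = ((of_real x + of_real b) * (of_real x + 3 * \<i>)) / (of_real (4 - d\<^sup>2) * ((of_real x + \<i>)\<^sup>2 + of_real (d\<^sup>2)))"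

text \<open>
  Up to the factor \<open>- m d\<close>, the second derivative of the logarithm of the wave at the saddle; it is not real.
\<close>
definition curv :: complex where
  "curv = slope b"

lemma d2_complex: "complex_of_real (d\<^sup>2) = 3 - of_real (b\<^sup>2)"
  by (simp add: d_b_facts(2))

lemma slope_den_factor:
  "(of_real x + \<i>)\<^sup>2 + of_real (d\<^sup>2) = (of_real d - \<i> * (of_real x + \<i>)) * (of_real d + \<i> * (of_real x + \<i>))"
  by (simp add: power2_eq_square algebra_simps)

lemma slope_den_nonzero: "x > 0 \<Longrightarrow> (of_real x + \<i>)\<^sup>2 + of_real (d\<^sup>2) \<noteq> 0"
  unfolding slope_den_factor using den_nonzero[of x] by (auto simp: complex_eq_iff)

lemma line_wave_derivative:
  assumes x: "x > 0"
  shows "(line_wave m has_vector_derivative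
          - of_real (real m * d * (x - b)) * slope x * line_wave m x) (at x within S)"
proof -
  let ?y = "of_real x + \<i>"
  have nz: "of_real d - \<i> * ?y \<noteq> 0" "of_real d + \<i> * ?y \<noteq> 0" "?y\<^sup>2 + of_real (d\<^sup>2) \<noteq> 0"
    using slope_den_nonzero[OF x] unfolding slope_den_factor by auto
  have nz4: "complex_of_real (4 - d\<^sup>2) \<noteq> 0" using d_b_facts(1) by (metis of_real_eq_0_iff less_numeral_extra(1) not_one_less_zero)
  define r where "r = (\<lambda>z. (of_real d + \<i> * (z + \<i>)) / (of_real d - \<i> * (z + \<i>)))"
  define c where "c = complex_of_real (real m * d / (2 * (4 - d\<^sup>2)))"
  have r': "(r has_field_derivative r (of_real x) * (2 * \<i> * of_real d / (?y\<^sup>2 + of_real (d\<^sup>2)))) (at (of_real x))"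
  proof -
    have "(r has_field_derivative (\<i> * (of_real d - \<i> * ?y) + (of_real d + \<i> * ?y) * \<i>) / (of_real d - \<i> * ?y)\<^sup>2) (at (of_real x))"
      unfolding r_def using nz(1) by (auto intro!: derivative_eq_intros simp: power2_eq_square)
    moreover have "(\<i> * (of_real d - \<i> * ?y) + (of_real d + \<i> * ?y) * \<i>) / (of_real d - \<i> * ?y)\<^sup>2 =
      r (of_real x) * (2 * \<i> * of_real d / (?y\<^sup>2 + of_real (d\<^sup>2)))"
      unfolding slope_den_factor r_def using nz(1,2) by (simp add: power2_eq_square) (simp add: algebra_simps)
    ultimately show ?thesis by simp
  qed
  have "((\<lambda>z. exp (- c * (z + \<i>)\<^sup>2) * r z ^ m) has_field_derivative
     (exp (- c * ?y\<^sup>2) * r (of_real x) ^ m) * (- 2 * c * ?y + of_nat m * (2 * \<i> * of_real d / (?y\<^sup>2 + of_real (d\<^sup>2))))) (at (of_real x))"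
  proof -
    have pw: "((\<lambda>z. r z ^ m) has_field_derivative r (of_real x) ^ m * (of_nat m * (2 * \<i> * of_real d / (?y\<^sup>2 + of_real (d\<^sup>2))))) (at (of_real x))"
    proof (cases m)
      case (Suc n)
      then show ?thesis using DERIV_power_Suc[OF r', of n] by (simp add: algebra_simps)
    qed simp
    have ex: "((\<lambda>z. exp (- c * (z + \<i>)\<^sup>2)) has_field_derivative exp (- c * ?y\<^sup>2) * (- 2 * c * ?y)) (at (of_real x))"
      by (auto intro!: derivative_eq_intros)
    show ?thesis
      using DERIV_mult[OF ex pw] by (simp add: algebra_simps)
  qed
  from has_vector_derivative_real_field[OF this]
  have "(line_wave m has_vector_derivative
      line_wave m x * (- 2 * c * ?y + of_nat m * (2 * \<i> * of_real d / (?y\<^sup>2 + of_real (d\<^sup>2))))) (at x within S)"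
    by (simp add: wave_def r_def c_def)
  moreover have "- 2 * c * ?y + of_nat m * (2 * \<i> * of_real d / (?y\<^sup>2 + of_real (d\<^sup>2))) = - of_real (real m * d * (x - b)) * slope x"
  proof -
    have "- 2 * c * ?y + of_nat m * (2 * \<i> * of_real d / (?y\<^sup>2 + of_real (d\<^sup>2)))
      = of_real (real m * d) * ((2 * \<i> * of_real (4 - d\<^sup>2) - ?y * (?y\<^sup>2 + of_real (d\<^sup>2))) / (of_real (4 - d\<^sup>2) * (?y\<^sup>2 + of_real (d\<^sup>2))))"
    proof -
      have "2 * (u / (2 * v)) = u / v" for u v :: real by simp
      then have "2 * (real m * d / (2 * (4 - d\<^sup>2))) = real m * d / (4 - d\<^sup>2)" .
      then have "2 * c = of_real (real m * d) / of_real (4 - d\<^sup>2)"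
        unfolding c_def by (metis of_real_divide of_real_mult of_real_numeral)
      moreover have "- (u / Q * v) = u * (- v / Q)" for u v Q :: complex by simp
      moreover have "- 2 * c * ?y = - (2 * c * ?y)" by simp
      ultimately have "- 2 * c * ?y = of_real (real m * d) * (- ?y / of_real (4 - d\<^sup>2))"
        by (simp only:)
      moreover have "of_nat m * (2 * \<i> * of_real d / W) = of_real (real m * d) * (2 * \<i> / W)" for W :: complex
        by simp
      moreover have "U * (- v / Q) + U * (2 * \<i> / W) = U * ((2 * \<i> * Q - v * W) / (Q * W))"
        if "Q \<noteq> 0" "W \<noteq> 0" for U v Q W :: complex
        using that by (simp add: field_simps)
      ultimately show ?thesis using nz(3) nz4 by (simp only:)
    qed
    also have "2 * \<i> * of_real (4 - d\<^sup>2) - ?y * (?y\<^sup>2 + of_real (d\<^sup>2)) = - (of_real x - of_real b) * ((of_real x + of_real b) * (of_real x + 3 * \<i>))"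
      unfolding of_real_diff d2_complex by (simp add: power2_eq_square algebra_simps)
    also have "of_real (real m * d) * (- (of_real x - of_real b) * P / W)
        = - of_real (real m * d * (x - b)) * (P / W)" for P W :: complex
      unfolding of_real_mult[of "real m * d"] of_real_diff[of x b] by (simp only: times_divide_eq_right mult_minus_left mult_minus_right mult.assoc)
    finally show ?thesis unfolding slope_def .
  qed
  ultimately show ?thesis by (simp add: mult_ac)
qed

lemma curv_eq: "curv = of_real b * (of_real b + 3 * \<i>) / (of_real (4 - d\<^sup>2) * (1 + \<i> * of_real b))"
proof -
  have e: "(of_real b + \<i>)\<^sup>2 + of_real (d\<^sup>2) = 2 * (1 + \<i> * of_real b)"
    unfolding d2_complex by (simp add: power2_eq_square algebra_simps)
  have "(B + B) * C / (A * (2 * w)) = B * C / (A * w)" for A B C w :: complex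
    by (simp add: mult_2[symmetric])
  then show ?thesis unfolding curv_def slope_def e .
qed

lemma Re_curv: "Re curv = 4 * b\<^sup>2 / (4 - d\<^sup>2)\<^sup>2"
proof -
  have nz: "1 + \<i> * of_real b \<noteq> 0" by (auto simp: complex_eq_iff)
  have "(1 + \<i> * of_real b) * (1 - \<i> * of_real b) = of_real (4 - d\<^sup>2)"
    unfolding of_real_diff d2_complex by (simp add: power2_eq_square algebra_simps)
  then have "curv = of_real b * (of_real b + 3 * \<i>) * (1 - \<i> * of_real b) / of_real ((4 - d\<^sup>2)\<^sup>2)"
    unfolding curv_eq using nz d_b_facts(1) by (simp add: power2_eq_square divide_simps) (simp add: algebra_simps)
  then show ?thesis by (simp add: power2_eq_square)
qed

lemma curv_bounds: "Re curv \<ge> 2 * decay" "Re curv > 0" "norm curv \<le> 10"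
proof -
  have "(4 - d\<^sup>2)\<^sup>2 \<le> 4\<^sup>2" using d_b_facts(1) by (intro power_mono) auto
  moreover have "(4 - d\<^sup>2)\<^sup>2 > 0" using d_b_facts(1) by simp
  ultimately have "(4 - d\<^sup>2)\<^sup>2 \<le> 16" "(4 - d\<^sup>2)\<^sup>2 > 0" by simp_all
  then have "4 * b\<^sup>2 / (4 - d\<^sup>2)\<^sup>2 \<ge> 4 * b\<^sup>2 / 16" by (intro divide_left_mono) auto
  moreover have "2 * decay \<le> 4 * b\<^sup>2 / 16" by (simp add: decay_def)
  ultimately show *: "Re curv \<ge> 2 * decay" unfolding Re_curv by linarith
  then show "Re curv > 0" using decay_pos by linarith
  have "norm (of_real b + 3 * \<i>) \<le> 5"
    using norm_triangle_ineq[of "of_real b" "3 * \<i>"] d_b_facts(6) b_pos by (simp add: norm_mult)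
  then have "b * norm (of_real b + 3 * \<i>) \<le> 2 * 5" using d_b_facts(6) b_pos by (intro mult_mono) auto
  moreover have "(4 - d\<^sup>2) * norm (1 + \<i> * of_real b) \<ge> 1 * 1"
    using d_b_facts(1) complex_Re_le_cmod[of "1 + \<i> * of_real b"] by (intro mult_mono) auto
  moreover have "norm curv = b * norm (of_real b + 3 * \<i>) / ((4 - d\<^sup>2) * norm (1 + \<i> * of_real b))"
    unfolding curv_eq norm_divide norm_mult using b_pos d_b_facts(1) by (simp flip: of_real_diff of_real_power)
  ultimately show "norm curv \<le> 10"
    by (simp add: divide_le_eq)
qed

text \<open>
  The cross difference of numerators and denominators is exactly divisible by \<open>x - b\<close>. The restriction on \<open>x\<close> keeps
  the denominator away from 0; for \<open>d = 1\<close> the slope has a pole at \<open>x = 0\<close>.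
\<close>
lemma slope_lipschitz:
  assumes x: "x \<ge> b / 2"
  shows "norm (curv - slope x) \<le> 244 / b * \<bar>x - b\<bar>"
proof -
  define A where "A = complex_of_real (4 - d\<^sup>2)"
  define D where "D = (\<lambda>x::real. (of_real x + \<i>)\<^sup>2 + complex_of_real (d\<^sup>2))"
  define n where "n = (\<lambda>x::real. (of_real x + complex_of_real b) * (of_real x + 3 * \<i>))"
  have xp: "x > 0" using x b_pos by linarith
  have nz: "D x \<noteq> 0" "D b \<noteq> 0"
    unfolding D_def using slope_den_nonzero xp b_pos by auto
  have A: "norm A \<ge> 1" unfolding A_def norm_of_real using d_b_facts(1) by linarith
  then have nzA: "A \<noteq> 0" by auto
  have Db: "D b = 2 * (1 + \<i> * of_real b)"
    unfolding D_def d2_complex by (simp add: power2_eq_square algebra_simps)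
  define R where "R = n b * (of_real x + of_real b + 2 * \<i>) - (of_real x + 2 * of_real b + 3 * \<i>) * D b"
  have "n b * D x - n x * D b = of_real (x - b) * R"
  proof -
    have Dx: "D x = D b + of_real (x - b) * (of_real x + of_real b + 2 * \<i>)"
      by (simp add: D_def power2_eq_square algebra_simps)
    have nx: "n x = n b + of_real (x - b) * (of_real x + 2 * of_real b + 3 * \<i>)"
      by (simp add: n_def algebra_simps)
    show ?thesis unfolding Dx nx R_def by (simp add: algebra_simps)
  qed
  moreover have "curv - slope x = (n b * D x - n x * D b) / (A * D x * D b)"
  proof -
    have "slope z = n z / (A * D z)" for z
      by (simp add: slope_def A_def D_def n_def)
    moreover have "n b / (A * D b) - n x / (A * D x) = (n b * D x - n x * D b) / (A * D x * D b)"
      using nz nzA by (simp add: divide_simps)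
    ultimately show ?thesis by (simp add: curv_def)
  qed
  ultimately have eq: "norm (curv - slope x) = \<bar>x - b\<bar> * norm R / (norm A * norm (D x) * norm (D b))"
    by (simp add: norm_mult norm_divide flip: of_real_diff)
  have "norm R \<le> norm (n b) * norm (of_real x + of_real b + 2 * \<i>) + norm (of_real x + 2 * of_real b + 3 * \<i>) * norm (D b)"
    unfolding R_def by (metis norm_mult norm_triangle_ineq4)
  also have "\<dots> \<le> 20 * (x + 4) + (x + 7) * 6"
  proof (intro add_mono mult_mono)
    have "norm (of_real b + of_real b :: complex) \<le> 4"
      using norm_triangle_ineq[of "of_real b :: complex" "of_real b"] d_b_facts(6) b_pos by simp
    moreover have "norm (of_real b + 3 * \<i>) \<le> 5"
      using norm_triangle_ineq[of "of_real b" "3 * \<i>"] d_b_facts(6) b_pos by (simp add: norm_mult)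
    ultimately have "norm (of_real b + of_real b :: complex) * norm (of_real b + 3 * \<i>) \<le> 4 * 5"
      by (intro mult_mono) auto
    then show "norm (n b) \<le> 20" unfolding n_def norm_mult by simp
    show "norm (of_real x + of_real b + 2 * \<i>) \<le> x + 4"
      using norm_triangle_ineq[of "of_real (x + b)" "2 * \<i>"] d_b_facts(6) b_pos xp
      unfolding norm_of_real by (simp add: norm_mult)
    show "norm (of_real x + 2 * of_real b + 3 * \<i>) \<le> x + 7"
      using norm_triangle_ineq[of "of_real (x + 2 * b)" "3 * \<i>"] d_b_facts(6) b_pos xp
      unfolding norm_of_real by (simp add: norm_mult)
    have "norm (1 + \<i> * of_real b) \<le> 3"
      using norm_triangle_ineq[of 1 "\<i> * of_real b"] d_b_facts(6) b_pos by (simp add: norm_mult)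
    then show "norm (D b) \<le> 6" unfolding Db norm_mult by simp
  qed (use xp in auto)
  finally have R: "norm R \<le> 122 * (x + 1)" using xp by simp
  have "b / 2 * ((x + 1) / 2) \<le> norm (of_real d + \<i> * (of_real x + \<i>)) * norm (of_real d - \<i> * (of_real x + \<i>))"
  proof (intro mult_mono)
    have "norm (of_real d + \<i> * (of_real x + \<i>)) \<ge> x"
      using abs_Im_le_cmod[of "of_real d + \<i> * (of_real x + \<i>)"] by simp
    then show "b / 2 \<le> norm (of_real d + \<i> * (of_real x + \<i>))" using x by linarith
    have "norm (of_real d - \<i> * (of_real x + \<i>)) \<ge> x"  "norm (of_real d - \<i> * (of_real x + \<i>)) \<ge> 1"
      using abs_Im_le_cmod[of "of_real d - \<i> * (of_real x + \<i>)"]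
            abs_Re_le_cmod[of "of_real d - \<i> * (of_real x + \<i>)"] d_pos by simp_all
    from add_mono[OF this] show "(x + 1) / 2 \<le> norm (of_real d - \<i> * (of_real x + \<i>))" by simp
  qed (use b_pos xp in auto)
  then have Dx: "norm (D x) \<ge> b / 2 * ((x + 1) / 2)"
    unfolding D_def slope_den_factor norm_mult by (simp add: mult.commute)
  have "norm (D b) \<ge> 2"
    unfolding Db norm_mult using complex_Re_le_cmod[of "1 + \<i> * of_real b"] by simp
  with A Dx have den: "norm A * norm (D x) * norm (D b) \<ge> 1 * (b / 2 * ((x + 1) / 2)) * 2"
    using b_pos xp by (intro mult_mono) auto
  have "\<bar>x - b\<bar> * norm R / (norm A * norm (D x) * norm (D b)) \<le> \<bar>x - b\<bar> * (122 * (x + 1)) / (1 * (b / 2 * ((x + 1) / 2)) * 2)"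
    using R den b_pos xp by (intro frac_le mult_left_mono) auto
  also have "\<dots> = 244 / b * \<bar>x - b\<bar>"
  proof -
    have gen: "h * (122 * X) / (1 * (b / 2 * (X / 2)) * 2) = 244 / b * h" if "X \<noteq> 0" for h X :: real
      using that b_pos by (simp add: field_simps)
    show ?thesis by (rule gen) (use xp in simp)
  qed
  finally show ?thesis unfolding eq .
qed

lemma line_wave_nonzero: "x \<noteq> 0 \<Longrightarrow> line_wave m x \<noteq> 0"
  using norm_line_wave[of x m] by (metis exp_not_eq_zero norm_zero)

text \<open>
  The quotient \<open>C\<close> of the wave by the Gaussian solves the linear differential equation
  \<open>C' = m d (x - b) (curv - slope x) C\<close>, whose coefficient is \<open>O (m d (x - b)\<^sup>2)\<close>. The mean value inequality bounds
  \<open>C - 1\<close>; no logarithm of the wave is needed, hence no branch of it.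
\<close>
lemma line_wave_gaussian_approx:
  assumes x: "x \<ge> b / 2"
  shows "norm (line_wave m x / line_wave m b - exp (- (of_real (real m * d) * curv) * of_real ((x - b)\<^sup>2) / 2))
         \<le> 244 / b * (real m * d) * \<bar>x - b\<bar> ^ 3 * exp (- (real m * d * decay) * (x - b)\<^sup>2)"
proof -
  define N where "N = real m * d"
  have N0: "N \<ge> 0" using d_pos by (simp add: N_def)
  (* the reciprocal of the Gaussian *)
  define G where "G = (\<lambda>x::real. exp (of_real N * curv * of_real ((x - b)\<^sup>2) / 2))"
  define C where "C = (\<lambda>x. line_wave m x / line_wave m b * G x)"
  have nz: "line_wave m b \<noteq> 0" using line_wave_nonzero b_pos by simp
  have Cb: "C b = 1" using nz by (simp add: C_def G_def)
  have nG: "norm (G x) = exp (N * Re curv * (x - b)\<^sup>2 / 2)" for x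
    by (simp add: G_def norm_exp_eq_Re)
  define M where "M = N * (244 / b) * (x - b)\<^sup>2 * exp (N * (Re curv / 2 - decay) * (x - b)\<^sup>2)"
  have der: "(C has_vector_derivative of_real (N * (\<xi> - b)) * (curv - slope \<xi>) * C \<xi>) (at \<xi> within S)" if "\<xi> > 0" for \<xi> S
  proof -
    have "(G has_vector_derivative of_real (N * (\<xi> - b)) * curv * G \<xi>) (at \<xi> within S)"
    proof -
      have "((\<lambda>z. exp (of_real N * curv * (z - of_real b)\<^sup>2 / 2)) has_field_derivative
          of_real (N * (\<xi> - b)) * curv * G \<xi>) (at (of_real \<xi>))"
        by (auto intro!: derivative_eq_intros simp: G_def)
      from has_vector_derivative_real_field[OF this] show ?thesis
        by (simp add: G_def)
    qed
    from has_vector_derivative_mult[OF has_vector_derivative_divide[OF line_wave_derivative[OF that, of m S], of "line_wave m b"] this]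
    show ?thesis unfolding C_def N_def[symmetric] by (rule back_subst[where P = "\<lambda>D. (_ has_vector_derivative D) _"]) (use nz in \<open>simp add: field_simps\<close>)
  qed
  have seg_pos: "\<xi> > 0" "\<bar>\<xi> - b\<bar> \<le> \<bar>x - b\<bar>" "\<xi> \<ge> b / 2" if "\<xi> \<in> closed_segment b x" for \<xi>
    using that x b_pos by (auto simp: closed_segment_eq_real_ivl split: if_splits)
  have "norm (C x - C b) \<le> M * norm (x - b)"
  proof (rule differentiable_bound[of "closed_segment b x" C "\<lambda>\<xi> h. h *\<^sub>R (of_real (N * (\<xi> - b)) * (curv - slope \<xi>) * C \<xi>)"])
    fix \<xi> assume \<xi>: "\<xi> \<in> closed_segment b x"
    show "(C has_derivative (\<lambda>h. h *\<^sub>R (of_real (N * (\<xi> - b)) * (curv - slope \<xi>) * C \<xi>))) (at \<xi> within closed_segment b x)"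
      using der[OF seg_pos(1)[OF \<xi>]] by (simp add: has_vector_derivative_def)
    have sq: "(\<xi> - b)\<^sup>2 \<le> (x - b)\<^sup>2" using seg_pos(2)[OF \<xi>] by (simp add: abs_le_square_iff)
    have "norm (of_real (N * (\<xi> - b)) * (curv - slope \<xi>)) \<le> N * \<bar>\<xi> - b\<bar> * (244 / b * \<bar>\<xi> - b\<bar>)"
      unfolding norm_mult norm_of_real abs_mult using slope_lipschitz[OF seg_pos(3)[OF \<xi>]] N0
      by (intro mult_mono) auto
    also have "\<dots> = N * (244 / b) * (\<xi> - b)\<^sup>2" by (simp add: power2_eq_square)
    also have "\<dots> \<le> N * (244 / b) * (x - b)\<^sup>2" using sq N0 b_pos by (intro mult_left_mono) auto
    finally have 1: "norm (of_real (N * (\<xi> - b)) * (curv - slope \<xi>)) \<le> N * (244 / b) * (x - b)\<^sup>2" .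
    have "norm (C \<xi>) \<le> exp (- (N * decay) * (\<xi> - b)\<^sup>2) * exp (N * Re curv * (\<xi> - b)\<^sup>2 / 2)"
      unfolding C_def norm_mult norm_divide nG
      using line_wave_bound[of m \<xi>] seg_pos(1)[OF \<xi>] nz
      by (intro mult_right_mono) (auto simp: divide_le_eq mult.commute N_def)
    also have "\<dots> = exp (N * (Re curv / 2 - decay) * (\<xi> - b)\<^sup>2)"
      by (simp add: mult_exp_exp algebra_simps)
    also have "\<dots> \<le> exp (N * (Re curv / 2 - decay) * (x - b)\<^sup>2)"
      using curv_bounds(1) N0 sq by (simp, intro mult_left_mono) auto
    finally have 2: "norm (C \<xi>) \<le> exp (N * (Re curv / 2 - decay) * (x - b)\<^sup>2)" .
    have "norm (of_real (N * (\<xi> - b)) * (curv - slope \<xi>) * C \<xi>) \<le> M"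
      unfolding M_def norm_mult[of _ "C \<xi>"] using 1 2 N0 b_pos by (intro mult_mono) auto
    then show "onorm (\<lambda>h. h *\<^sub>R (of_real (N * (\<xi> - b)) * (curv - slope \<xi>) * C \<xi>)) \<le> M"
      by (intro onorm_le) (simp only: norm_scaleR real_norm_def, subst mult.commute, rule mult_right_mono, auto)
  qed (auto simp: convex_closed_segment)
  then have "norm (C x - 1) \<le> M * \<bar>x - b\<bar>" by (simp add: Cb)
  moreover have "line_wave m x / line_wave m b - exp (- (of_real N * curv) * of_real ((x - b)\<^sup>2) / 2)
     = (C x - 1) * exp (- (of_real N * curv) * of_real ((x - b)\<^sup>2) / 2)"
  proof -
    have "G x * exp (- (of_real N * curv) * of_real ((x - b)\<^sup>2) / 2) = 1"
      unfolding G_def mult_exp_exp by simp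
    then show ?thesis by (simp add: C_def left_diff_distrib mult.assoc)
  qed
  moreover have "norm (exp (- (of_real N * curv) * of_real ((x - b)\<^sup>2) / 2)) = exp (- (N * Re curv * (x - b)\<^sup>2 / 2))"
    by (simp add: norm_exp_eq_Re)
  ultimately have "norm (line_wave m x / line_wave m b - exp (- (of_real N * curv) * of_real ((x - b)\<^sup>2) / 2))
     \<le> M * \<bar>x - b\<bar> * exp (- (N * Re curv * (x - b)\<^sup>2 / 2))"
    by (simp add: norm_mult mult_right_mono)
  also have "\<dots> = 244 / b * N * \<bar>x - b\<bar> ^ 3 * (exp (N * (Re curv / 2 - decay) * (x - b)\<^sup>2) * exp (- (N * Re curv * (x - b)\<^sup>2 / 2)))"
    by (simp add: M_def power3_eq_cube power2_eq_square)
  also have "exp (N * (Re curv / 2 - decay) * (x - b)\<^sup>2) * exp (- (N * Re curv * (x - b)\<^sup>2 / 2)) = exp (- (N * decay) * (x - b)\<^sup>2)"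
    by (simp add: mult_exp_exp algebra_simps)
  finally show ?thesis by (simp add: N_def)
qed

end


section \<open>Laplace's method at a saddle point\<close>

context saddle
begin

text \<open>
  What is left of the annihilating kernel beside the wave if \<open>c\<close> is the value of the Cayley transform at the left
  saddle; the zero at \<open>- b\<close> switches that saddle off (see \<open>annihilator_scaled\<close>).
\<close>
definition weight :: "real \<Rightarrow> complex" where
  "weight x = (of_real x + of_real b) / (of_real x + \<i> * of_real (1 + d)) ^ 3"

lemma weight_den:
  "norm (of_real x + \<i> * of_real (1 + d)) \<ge> 1" "norm (of_real x + \<i> * of_real (1 + d)) \<ge> \<bar>x\<bar>"
  using abs_Im_le_cmod[of "of_real x + \<i> * of_real (1 + d)"] abs_Re_le_cmod[of "of_real x + \<i> * of_real (1 + d)"] d_pos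
  by simp_all

lemma weight_den_nonzero: "of_real x + \<i> * complex_of_real (1 + d) \<noteq> 0"
  using weight_den(1)[of x] by force

lemma norm_weight: "norm (weight x) = \<bar>x + b\<bar> / norm (of_real x + \<i> * of_real (1 + d)) ^ 3"
proof -
  have "norm (of_real x + of_real b :: complex) = \<bar>x + b\<bar>" by (simp flip: of_real_add)
  then show ?thesis by (simp only: weight_def norm_divide norm_power)
qed

lemma weight_bounds:
  "norm (weight x) \<le> \<bar>x + b\<bar>" "norm (weight x) \<le> 3" "norm (weight b) \<ge> 2 * b / 125"
proof -
  let ?n = "norm (of_real x + \<i> * of_real (1 + d))"
  have n: "?n ^ 3 \<ge> 1" "?n ^ 3 \<ge> ?n"
    using weight_den(1)[of x] self_le_power[of ?n 3] by auto
  show "norm (weight x) \<le> \<bar>x + b\<bar>"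
    unfolding norm_weight using mult_left_mono[OF n(1), of "\<bar>x + b\<bar>"] less_le_trans[OF zero_less_one n(1)]
    by (simp only: pos_divide_le_eq) simp
  have "\<bar>x + b\<bar> \<le> 3 * ?n"
    using weight_den[of x] b_pos d_b_facts(6) by linarith
  also have "\<dots> \<le> 3 * ?n ^ 3" using n(2) by simp
  finally show "norm (weight x) \<le> 3"
    unfolding norm_weight using n(1) by (simp add: divide_le_eq)
  have "norm (of_real b + \<i> * of_real (1 + d)) \<le> \<bar>b\<bar> + \<bar>1 + d\<bar>"
    using norm_triangle_ineq[of "of_real b" "\<i> * of_real (1 + d)"] by (simp only: norm_mult norm_of_real norm_ii mult_1)
  also have "\<dots> \<le> 5" using d_b_facts b_pos d_pos by simp
  finally have "norm (of_real b + \<i> * of_real (1 + d)) ^ 3 \<le> 5 ^ 3"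
    by (intro power_mono) auto
  moreover have "norm (of_real b + \<i> * of_real (1 + d)) ^ 3 > 0"
    using weight_den(1)[of b] by (intro zero_less_power) linarith
  ultimately have "2 * b / 5 ^ 3 \<le> 2 * b / norm (of_real b + \<i> * of_real (1 + d)) ^ 3"
    using b_pos by (intro divide_left_mono) auto
  then show "norm (weight b) \<ge> 2 * b / 125"
    unfolding norm_weight using b_pos by simp
qed

lemma weight_lipschitz: "norm (weight x - weight b) \<le> 13 * \<bar>x - b\<bar>"
proof -
  define u v where "u = of_real x + \<i> * of_real (1 + d)" and "v = of_real b + \<i> * complex_of_real (1 + d)"
  have u1: "norm u \<ge> 1" and v1: "norm v \<ge> 1"
    unfolding u_def v_def by (rule weight_den)+
  then have nz: "u \<noteq> 0" "v \<noteq> 0" by auto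
  have uv: "u - v = of_real (x - b)" by (simp add: u_def v_def)
  have "weight x - weight b = of_real (x - b) / u ^ 3 - 2 * of_real b * ((u - v) * (u\<^sup>2 + u * v + v\<^sup>2)) / (u ^ 3 * v ^ 3)"
  proof -
    have "(u - v) * (u\<^sup>2 + u * v + v\<^sup>2) = u ^ 3 - v ^ 3" by (simp add: power3_eq_cube power2_eq_square algebra_simps)
    moreover have "(h + 2 * B) / U - 2 * B / V = h / U - 2 * B * (U - V) / (U * V)" if "U \<noteq> 0" "V \<noteq> 0" for h B U V :: complex
      using that by (simp add: field_simps)
    moreover have "weight x = (of_real (x - b) + 2 * of_real b) / u ^ 3" "weight b = 2 * of_real b / v ^ 3"
      unfolding weight_def u_def[symmetric] v_def[symmetric] by simp_all
    ultimately show ?thesis using nz by (simp only: power_not_zero not_False_eq_True)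
  qed
  also have "norm \<dots> \<le> \<bar>x - b\<bar> / norm u ^ 3 + 2 * b * (\<bar>x - b\<bar> * norm (u\<^sup>2 + u * v + v\<^sup>2)) / (norm u ^ 3 * norm v ^ 3)"
    unfolding uv using b_pos by (intro order_trans[OF norm_triangle_ineq4]) (simp add: norm_divide norm_mult norm_power flip: of_real_diff)
  also have "\<dots> \<le> \<bar>x - b\<bar> + 2 * b * (\<bar>x - b\<bar> * 3)"
  proof (intro add_mono)
    have "norm u ^ 3 \<ge> 1" using u1 by simp
    then show "\<bar>x - b\<bar> / norm u ^ 3 \<le> \<bar>x - b\<bar>"
      using divide_left_mono[of 1 "norm u ^ 3" "\<bar>x - b\<bar>"] nz by simp
    have "norm (u\<^sup>2 + u * v + v\<^sup>2) \<le> norm u ^ 2 + norm u * norm v + norm v ^ 2"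
      by (intro order_trans[OF norm_triangle_ineq] add_mono) (auto simp: norm_mult norm_power norm_triangle_ineq intro: order_trans[OF norm_triangle_ineq])
    also have "\<dots> \<le> norm u ^ 3 * norm v ^ 3 + norm u ^ 3 * norm v ^ 3 + norm u ^ 3 * norm v ^ 3"
    proof (intro add_mono)
      have p: "norm u ^ 2 \<le> norm u ^ 3" "norm v ^ 2 \<le> norm v ^ 3" "norm u \<le> norm u ^ 3" "norm v \<le> norm v ^ 3"
          "1 \<le> norm u ^ 3" "1 \<le> norm v ^ 3"
        using u1 v1 by (auto intro: power_increasing self_le_power)
      show "norm u ^ 2 \<le> norm u ^ 3 * norm v ^ 3" using mult_mono[OF p(1) p(6)] by simp
      show "norm v ^ 2 \<le> norm u ^ 3 * norm v ^ 3" using mult_mono[OF p(5) p(2)] by simp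
      show "norm u * norm v \<le> norm u ^ 3 * norm v ^ 3" using mult_mono[OF p(3) p(4)] by simp
    qed
    finally have "norm (u\<^sup>2 + u * v + v\<^sup>2) \<le> 3 * (norm u ^ 3 * norm v ^ 3)" by simp
    then have "2 * b * (\<bar>x - b\<bar> * norm (u\<^sup>2 + u * v + v\<^sup>2)) \<le> 2 * b * (\<bar>x - b\<bar> * (3 * (norm u ^ 3 * norm v ^ 3)))"
      using b_pos by (intro mult_left_mono) auto
    then show "2 * b * (\<bar>x - b\<bar> * norm (u\<^sup>2 + u * v + v\<^sup>2)) / (norm u ^ 3 * norm v ^ 3) \<le> 2 * b * (\<bar>x - b\<bar> * 3)"
      using nz by (simp add: divide_le_eq mult_ac)
  qed
  also have "\<dots> = (1 + 6 * b) * \<bar>x - b\<bar>" by (simp add: algebra_simps)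
  also have "\<dots> \<le> 13 * \<bar>x - b\<bar>" using d_b_facts(6) by (intro mult_right_mono) auto
  finally show ?thesis .
qed

text \<open>
  Decreasing in \<open>b\<close>, hence bounded as long as \<open>b\<close> stays away from 0.
\<close>
definition laplace_const :: real where
  "laplace_const = 13 + 12 / b + 1464 / (b * decay)"

definition gauss :: "nat \<Rightarrow> real \<Rightarrow> complex" where
  "gauss m x = exp (- (of_real (real m * d) * curv) * of_real ((x - b)\<^sup>2) / 2)"

lemma norm_gauss: "norm (gauss m x) = exp (- (real m * d * Re curv / 2) * (x - b)\<^sup>2)"
  by (simp add: gauss_def norm_exp_eq_Re)

text \<open>
  Three regions. To the right of \<open>b / 2\<close> the wave is compared with the Gaussian; a factor \<open>m d (x - b)\<^sup>2\<close> is absorbed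
  by half of the exponent. Between 0 and \<open>b / 2\<close> both terms are small, because \<open>|x - b|\<close> is bounded below. On the
  negative side the zero of the weight makes the contribution of the left saddle one order smaller.
\<close>
lemma weighted_wave_approx:
  fixes x :: real and m :: nat
  defines "p \<equiv> real m * d * decay / 2"
  shows "norm (line_wave m x / line_wave m b * weight x - gauss m x * weight b)
         \<le> laplace_const * (\<bar>x - b\<bar> * exp (- p * (x - b)\<^sup>2) + \<bar>x - (- b)\<bar> * exp (- p * (x - (- b))\<^sup>2))"
proof -
  define N where "N = real m * d"
  have N0: "N \<ge> 0" using d_pos by (simp add: N_def)
  have Np: "N * decay = 2 * p" by (simp add: p_def N_def)
  have p0: "p \<ge> 0" using N0 decay_pos Np mult_nonneg_nonneg[of N decay] by linarith
  define r where "r = line_wave m x / line_wave m b"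
  have nz: "norm (line_wave m b) > 0" using line_wave_nonzero b_pos by simp
  have r: "norm r \<le> exp (- (2 * p) * (\<bar>x\<bar> - b)\<^sup>2)"
    using line_wave_bound[of m x] nz unfolding r_def norm_divide Np[symmetric] N_def
    by (simp add: divide_le_eq mult.commute)
  have halve: "exp (- (2 * p) * y\<^sup>2) \<le> exp (- p * y\<^sup>2)" for y :: real
    using p0 by (simp add: mult_right_mono)
  have gauss: "norm (gauss m x) \<le> exp (- p * (x - b)\<^sup>2)"
  proof -
    have "2 * (N * decay) \<le> N * Re curv"
      using mult_left_mono[OF curv_bounds(1) N0] by (simp only: mult.left_commute[of N 2])
    then have "p \<le> N * Re curv / 2" using p0 unfolding Np by linarith
    then show ?thesis unfolding norm_gauss N_def[symmetric]
      by (intro iffD2[OF exp_le_cancel_iff] mult_right_mono) auto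
  qed
  define F1 F2 where "F1 = \<bar>x - b\<bar> * exp (- p * (x - b)\<^sup>2)" and "F2 = \<bar>x - (- b)\<bar> * exp (- p * (x - (- b))\<^sup>2)"
  have F: "F1 \<ge> 0" "F2 \<ge> 0" by (auto simp: F1_def F2_def)
  have split: "norm (r * weight x - gauss m x * weight b) \<le> norm r * norm (weight x) + norm (gauss m x) * norm (weight b)"
    by (metis norm_mult norm_triangle_ineq4)
  have gw: "norm (gauss m x) * norm (weight b) \<le> exp (- p * (x - b)\<^sup>2) * 3"
    using gauss weight_bounds(2) by (intro mult_mono) auto
  have "norm (r * weight x - gauss m x * weight b) \<le> laplace_const * F1 + F2"
  proof -
    have c: "12 / b \<ge> 0" "1464 / (b * decay) \<ge> 0" using b_pos decay_pos by auto
    consider "x \<ge> b / 2" | "0 \<le> x" "x < b / 2" | "x < 0" by linarith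
    then show ?thesis
    proof cases
      case 1
      then have "\<bar>x\<bar> = x" using b_pos by simp
      have "norm (r * weight x - gauss m x * weight b) = norm (r * (weight x - weight b) + (r - gauss m x) * weight b)"
        by (simp add: algebra_simps)
      also have "\<dots> \<le> norm r * norm (weight x - weight b) + norm (r - gauss m x) * norm (weight b)"
        by (metis norm_mult norm_triangle_ineq)
      also have "\<dots> \<le> exp (- p * (x - b)\<^sup>2) * (13 * \<bar>x - b\<bar>) + (244 / b * (2 / decay) * F1) * 3"
      proof (intro add_mono mult_mono)
        show "norm r \<le> exp (- p * (x - b)\<^sup>2)" using order_trans[OF r halve] \<open>\<bar>x\<bar> = x\<close> by simp
        have t: "t * exp (- t) \<le> 1" for t :: real
        proof -
          have "t \<le> exp t" using exp_ge_add_one_self[of t] by linarith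
          then show ?thesis by (simp add: exp_minus field_simps)
        qed
        have "norm (r - gauss m x) \<le> 244 / b * N * \<bar>x - b\<bar> ^ 3 * exp (- (2 * p) * (x - b)\<^sup>2)"
          using line_wave_gaussian_approx[OF 1, of m] unfolding r_def gauss_def N_def[symmetric] Np by simp
        also have "\<dots> = 244 / b * (2 / decay) * F1 * ((p * (x - b)\<^sup>2) * exp (- (p * (x - b)\<^sup>2)))"
        proof -
          have "N = 2 * p / decay" using Np decay_pos by (simp add: field_simps)
          moreover have "exp (- (2 * p) * (x - b)\<^sup>2) = exp (- p * (x - b)\<^sup>2) * exp (- (p * (x - b)\<^sup>2))"
            by (simp add: mult_exp_exp)
          moreover have "\<bar>x - b\<bar> ^ 3 = \<bar>x - b\<bar> * (x - b)\<^sup>2" by (simp add: power3_eq_cube power2_eq_square)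
          ultimately show ?thesis by (simp only: F1_def) (simp add: mult_ac)
        qed
        also have "\<dots> \<le> 244 / b * (2 / decay) * F1 * 1"
          using t F b_pos decay_pos by (intro mult_left_mono) auto
        finally show "norm (r - gauss m x) \<le> 244 / b * (2 / decay) * F1" by simp
      qed (use weight_lipschitz weight_bounds F b_pos decay_pos in auto)
      also have "\<dots> = (13 + 1464 / (b * decay)) * F1" by (simp add: F1_def algebra_simps)
      also have "\<dots> \<le> laplace_const * F1 + F2"
        using F c by (simp add: laplace_const_def distrib_right)
      finally show ?thesis .
    next
      case 2
      then have "\<bar>x\<bar> = x" by simp
      have "norm r * norm (weight x) \<le> exp (- p * (x - b)\<^sup>2) * 3"
        using order_trans[OF r halve] \<open>\<bar>x\<bar> = x\<close> weight_bounds(2) by (intro mult_mono) auto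
      with split gw have "norm (r * weight x - gauss m x * weight b) \<le> 6 * exp (- p * (x - b)\<^sup>2) * 1" by linarith
      also have "\<dots> \<le> 6 * exp (- p * (x - b)\<^sup>2) * (2 * \<bar>x - b\<bar> / b)"
        using 2 b_pos by (intro mult_left_mono) (auto simp: field_simps)
      also have "\<dots> = 12 / b * F1" by (simp add: F1_def)
      also have "\<dots> \<le> laplace_const * F1 + F2"
        using F c by (simp add: laplace_const_def distrib_right)
      finally show ?thesis .
    next
      case 3
      then have "(\<bar>x\<bar> - b)\<^sup>2 = (x - (- b))\<^sup>2" by (simp add: power2_eq_square algebra_simps)
      then have "norm r * norm (weight x) \<le> exp (- p * (x - (-b))\<^sup>2) * \<bar>x + b\<bar>"
        using order_trans[OF r halve] weight_bounds(1)[of x] by (intro mult_mono) auto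
      also have "\<dots> = F2" by (simp add: F2_def)
      finally have 1: "norm r * norm (weight x) \<le> F2" .
      have "exp (- p * (x - b)\<^sup>2) * 3 \<le> exp (- p * (x - b)\<^sup>2) * (3 * \<bar>x - b\<bar> / b)"
        using 3 b_pos by (intro mult_left_mono) (auto simp: field_simps)
      also have "\<dots> = 3 / b * F1" by (simp add: F1_def)
      also have "\<dots> \<le> laplace_const * F1"
      proof (rule mult_right_mono[OF _ F(1)])
        have "3 / b \<le> 12 / b" using b_pos by (simp add: divide_right_mono)
        then show "3 / b \<le> laplace_const" unfolding laplace_const_def using c by linarith
      qed
      finally show ?thesis using split gw 1 by linarith
    qed
  qed
  also have "\<dots> \<le> laplace_const * (F1 + F2)"
  proof -
    have "laplace_const \<ge> 1" using b_pos decay_pos unfolding laplace_const_def by (simp add: add_increasing2)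
    then have "1 * F2 \<le> laplace_const * F2" using F by (intro mult_right_mono)
    then show ?thesis by (simp add: distrib_left)
  qed
  finally show ?thesis unfolding F1_def F2_def r_def .
qed

lemma weighted_wave_integrable:
  assumes "m \<ge> 1"
  shows "integrable lborel (\<lambda>x. line_wave m x * weight x)"
proof (rule Bochner_Integration.integrable_bound[OF integrable_mult_right[OF integrable_norm[OF line_wave_integrable[OF assms]], of 3]])
  have "continuous_on UNIV weight"
    unfolding weight_def using weight_den_nonzero by (intro continuous_intros ballI) (simp del: of_real_add)
  then show "(\<lambda>x. line_wave m x * weight x) \<in> borel_measurable lborel"
    by (auto intro!: borel_measurable_continuous_onI continuous_on_mult line_wave_continuous)
  show "AE x in lborel. norm (line_wave m x * weight x) \<le> norm (3 * norm (line_wave m x))"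
    using weight_bounds(2) by (intro AE_I2) (simp add: norm_mult mult.commute mult_right_mono)
qed

text \<open>
  The main term is the Gaussian integral, of order \<open>(m d)^(-1/2)\<close>; the first moments in \<open>weighted_wave_approx\<close> are of
  order \<open>1 / (m d)\<close>.
\<close>
lemma weighted_wave_integral_lower:
  assumes m: "m \<ge> 1"
  shows "norm (LINT x|lborel. line_wave m x * weight x) \<ge>
         norm (line_wave m b) * (b / 125 / sqrt (real m * d) - 4 * laplace_const / decay / (real m * d))"
proof -
  define N where "N = real m * d"
  have N: "N > 0" using d_pos m by (simp add: N_def)
  define p where "p = N * decay / 2"
  have p: "p > 0" using N decay_pos by (simp add: p_def)
  let ?F = "\<lambda>x. laplace_const * (\<bar>x - b\<bar> * exp (- p * (x - b)\<^sup>2) + \<bar>x - (- b)\<bar> * exp (- p * (x - (- b))\<^sup>2))"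
  let ?w = "\<lambda>x. line_wave m x / line_wave m b * weight x"
  let ?g = "\<lambda>x. gauss m x * weight b"
  have k: "Re (of_real N * curv) > 0" using N curv_bounds(2) by simp
  have gi: "integrable lborel (gauss m)"
    using lborel_integrable_real_affine[OF complex_gaussian_integrable[OF k], of 1 "- b"]
    unfolding gauss_def N_def[symmetric] by (simp only: mult_1 add_uminus_conv_diff add.commute[of "-b"])
  have gval: "(LINT x|lborel. gauss m x) = (LINT x|lborel. exp (- (of_real N * curv) * of_real (x\<^sup>2) / 2))"
    using lborel_integral_real_affine[of 1 "\<lambda>x. exp (- (of_real N * curv) * of_real (x\<^sup>2) / 2)" "- b"]
    unfolding gauss_def N_def[symmetric] by (simp only: mult_1 add_uminus_conv_diff add.commute[of "-b"] abs_one scaleR_one one_neq_zero simp_thms)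
  have gn: "norm (LINT x|lborel. gauss m x) \<ge> 1 / (2 * sqrt N)"
  proof (rule power2_le_imp_le)
    have "(norm (LINT x|lborel. gauss m x))\<^sup>2 = 2 * pi / (N * norm curv)"
      unfolding gval norm_complex_gaussian_integral[OF k] using N by (simp add: norm_mult)
    moreover have "(1 / (2 * sqrt N))\<^sup>2 = 1 / (4 * N)"
      using N by (simp add: power_divide power_mult_distrib)
    moreover have "1 / (4 * N) \<le> 2 * pi / (N * norm curv)"
    proof -
      have c0: "norm curv > 0" using curv_bounds(2) by auto
      have "norm curv \<le> 8 * pi" using curv_bounds(3) pi_ge_two by linarith
      then show ?thesis using N c0 by (simp add: field_simps)
    qed
    ultimately show "(1 / (2 * sqrt N))\<^sup>2 \<le> (norm (LINT x|lborel. gauss m x))\<^sup>2" by simp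
  qed simp
  have wi: "integrable lborel ?w"
    using integrable_mult_right[OF weighted_wave_integrable[OF m], of "1 / line_wave m b"] by simp
  have Fi: "integrable lborel ?F" and Fv: "(LINT x|lborel. ?F x) = laplace_const * (1 / p + 1 / p)"
    using gaussian_abs_moment[OF p, of b] gaussian_abs_moment[OF p, of "-b"] by simp_all
  have "norm ((LINT x|lborel. ?w x) - (LINT x|lborel. ?g x)) = norm (LINT x|lborel. ?w x - ?g x)"
    using wi gi by (subst Bochner_Integration.integral_diff) auto
  also have "\<dots> \<le> (LINT x|lborel. norm (?w x - ?g x))" by (rule integral_norm_bound)
  also have "\<dots> \<le> (LINT x|lborel. ?F x)"
  proof (rule integral_mono[OF _ Fi])
    show "integrable lborel (\<lambda>x. norm (?w x - ?g x))"
      using wi gi by (intro integrable_norm Bochner_Integration.integrable_diff) auto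
    show "norm (?w x - ?g x) \<le> ?F x" for x
      using weighted_wave_approx[of m x] unfolding p_def N_def .
  qed
  also have "\<dots> = laplace_const * (1 / p + 1 / p)" by (rule Fv)
  also have "\<dots> = 4 * laplace_const / decay / N" unfolding p_def using N decay_pos by (simp add: field_simps)
  finally have "norm (LINT x|lborel. ?g x) - 4 * laplace_const / decay / N \<le> norm (LINT x|lborel. ?w x)"
    using norm_triangle_ineq2[of "LINT x|lborel. ?g x" "LINT x|lborel. ?w x"]
    unfolding norm_minus_commute[of "LINT x|lborel. ?g x"] by linarith
  moreover have "norm (LINT x|lborel. ?g x) \<ge> 1 / (2 * sqrt N) * (2 * b / 125)"
    unfolding integral_mult_left_zero norm_mult using gn weight_bounds(3) b_pos by (intro mult_mono) auto
  moreover have "1 / (2 * sqrt N) * (2 * b / 125) = b / 125 / sqrt N" by simp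
  ultimately have "b / 125 / sqrt N - 4 * laplace_const / decay / N \<le> norm (LINT x|lborel. ?w x)" by linarith
  moreover have "(LINT x|lborel. ?w x) = (LINT x|lborel. line_wave m x * weight x) / line_wave m b"
    by simp
  moreover have "norm (line_wave m b) > 0" using line_wave_nonzero b_pos by simp
  ultimately show ?thesis unfolding N_def by (simp add: norm_divide le_divide_eq mult.commute)
qed

end


section \<open>Uniform two-sided bounds\<close>

text \<open>
  The value of \<open>\<alpha>\<close> for which \<open>\<alpha> (\<zeta>^3 - \<zeta>) + 1\<close> has a root in the first quadrant with real part \<open>1 / d\<close>.
\<close>
definition pole_ratio :: "real \<Rightarrow> real" where
  "pole_ratio d = d ^ 3 / (2 * (4 - d\<^sup>2))"

text \<open>
  The logarithm of \<open>H_e\<close> at \<open>\<alpha> = pole_ratio d\<close>, as \<open>H_e_eq_exp_saddle_rate\<close> shows.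
\<close>
definition saddle_rate :: "real \<Rightarrow> real" where
  "saddle_rate d = d * (d\<^sup>2 - 2) / (2 * (4 - d\<^sup>2)) + (ln (4 - 2 * d) - ln (4 + 2 * d)) / 2"

context saddle
begin

lemma norm_wave_at_saddle: "norm (line_wave m b) = exp (real m * saddle_rate d)"
proof -
  have e: "b\<^sup>2 + (1 - d)\<^sup>2 = 4 - 2 * d" "b\<^sup>2 + (1 + d)\<^sup>2 = 4 + 2 * d"
    using d_b_facts(2) by (simp_all add: power2_eq_square algebra_simps)
  have e': "b\<^sup>2 - 1 = 2 - d\<^sup>2" using d_b_facts(2) by simp
  have e'': "- (d / D) * (2 - X) = d * (X - 2) / D" for D X :: real
    by (simp add: algebra_simps diff_divide_distrib)
  have "logsize (b\<^sup>2) = saddle_rate d"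
    unfolding logsize_def saddle_rate_def e e' e'' by simp
  then show ?thesis using norm_line_wave[of b m] b_pos by simp
qed

lemma scaled_point: "Complex (x / d) (1 / d) = (of_real x + \<i>) / of_real d"
  by (simp add: complex_eq_iff)

lemma cayley_scaled: "cayley (Complex (x / d) (1 / d)) = (of_real d + \<i> * (of_real x + \<i>)) / (of_real d - \<i> * (of_real x + \<i>))"
proof -
  have "(1 + \<i> * (Y / D)) / (1 - \<i> * (Y / D)) = (D + \<i> * Y) / (D - \<i> * Y)" if "D \<noteq> 0" for D Y :: complex
  proof -
    have "1 + \<i> * (Y / D) = (D + \<i> * Y) / D" "1 - \<i> * (Y / D) = (D - \<i> * Y) / D"
      using that by (simp_all add: add_divide_distrib diff_divide_distrib)
    then show ?thesis using that by simp
  qed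
  then show ?thesis unfolding cayley_def scaled_point using d_pos by simp
qed

lemma wave_scaled:
  "exp (- of_real (real m * pole_ratio d) * (Complex (x / d) (1 / d))\<^sup>2) * cayley (Complex (x / d) (1 / d)) ^ m = line_wave m x"
proof -
  have r: "real m * pole_ratio d = real m * d / (2 * (4 - d\<^sup>2)) * d\<^sup>2"
    by (simp add: pole_ratio_def power3_eq_cube power2_eq_square)
  have "of_real (real m * pole_ratio d) * (Complex (x / d) (1 / d))\<^sup>2 = of_real (real m * d / (2 * (4 - d\<^sup>2))) * (of_real x + \<i>)\<^sup>2"
  proof -
    have gen: "A * D\<^sup>2 * (Y / D)\<^sup>2 = A * Y\<^sup>2" if "D \<noteq> 0" for A D Y :: complex
      using that by (simp add: power_divide)
    show ?thesis unfolding r scaled_point of_real_mult[of _ "d\<^sup>2"] of_real_power by (rule gen) (use d_pos in simp)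
  qed
  then show ?thesis unfolding wave_def cayley_scaled by (simp only: mult_minus_left)
qed

lemma annihilator_scaled:
  fixes x :: real
  defines "c \<equiv> cayley (Complex (- b / d) (1 / d))"
  shows "exp (- of_real (real m * pole_ratio d) * (Complex (x / d) (1 / d))\<^sup>2) * annihilator m c (Complex (x / d) (1 / d))
     = 2 * of_real (d ^ 3) / (of_real d - \<i> * (of_real (- b) + \<i>)) * (line_wave m x * weight x)"
proof -
  let ?u = "Complex (x / d) (1 / d)"
  let ?D = "complex_of_real d" and ?y = "of_real x + \<i>" and ?z = "of_real (- b) + \<i>"
  have D: "?D \<noteq> 0" using d_pos by simp
  have y: "?D - \<i> * ?y \<noteq> 0" and z: "?D - \<i> * ?z \<noteq> 0" by (rule den_nonzero)+
  have den: "1 - \<i> * ?u = (?D - \<i> * ?y) / ?D"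
    unfolding scaled_point using D by (simp add: diff_divide_distrib)
  have "annihilator m c ?u = cayley ?u ^ m * ((cayley ?u - c) / (1 - \<i> * ?u)\<^sup>2)"
    by (simp add: annihilator_def cayley_def power_divide power_add power2_eq_square)
  also have "(cayley ?u - c) / (1 - \<i> * ?u)\<^sup>2 = 2 * of_real (d ^ 3) / (?D - \<i> * ?z) * weight x"
  proof -
    have c: "c = (?D + \<i> * ?z) / (?D - \<i> * ?z)"
      unfolding c_def using cayley_scaled[of "- b"] by simp
    have "(cayley ?u - c) = 2 * \<i> * ?D * (?y - ?z) / ((?D - \<i> * ?y) * (?D - \<i> * ?z))"
    proof -
      have "(D + \<i> * Y) / (D - \<i> * Y) - (D + \<i> * Z) / (D - \<i> * Z) = 2 * \<i> * D * (Y - Z) / ((D - \<i> * Y) * (D - \<i> * Z))"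
        if "D - \<i> * Y \<noteq> 0" "D - \<i> * Z \<noteq> 0" for D Y Z :: complex
        unfolding diff_frac_eq[OF that] by (simp add: algebra_simps)
      from this[OF y z] show ?thesis unfolding c cayley_scaled .
    qed
    moreover have "?y - ?z = of_real x + of_real b" by simp
    moreover have "weight x = \<i> * (of_real x + of_real b) / (?D - \<i> * ?y) ^ 3"
    proof -
      have w: "?D - \<i> * ?y = - \<i> * (of_real x + \<i> * of_real (1 + d))" by (simp add: algebra_simps)
      show ?thesis unfolding weight_def w power_mult_distrib by (simp add: power3_eq_cube)
    qed
    moreover have "2 * \<i> * D * B / (A * C) / (A / D)\<^sup>2 = 2 * D ^ 3 / C * (\<i> * B / A ^ 3)" for A B C D :: complex
      by (simp add: power_divide power3_eq_cube power2_eq_square mult_ac)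
    ultimately show ?thesis unfolding den of_real_power by (simp only:)
  qed
  finally have "exp (- of_real (real m * pole_ratio d) * ?u\<^sup>2) * annihilator m c ?u
     = (exp (- of_real (real m * pole_ratio d) * ?u\<^sup>2) * cayley ?u ^ m) * (2 * of_real (d ^ 3) / (?D - \<i> * ?z) * weight x)"
    by (simp only: mult.assoc)
  then show ?thesis unfolding wave_scaled by (simp only: mult_ac)
qed

lemma rat_error_upper_saddle:
  assumes m: "m \<ge> 1" and q: "q > 0" and t: "t > 0" and tq: "t * q = real m * pole_ratio d"
  shows "rat_error m t q \<le> 2 / sqrt (pi * decay) * (exp (real m * saddle_rate d) / sqrt (real m * d))"
proof -
  let ?F = "\<lambda>x. norm (exp (- of_real (t * q) * (Complex x (1 / d))\<^sup>2) * cayley (Complex x (1 / d)) ^ m)"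
  have "rat_error m t q \<le> (LINT x|lborel. ?F x) / (pi * (1 / d))"
    using d_pos by (intro rat_error_upper q t) simp
  also have "(LINT x|lborel. ?F x) = (1 / d) * (LINT x|lborel. ?F (0 + (1 / d) * x))"
    using lborel_integral_real_affine[of "1 / d" ?F 0] d_pos by simp
  also have "(LINT x|lborel. ?F (0 + (1 / d) * x)) = (LINT x|lborel. norm (line_wave m x))"
    unfolding tq using wave_scaled[of m] by simp
  also have "(1 / d) * (LINT x|lborel. norm (line_wave m x)) / (pi * (1 / d)) = (LINT x|lborel. norm (line_wave m x)) / pi"
    using d_pos by simp
  also have "\<dots> \<le> 2 * norm (line_wave m b) * sqrt (pi / (real m * d * decay)) / pi"
    using line_wave_integral_bound[OF m] by (intro divide_right_mono) auto
  also have "\<dots> = 2 / sqrt (pi * decay) * (exp (real m * saddle_rate d) / sqrt (real m * d))"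
  proof -
    have "sqrt (pi / (real m * d * decay)) / pi = 1 / (sqrt (pi * decay) * sqrt (real m * d))"
    proof -
      have "pi = sqrt pi * sqrt pi" by simp
      then have "sqrt pi / pi = 1 / sqrt pi" by (metis divide_divide_eq_left divide_self_if real_sqrt_eq_zero_cancel_iff pi_neq_zero)
      then have gen: "sqrt pi / (pi * X) = 1 / (sqrt pi * X)" for X
        by (metis divide_divide_eq_left)
      have "sqrt (pi / (real m * d * decay)) / pi = sqrt pi / (pi * (sqrt decay * sqrt (real m * d)))"
        by (simp add: real_sqrt_divide real_sqrt_mult mult_ac)
      then show ?thesis unfolding gen by (simp add: real_sqrt_mult mult.assoc)
    qed
    moreover have "2 * E * S / pi = 2 / A * (E / B)" if "S / pi = 1 / (A * B)" for E S A B :: real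
    proof -
      have "2 * E * S / pi = 2 * E * (S / pi)" by simp
      also have "\<dots> = 2 / A * (E / B)" unfolding that by simp
      finally show ?thesis .
    qed
    ultimately show ?thesis unfolding norm_wave_at_saddle by blast
  qed
  finally show ?thesis .
qed

lemma rat_error_lower_saddle:
  assumes m: "m \<ge> 1" and q: "q > 0" and t: "t > 0" and tq: "t * q = real m * pole_ratio d"
  shows "rat_error m t q \<ge> d\<^sup>2 / (5 * pi) * (exp (real m * saddle_rate d) *
           (b / 125 / sqrt (real m * d) - 4 * laplace_const / decay / (real m * d)))"
proof -
  define c where "c = cayley (Complex (- b / d) (1 / d))"
  let ?F = "\<lambda>x. exp (- of_real (t * q) * (Complex x (1 / d))\<^sup>2) * annihilator m c (Complex x (1 / d))"
  let ?z = "complex_of_real d - \<i> * (of_real (- b) + \<i>)"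
  let ?I = "LINT x|lborel. line_wave m x * weight x"
  have z: "norm ?z \<le> 5" "norm ?z > 0"
  proof -
    have "norm ?z \<le> \<bar>Re ?z\<bar> + \<bar>Im ?z\<bar>" by (rule cmod_le)
    then show "norm ?z \<le> 5" using d_b_facts(5,6) d_pos b_pos by simp
    show "norm ?z > 0" using den_nonzero[of "- b"] by simp
  qed
  have c1: "norm c \<le> 1" unfolding c_def using d_pos by (intro norm_cayley_le_1) simp
  have "(LINT x|lborel. ?F x) = (1 / d) *\<^sub>R (LINT x|lborel. ?F (0 + (1 / d) * x))"
    using lborel_integral_real_affine[of "1 / d" ?F 0] d_pos by simp
  also have "(LINT x|lborel. ?F (0 + (1 / d) * x)) = (LINT x|lborel. 2 * of_real (d ^ 3) / ?z * (line_wave m x * weight x))"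
    unfolding tq c_def using annihilator_scaled[of m] by simp
  also have "\<dots> = 2 * of_real (d ^ 3) / ?z * ?I"
    by (rule integral_mult_right_zero)
  finally have "norm (LINT x|lborel. ?F x) = 2 * d\<^sup>2 / norm ?z * norm ?I"
    using d_pos by (simp add: norm_mult norm_divide norm_power power3_eq_cube power2_eq_square del: of_real_minus)
  moreover have "2 * d\<^sup>2 / norm ?z * norm ?I \<ge> 2 * d\<^sup>2 / 5 * norm ?I"
    using z by (intro mult_right_mono divide_left_mono) auto
  moreover have "norm (LINT x|lborel. ?F x) \<le> pi * (1 + norm c) * rat_error m t q"
    using d_pos by (intro rat_error_lower q t) simp
  moreover have "pi * (1 + norm c) * rat_error m t q \<le> pi * 2 * rat_error m t q"
  proof (intro mult_right_mono mult_left_mono)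
    have "0 \<le> pi * (1 + norm c) * rat_error m t q"
      using calculation(3) norm_ge_zero order_trans by blast
    moreover have "pi * (1 + norm c) > 0" by (simp add: add_pos_nonneg)
    ultimately show "rat_error m t q \<ge> 0" by (simp only: zero_le_mult_iff) auto
  qed (use c1 in auto)
  ultimately have "2 * d\<^sup>2 / 5 * norm ?I \<le> pi * 2 * rat_error m t q" by linarith
  then have "d\<^sup>2 / (5 * pi) * norm ?I \<le> rat_error m t q"
    by (simp add: field_simps)
  moreover have "d\<^sup>2 / (5 * pi) * (exp (real m * saddle_rate d) * (b / 125 / sqrt (real m * d) - 4 * laplace_const / decay / (real m * d))) \<le> d\<^sup>2 / (5 * pi) * norm ?I"
    using weighted_wave_integral_lower[OF m] unfolding norm_wave_at_saddle by (intro mult_left_mono) auto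
  ultimately show ?thesis by linarith
qed

end

text \<open>
  The constants of the two preceding bounds are monotone in \<open>b\<close>, so they can be fixed for all \<open>b \<ge> \<beta>\<close>. This
  uniformity allows \<open>d\<close> to vary with \<open>m\<close>, and even to tend to 0.
\<close>
lemma rat_error_two_sided:
  fixes \<beta> :: real
  assumes \<beta>: "\<beta> > 0"
  obtains C c N0 where "C > 0" "c > 0" "N0 > 0"
    "\<And>d b m q t. saddle d b \<Longrightarrow> b \<ge> \<beta> \<Longrightarrow> m \<ge> 1 \<Longrightarrow> q > 0 \<Longrightarrow> t > 0 \<Longrightarrow> t * q = real m * pole_ratio d \<Longrightarrow>
       rat_error m t q \<le> C * (exp (real m * saddle_rate d) / sqrt (real m * d))"
    "\<And>d b m q t. saddle d b \<Longrightarrow> b \<ge> \<beta> \<Longrightarrow> m \<ge> 1 \<Longrightarrow> q > 0 \<Longrightarrow> t > 0 \<Longrightarrow> t * q = real m * pole_ratio d \<Longrightarrow>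
       real m * d \<ge> N0 \<Longrightarrow> c * d\<^sup>2 * (exp (real m * saddle_rate d) / sqrt (real m * d)) \<le> rat_error m t q"
proof -
  define D where "D = \<beta>\<^sup>2 / 400"
  define K where "K = 4 * (13 + 12 / \<beta> + 1464 / (\<beta> * D)) / D"
  have D: "D > 0" using \<beta> by (simp add: D_def)
  have K: "K > 0" using \<beta> D unfolding K_def by (intro divide_pos_pos mult_pos_pos add_pos_pos) auto
  have dec: "saddle.decay b \<ge> D" if "saddle d b" "b \<ge> \<beta>" for d b
    using that \<beta> unfolding saddle.decay_def[OF that(1)] D_def by (intro divide_right_mono power_mono) auto
  have con: "4 * saddle.laplace_const b / saddle.decay b \<le> K" if sb: "saddle d b" "b \<ge> \<beta>" for d b
  proof -
    have b: "b > 0" using that \<beta> by simp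
    have dd: "saddle.decay b > 0" using saddle.decay_pos[OF sb(1)] .
    have "saddle.laplace_const b \<le> 13 + 12 / \<beta> + 1464 / (\<beta> * D)"
      unfolding saddle.laplace_const_def[OF sb(1)] using sb(2) \<beta> D dec[OF sb]
      by (intro add_mono divide_left_mono mult_mono) (auto intro!: mult_pos_pos)
    moreover have "saddle.laplace_const b \<ge> 0"
      unfolding saddle.laplace_const_def[OF sb(1)] using b dd by (intro add_nonneg_nonneg) auto
    ultimately show ?thesis unfolding K_def using dec[OF sb] D by (intro frac_le) auto
  qed
  (* from the third constant on, the main term of the lower bound is twice the error term *)
  show thesis
  proof (rule that[of "2 / sqrt (pi * D)" "\<beta> / (1250 * pi)" "(250 * K / \<beta>)\<^sup>2"])
    show "2 / sqrt (pi * D) > 0" "\<beta> / (1250 * pi) > 0" "(250 * K / \<beta>)\<^sup>2 > 0" using D \<beta> K by auto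
  next
    fix d b q t :: real and m :: nat
    assume sb: "saddle d b" "b \<ge> \<beta>" and a: "m \<ge> 1" "q > 0" "t > 0" "t * q = real m * pole_ratio d"
    have d: "d > 0" using saddle.d_pos[OF sb(1)] .
    have "2 / sqrt (pi * saddle.decay b) \<le> 2 / sqrt (pi * D)"
      using dec[OF sb] D by (intro divide_left_mono) auto
    then have "2 / sqrt (pi * saddle.decay b) * (exp (real m * saddle_rate d) / sqrt (real m * d)) \<le> 2 / sqrt (pi * D) * (exp (real m * saddle_rate d) / sqrt (real m * d))"
      using d by (intro mult_right_mono) auto
    then show "rat_error m t q \<le> 2 / sqrt (pi * D) * (exp (real m * saddle_rate d) / sqrt (real m * d))"
      using saddle.rat_error_upper_saddle[OF sb(1) a] by linarith
  next
    fix d b q t :: real and m :: nat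
    assume sb: "saddle d b" "b \<ge> \<beta>" and a: "m \<ge> 1" "q > 0" "t > 0" "t * q = real m * pole_ratio d"
      and N: "real m * d \<ge> (250 * K / \<beta>)\<^sup>2"
    define n where "n = sqrt (real m * d)"
    have d: "d > 0" using saddle.d_pos[OF sb(1)] .
    have n: "n > 0" "n \<ge> 250 * K / \<beta>" "real m * d = n * n"
      using d a(1) N K \<beta> by (auto simp: n_def intro: real_le_rsqrt)
    have "\<beta> / 250 / n \<le> b / 125 / n - 4 * saddle.laplace_const b / saddle.decay b / (n * n)"
    proof -
      have "4 * saddle.laplace_const b / saddle.decay b / (n * n) \<le> K / (n * n)"
        using con[OF sb] n by (intro divide_right_mono) auto
      moreover have "K / (n * n) \<le> \<beta> / 250 / n"
        using n \<beta> by (simp add: field_simps)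
      moreover have "\<beta> / 125 / n \<le> b / 125 / n" using sb n by (intro divide_right_mono) auto
      moreover have "\<beta> / 125 / n = \<beta> / 250 / n + \<beta> / 250 / n" by simp
      ultimately show ?thesis by linarith
    qed
    then have "d\<^sup>2 / (5 * pi) * (exp (real m * saddle_rate d) * (\<beta> / 250 / n)) \<le> d\<^sup>2 / (5 * pi) * (exp (real m * saddle_rate d) * (b / 125 / n - 4 * saddle.laplace_const b / saddle.decay b / (n * n)))"
      by (intro mult_left_mono) auto
    also have "\<dots> \<le> rat_error m t q"
      using saddle.rat_error_lower_saddle[OF sb(1) a] unfolding n_def[symmetric] unfolding n(3) .
    finally show "\<beta> / (1250 * pi) * d\<^sup>2 * (exp (real m * saddle_rate d) / sqrt (real m * d)) \<le> rat_error m t q"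
      unfolding n_def by (simp add: field_simps)
  qed
qed


section \<open>The saddle parameter as a function of the pole ratio\<close>

lemma pole_ratio_strict_mono:
  assumes "0 \<le> d" "d < e" "e\<^sup>2 < 4"
  shows "pole_ratio d < pole_ratio e"
proof -
  have "d\<^sup>2 < e\<^sup>2" "d ^ 3 < e ^ 3" using assms by (auto intro: power_strict_mono)
  then show ?thesis unfolding pole_ratio_def using assms
    by (intro frac_less) auto
qed

lemma below_sqrt3: "0 \<le> d \<Longrightarrow> d < sqrt 3 \<Longrightarrow> d\<^sup>2 < (3::real)"
  using power_strict_mono[of d "sqrt 3" 2] by simp

lemma pole_ratio_mono_iff:
  assumes "0 \<le> d" "d < sqrt 3" "0 \<le> e" "e < sqrt 3"
  shows "pole_ratio d < pole_ratio e \<longleftrightarrow> d < e"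
  using pole_ratio_strict_mono[of d e] pole_ratio_strict_mono[of e d] below_sqrt3[of d] below_sqrt3[of e] assms
  by (cases d e rule: linorder_cases) auto

definition saddle_param :: "real \<Rightarrow> real" where
  "saddle_param \<alpha> = (THE d. 0 < d \<and> d < sqrt 3 \<and> pole_ratio d = \<alpha>)"

lemma saddle_param_pole_ratio:
  assumes "0 < d" "d < sqrt 3"
  shows "saddle_param (pole_ratio d) = d"
  unfolding saddle_param_def
proof (rule the_equality)
  fix e assume "0 < e \<and> e < sqrt 3 \<and> pole_ratio e = pole_ratio d"
  then show "e = d" using pole_ratio_mono_iff[of d e] pole_ratio_mono_iff[of e d] assms by linarith
qed (use assms in simp)

lemma saddle_param:
  assumes "0 < \<alpha>" "\<alpha> < alpha_c"
  shows "0 < saddle_param \<alpha>" "saddle_param \<alpha> < sqrt 3" "pole_ratio (saddle_param \<alpha>) = \<alpha>"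
proof -
  have ends: "pole_ratio 0 = 0" "pole_ratio (sqrt 3) = alpha_c"
    by (simp_all add: pole_ratio_def alpha_c_def power3_eq_cube)
  have "continuous_on {0..sqrt 3} pole_ratio"
    unfolding pole_ratio_def
  proof (intro continuous_intros ballI)
    fix d :: real assume "d \<in> {0..sqrt 3}"
    then have "d\<^sup>2 \<le> (sqrt 3)\<^sup>2" by (intro power_mono) auto
    then show "2 * (4 - d\<^sup>2) \<noteq> 0" by simp
  qed
  then obtain d where d: "0 \<le> d" "d \<le> sqrt 3" "pole_ratio d = \<alpha>"
    using IVT'[of pole_ratio 0 \<alpha> "sqrt 3"] assms ends by auto
  then have "0 < d" "d < sqrt 3" using assms ends by (auto simp: less_le)
  then show "0 < saddle_param \<alpha>" "saddle_param \<alpha> < sqrt 3" "pole_ratio (saddle_param \<alpha>) = \<alpha>"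
    using saddle_param_pole_ratio[of d] d(3) by auto
qed

lemma saddle_exists:
  assumes "0 < d" "d < sqrt 3"
  shows "saddle d (sqrt (3 - d\<^sup>2))"
  using assms below_sqrt3[of d] by unfold_locales auto

text \<open>
  The imaginary part of the cubic equation for \<open>x + i y\<close> gives \<open>y\<^sup>2 = 3 x\<^sup>2 - 1\<close>, in particular \<open>1 / x < \<surd>3\<close>; the real
  part then says that \<open>1 / x\<close> is mapped to \<open>\<alpha>\<close> by the injective function \<open>pole_ratio\<close>.
\<close>
lemma zeta_eq:
  assumes \<alpha>: "0 < \<alpha>" "\<alpha> < alpha_c"
  defines "d \<equiv> saddle_param \<alpha>"
  shows "zeta \<alpha> = Complex (1 / d) (sqrt (3 - d\<^sup>2) / d)"
  unfolding zeta_def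
proof (rule the_equality)
  have d: "0 < d" "d < sqrt 3" "pole_ratio d = \<alpha>" using saddle_param[OF \<alpha>] by (simp_all add: d_def)
  have d3: "d\<^sup>2 < 3" using below_sqrt3 d by simp
  have cubic: "of_real \<alpha> * (Complex x y ^ 3 - Complex x y) + 1 =
     Complex (\<alpha> * (x ^ 3 - 3 * x * y\<^sup>2 - x) + 1) (\<alpha> * y * (3 * x\<^sup>2 - y\<^sup>2 - 1))" for x y
    by (simp add: complex_eq_iff power3_eq_cube power2_eq_square algebra_simps)
  define b where "b = sqrt (3 - d\<^sup>2)"
  have b: "b > 0" "b\<^sup>2 = 3 - d\<^sup>2" using d3 by (simp_all add: b_def)
  have a: "\<alpha> * (2 * (4 - d\<^sup>2)) = d ^ 3"
    using d(3) d3 by (auto simp: pole_ratio_def field_simps)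
  have "\<alpha> * ((1 / d) ^ 3 - 3 * (1 / d) * (b / d)\<^sup>2 - 1 / d) + 1 = 0"
  proof -
    have "(1 / d) ^ 3 - 3 * (1 / d) * (b / d)\<^sup>2 - 1 / d = (1 - 3 * b\<^sup>2 - d\<^sup>2) / d ^ 3"
      using d(1) by (simp add: field_simps power3_eq_cube power2_eq_square)
    also have "1 - 3 * b\<^sup>2 - d\<^sup>2 = - (2 * (4 - d\<^sup>2))" using b(2) by simp
    finally have "\<alpha> * ((1 / d) ^ 3 - 3 * (1 / d) * (b / d)\<^sup>2 - 1 / d) = - (\<alpha> * (2 * (4 - d\<^sup>2))) / d ^ 3"
      by (simp only: times_divide_eq_right mult_minus_right)
    then show ?thesis unfolding a using d(1) by simp
  qed
  moreover have "3 * (1 / d)\<^sup>2 - (b / d)\<^sup>2 - 1 = 0"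
    using d(1) b(2) by (simp add: field_simps)
  ultimately show "of_real \<alpha> * (Complex (1 / d) (sqrt (3 - d\<^sup>2) / d) ^ 3 - Complex (1 / d) (sqrt (3 - d\<^sup>2) / d)) + 1 = 0
      \<and> 0 < Re (Complex (1 / d) (sqrt (3 - d\<^sup>2) / d)) \<and> 0 < Im (Complex (1 / d) (sqrt (3 - d\<^sup>2) / d))"
    unfolding cubic using d(1) b unfolding b_def by (simp add: complex_eq_iff)
  fix z assume z: "of_real \<alpha> * (z ^ 3 - z) + 1 = 0 \<and> 0 < Re z \<and> 0 < Im z"
  obtain x y where xy: "z = Complex x y" by (cases z)
  have x: "x > 0" and y: "y > 0" using z xy by auto
  have "Complex (\<alpha> * (x ^ 3 - 3 * x * y\<^sup>2 - x) + 1) (\<alpha> * y * (3 * x\<^sup>2 - y\<^sup>2 - 1)) = 0"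
    using z unfolding xy cubic by blast
  then have re: "\<alpha> * (x ^ 3 - 3 * x * y\<^sup>2 - x) + 1 = 0" and im: "\<alpha> * y * (3 * x\<^sup>2 - y\<^sup>2 - 1) = 0"
    by (auto simp: complex_eq_iff)
  from im have y2: "y\<^sup>2 = 3 * x\<^sup>2 - 1" using \<alpha>(1) y by auto
  have pos: "3 * x\<^sup>2 > 1" using y2 zero_less_power[OF y, of 2] by linarith
  define e where "e = 1 / x"
  have e: "e > 0" "x = 1 / e" using x by (auto simp: e_def)
  have e3: "e\<^sup>2 < 3" using pos x by (simp add: e_def power_divide divide_less_eq)
  then have e_lt: "e < sqrt 3" by (simp add: real_less_rsqrt)
  have "\<alpha> * (8 * x ^ 3 - 2 * x) = 1"
    using re unfolding y2 by (simp add: algebra_simps power3_eq_cube power2_eq_square)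
  then have "\<alpha> * ((8 - 2 * e\<^sup>2) / e ^ 3) = 1"
    unfolding e(2) using e(1) by (simp add: field_simps power3_eq_cube power2_eq_square)
  then have "pole_ratio e = \<alpha>" unfolding pole_ratio_def using e(1) e3 by (simp add: field_simps)
  then have ed: "e = d" using saddle_param_pole_ratio[OF e(1) e_lt] by (simp add: d_def)
  have "y = sqrt (3 * x\<^sup>2 - 1)" using y2 y by (metis less_imp_le real_sqrt_unique)
  also have "3 * x\<^sup>2 - 1 = (3 - d\<^sup>2) / d\<^sup>2" unfolding e(2) ed using d(1) by (simp add: field_simps)
  also have "sqrt \<dots> = sqrt (3 - d\<^sup>2) / d" using d(1) by (simp add: real_sqrt_divide)
  finally show "z = Complex (1 / d) (sqrt (3 - d\<^sup>2) / d)" unfolding xy e(2) ed by simp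
qed

lemma H_e_eq_exp_saddle_rate:
  assumes \<alpha>: "0 < \<alpha>" "\<alpha> < alpha_c"
  shows "H_e \<alpha> = exp (saddle_rate (saddle_param \<alpha>))"
proof -
  define d where "d = saddle_param \<alpha>"
  have d: "0 < d" "d < sqrt 3" "pole_ratio d = \<alpha>" using saddle_param[OF \<alpha>] by (simp_all add: d_def)
  have d3: "d\<^sup>2 < 3" using below_sqrt3 d by simp
  have d_b_facts: "d < 2" using d3 power2_less_imp_less[of d 2] by simp
  define b where "b = sqrt (3 - d\<^sup>2)"
  have b: "b\<^sup>2 = 3 - d\<^sup>2" using d3 by (simp add: b_def)
  have z: "zeta \<alpha> = Complex (1 / d) (b / d)" using zeta_eq[OF \<alpha>] by (simp add: d_def b_def)
  have sq: "(1 / d - 1)\<^sup>2 + (b / d)\<^sup>2 = (4 - 2 * d) / d\<^sup>2" "(1 / d + 1)\<^sup>2 + (b / d)\<^sup>2 = (4 + 2 * d) / d\<^sup>2"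
    using d(1) b by (simp_all add: power_divide power2_diff power2_sum field_simps)
  have n: "norm (zeta \<alpha> - 1) = sqrt ((4 - 2 * d) / d\<^sup>2)" "norm (zeta \<alpha> + 1) = sqrt ((4 + 2 * d) / d\<^sup>2)"
    unfolding z sq[symmetric] by (simp_all add: cmod_def)
  have s: "sqrt X = exp (ln X / 2)" if "X > 0" for X :: real
    using that by (simp add: ln_sqrt[symmetric])
  have "norm ((zeta \<alpha> - 1) / (zeta \<alpha> + 1)) = sqrt (4 - 2 * d) / sqrt (4 + 2 * d)"
    unfolding norm_divide n using d(1) by (simp add: real_sqrt_divide)
  also have "\<dots> = exp ((ln (4 - 2 * d) - ln (4 + 2 * d)) / 2)"
    using d(1) d_b_facts s[of "4 - 2 * d"] s[of "4 + 2 * d"] by (simp add: exp_diff diff_divide_distrib)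
  finally have 1: "norm ((zeta \<alpha> - 1) / (zeta \<alpha> + 1)) = exp ((ln (4 - 2 * d) - ln (4 + 2 * d)) / 2)" .
  have "Re ((zeta \<alpha>)\<^sup>2) = (1 / d)\<^sup>2 - (b / d)\<^sup>2" unfolding z by (simp add: power2_eq_square)
  also have "\<dots> = (d\<^sup>2 - 2) / d\<^sup>2" using b by (simp add: power_divide diff_divide_distrib[symmetric])
  finally have "\<alpha> * Re ((zeta \<alpha>)\<^sup>2) = d * (d\<^sup>2 - 2) / (2 * (4 - d\<^sup>2))"
  proof -
    assume re: "Re ((zeta \<alpha>)\<^sup>2) = (d\<^sup>2 - 2) / d\<^sup>2"
    have "d ^ 3 / D * (X / d\<^sup>2) = d * X / D" for D X :: real
      using d(1) by (simp add: power3_eq_cube power2_eq_square)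
    moreover have a: "\<alpha> = d ^ 3 / (2 * (4 - d\<^sup>2))" using d(3) by (simp add: pole_ratio_def)
    ultimately show ?thesis unfolding re by (metis a)
  qed
  then show ?thesis unfolding H_e_def 1 saddle_rate_def d_def[symmetric] mult_exp_exp by (simp add: add.commute)
qed

text \<open>
  The inverse of a strictly monotone function is continuous. The boundary point \<open>d = 0\<close> is included.
\<close>
lemma saddle_param_tendsto:
  assumes lim: "(a \<longlongrightarrow> pole_ratio d) F" and ev: "eventually (\<lambda>m. 0 < a m \<and> a m < alpha_c) F"
    and d: "0 \<le> d" "d < sqrt 3"
  shows "((\<lambda>m. saddle_param (a m)) \<longlongrightarrow> d) F"
proof (rule order_tendstoI)
  fix l assume l: "l < d"
  show "eventually (\<lambda>m. l < saddle_param (a m)) F"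
  proof (cases "l \<ge> 0")
    case True
    then have "pole_ratio l < pole_ratio d" using pole_ratio_mono_iff[of l d] l d by simp
    with lim have "eventually (\<lambda>m. pole_ratio l < a m) F" by (rule order_tendstoD)
    with ev show ?thesis
    proof eventually_elim
      case (elim m)
      then show ?case using saddle_param[of "a m"] pole_ratio_mono_iff[of l "saddle_param (a m)"] True l d by auto
    qed
  next
    case False
    from ev show ?thesis by eventually_elim (use False saddle_param(1) in force)
  qed
next
  fix u assume u: "d < u"
  show "eventually (\<lambda>m. saddle_param (a m) < u) F"
  proof (cases "u < sqrt 3")
    case True
    then have "pole_ratio d < pole_ratio u" using pole_ratio_mono_iff[of d u] u d by simp
    with lim have "eventually (\<lambda>m. a m < pole_ratio u) F" by (rule order_tendstoD)
    with ev show ?thesis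
    proof eventually_elim
      case (elim m)
      then show ?case using saddle_param[of "a m"] pole_ratio_mono_iff[of "saddle_param (a m)" u] True u d by auto
    qed
  next
    case False
    from ev show ?thesis by eventually_elim (use False saddle_param(2) in force)
  qed
qed

section \<open>Asymptotics of the error\<close>

text \<open>
  The case \<open>d0 = 0\<close> is that of poles of smaller order than \<open>m\<close>.
\<close>
locale convergent_pole_ratio =
  fixes t :: real and q :: "nat \<Rightarrow> real" and d0 :: real
  assumes t: "t > 0" and q: "\<And>m. m \<ge> 1 \<Longrightarrow> q m > 0"
    and d0: "0 \<le> d0" "d0 < sqrt 3"
    and ratio: "(\<lambda>m. t * q m / real m) \<longlonglongrightarrow> pole_ratio d0"
begin

definition d :: "nat \<Rightarrow> real" where
  "d m = saddle_param (t * q m / real m)"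

abbreviation "E m \<equiv> rat_error m t (q m)"

lemma ratio_range: "eventually (\<lambda>m. m \<ge> 1 \<and> 0 < t * q m / real m \<and> t * q m / real m < alpha_c) sequentially"
proof -
  have "pole_ratio d0 < pole_ratio (sqrt 3)" using d0 by (intro pole_ratio_strict_mono) auto
  then have "pole_ratio d0 < alpha_c" by (simp add: pole_ratio_def alpha_c_def power3_eq_cube)
  with ratio have "eventually (\<lambda>m. t * q m / real m < alpha_c) sequentially" by (rule order_tendstoD)
  with eventually_ge_at_top[of 1] show ?thesis
    by eventually_elim (use t q in auto)
qed

lemma d_tendsto: "d \<longlonglongrightarrow> d0"
  unfolding d_def using ratio d0 by (intro saddle_param_tendsto eventually_mono[OF ratio_range]) auto

lemma d_props: "eventually (\<lambda>m. m \<ge> 1 \<and> 0 < d m \<and> d m < sqrt 3 \<and> t * q m = real m * pole_ratio (d m)) sequentially"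
  using ratio_range
proof eventually_elim
  case (elim m)
  then show ?case using saddle_param[of "t * q m / real m"] by (simp add: d_def)
qed

lemma two_sided:
  assumes N: "filterlim (\<lambda>m. real m * d m) at_top sequentially"
  obtains C c where "C > 0" "c > 0"
    "eventually (\<lambda>m. E m \<le> C * (exp (real m * saddle_rate (d m)) / sqrt (real m * d m))) sequentially"
    "eventually (\<lambda>m. c * (d m)\<^sup>2 * (exp (real m * saddle_rate (d m)) / sqrt (real m * d m)) \<le> E m) sequentially"
proof -
  define d1 where "d1 = (d0 + sqrt 3) / 2"
  have d1: "d0 < d1" "0 \<le> d1" "d1 < sqrt 3" using d0 by (auto simp: d1_def)
  define \<beta> where "\<beta> = sqrt (3 - d1\<^sup>2)"
  have "\<beta> > 0" using below_sqrt3[of d1] d1 by (simp add: \<beta>_def)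
  then obtain C c N0 where C: "C > 0" "c > 0" "N0 > 0"
    and up: "\<And>d b m q t. saddle d b \<Longrightarrow> b \<ge> \<beta> \<Longrightarrow> m \<ge> 1 \<Longrightarrow> q > 0 \<Longrightarrow> t > 0 \<Longrightarrow> t * q = real m * pole_ratio d \<Longrightarrow>
       rat_error m t q \<le> C * (exp (real m * saddle_rate d) / sqrt (real m * d))"
    and lo: "\<And>d b m q t. saddle d b \<Longrightarrow> b \<ge> \<beta> \<Longrightarrow> m \<ge> 1 \<Longrightarrow> q > 0 \<Longrightarrow> t > 0 \<Longrightarrow> t * q = real m * pole_ratio d \<Longrightarrow>
       real m * d \<ge> N0 \<Longrightarrow> c * d\<^sup>2 * (exp (real m * saddle_rate d) / sqrt (real m * d)) \<le> rat_error m t q"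
    by (rule rat_error_two_sided) blast
  have ev: "eventually (\<lambda>m. saddle (d m) (sqrt (3 - (d m)\<^sup>2)) \<and> sqrt (3 - (d m)\<^sup>2) \<ge> \<beta> \<and> m \<ge> 1 \<and> t * q m = real m * pole_ratio (d m)) sequentially"
    using d_props order_tendstoD(2)[OF d_tendsto d1(1)]
  proof eventually_elim
    case (elim m)
    have "(d m)\<^sup>2 \<le> d1\<^sup>2" using elim by (intro power_mono) auto
    then have "sqrt (3 - (d m)\<^sup>2) \<ge> \<beta>" by (simp add: \<beta>_def)
    then show ?case using saddle_exists[of "d m"] elim by auto
  qed
  show thesis
  proof (rule that[OF C(1,2)])
    show "eventually (\<lambda>m. E m \<le> C * (exp (real m * saddle_rate (d m)) / sqrt (real m * d m))) sequentially"
      using ev by eventually_elim (use up t q in blast)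
    have "eventually (\<lambda>m. real m * d m \<ge> N0) sequentially" using N by (simp add: filterlim_at_top)
    with ev show "eventually (\<lambda>m. c * (d m)\<^sup>2 * (exp (real m * saddle_rate (d m)) / sqrt (real m * d m)) \<le> E m) sequentially"
      by eventually_elim (use lo t q in blast)
  qed
qed

text \<open>
  Powers of \<open>m\<close> and \<open>d\<close> only cost multiples of \<open>ln m\<close>: eventually \<open>m d \<ge> 1\<close>, hence \<open>d \<ge> 1 / m\<close>.
\<close>
lemma log_error:
  assumes N: "filterlim (\<lambda>m. real m * d m) at_top sequentially"
  obtains K where "eventually (\<lambda>m. E m > 0 \<and> \<bar>ln (E m) - real m * saddle_rate (d m)\<bar> \<le> K + 3 * ln (real m)) sequentially"
proof -
  obtain C c where C: "C > 0" "c > 0"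
    and up: "eventually (\<lambda>m. E m \<le> C * (exp (real m * saddle_rate (d m)) / sqrt (real m * d m))) sequentially"
    and lo: "eventually (\<lambda>m. c * (d m)\<^sup>2 * (exp (real m * saddle_rate (d m)) / sqrt (real m * d m)) \<le> E m) sequentially"
    using two_sided[OF N] by blast
  have N1: "eventually (\<lambda>m. real m * d m \<ge> 1) sequentially" using N by (simp add: filterlim_at_top)
  have "eventually (\<lambda>m. E m > 0 \<and> \<bar>ln (E m) - real m * saddle_rate (d m)\<bar> \<le> (\<bar>ln C\<bar> + \<bar>ln c\<bar> + ln 2) + 3 * ln (real m)) sequentially"
    using up lo N1 d_props
  proof eventually_elim
    case (elim m)
    define n where "n = real m * d m"
    have m: "real m \<ge> 1" and d: "d m > 0" and n1: "n \<ge> 1" using elim by (auto simp: n_def)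
    have lm: "ln (real m) \<ge> 0" using m by simp
    have d_b_facts: "d m < 2" using elim power2_less_imp_less[of "sqrt 3" 2] by simp
    have lo': "0 < c * (d m)\<^sup>2 * (exp (real m * saddle_rate (d m)) / sqrt n)"
      using C d n1 by simp
    then have E: "E m > 0" using elim unfolding n_def by linarith
    have lnn: "ln n = ln (real m) + ln (d m)" using m d by (simp add: n_def ln_mult)
    have "ln (d m) \<le> ln 2" using d d_b_facts by simp
    have ln0: "ln n \<ge> 0" using n1 by simp
    have "ln (E m) \<le> ln (C * (exp (real m * saddle_rate (d m)) / sqrt n))"
      using elim E unfolding n_def by (intro ln_mono) auto
    also have "\<dots> = ln C + real m * saddle_rate (d m) - ln n / 2"
      using C n1 by (simp add: ln_mult ln_div ln_sqrt)
    finally have 1: "ln (E m) - real m * saddle_rate (d m) \<le> \<bar>ln C\<bar>" using ln0 by linarith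
    have "ln (c * (d m)\<^sup>2 * (exp (real m * saddle_rate (d m)) / sqrt n)) \<le> ln (E m)"
      using elim lo' unfolding n_def by (intro ln_mono) auto
    moreover have "ln (c * (d m)\<^sup>2 * (exp (real m * saddle_rate (d m)) / sqrt n)) = ln c + 2 * ln (d m) + real m * saddle_rate (d m) - ln n / 2"
      using C n1 d by (simp add: ln_mult ln_div ln_sqrt ln_realpow)
    ultimately have 2: "ln (E m) - real m * saddle_rate (d m) \<ge> - \<bar>ln c\<bar> - ln 2 - 3 * ln (real m)"
      using ln0 lnn \<open>ln (d m) \<le> ln 2\<close> lm by linarith
    have "ln (2::real) \<ge> 0" by simp
    with 1 2 lm E show ?case by (intro conjI abs_leI) linarith+
  qed
  then show thesis using that by blast
qed

lemma error_root_limit: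
  assumes d0_pos: "d0 > 0"
  shows "(\<lambda>m. E m powr (1 / real m)) \<longlonglongrightarrow> exp (saddle_rate d0)"
proof -
  have "filterlim (\<lambda>m. real m * d m) at_top sequentially"
    by (rule filterlim_at_top_mult_tendsto_pos[OF d_tendsto d0_pos filterlim_real_sequentially])
  then obtain K where K: "eventually (\<lambda>m. E m > 0 \<and> \<bar>ln (E m) - real m * saddle_rate (d m)\<bar> \<le> K + 3 * ln (real m)) sequentially"
    by (rule log_error)
  have "(\<lambda>m. saddle_rate (d m)) \<longlonglongrightarrow> saddle_rate d0"
  proof -
    have "d0\<^sup>2 < 3" using below_sqrt3 d0 by simp
    moreover have "d0 < 2" using calculation power2_less_imp_less[of d0 2] by simp
    ultimately show ?thesis unfolding saddle_rate_def using d0(1)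
      by (intro tendsto_intros d_tendsto) auto
  qed
  moreover have "(\<lambda>m. ln (E m) / real m - saddle_rate (d m)) \<longlonglongrightarrow> 0"
  proof (rule Lim_null_comparison)
    show "eventually (\<lambda>m. norm (ln (E m) / real m - saddle_rate (d m)) \<le> (K + 3 * ln (real m)) / real m) sequentially"
      using K eventually_gt_at_top[of 0]
    proof eventually_elim
      case (elim m)
      have "ln (E m) / real m - saddle_rate (d m) = (ln (E m) - real m * saddle_rate (d m)) / real m"
        using elim by (simp add: diff_divide_distrib)
      then show ?case using elim by (simp add: divide_right_mono)
    qed
    show "(\<lambda>m. (K + 3 * ln (real m)) / real m) \<longlonglongrightarrow> 0" by real_asymp
  qed
  ultimately have "(\<lambda>m. (ln (E m) / real m - saddle_rate (d m)) + saddle_rate (d m)) \<longlonglongrightarrow> 0 + saddle_rate d0"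
    by (intro tendsto_add)
  then have "(\<lambda>m. exp (ln (E m) / real m)) \<longlonglongrightarrow> exp (saddle_rate d0)"
    by (intro tendsto_exp) simp
  moreover have "eventually (\<lambda>m. exp (ln (E m) / real m) = E m powr (1 / real m)) sequentially"
    using K by eventually_elim (simp add: powr_def)
  ultimately show ?thesis by (rule Lim_transform_eventually)
qed

end

text \<open>
  Here the saddle does not move with \<open>m\<close>, so both bounds are constant multiples of the same sequence.
\<close>
lemma error_proportional_pole:
  fixes t \<alpha> :: real and q :: "nat \<Rightarrow> real"
  assumes t: "t > 0" and \<alpha>: "0 < \<alpha>" "\<alpha> < alpha_c" and q: "\<And>m. m \<ge> 1 \<Longrightarrow> q m = \<alpha> / t * real m"
  shows "(\<lambda>m. rat_error m t (q m)) \<in> \<Theta>(\<lambda>m. real m powr (- 1 / 2) * H_e \<alpha> ^ m)"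
proof -
  define d0 where "d0 = saddle_param \<alpha>"
  have dz: "0 < d0" "d0 < sqrt 3" "pole_ratio d0 = \<alpha>" using saddle_param[OF \<alpha>] by (simp_all add: d0_def)
  have ev: "eventually (\<lambda>m. t * q m / real m = \<alpha>) sequentially"
    using eventually_ge_at_top[of 1] by eventually_elim (use q t in simp)
  interpret convergent_pole_ratio t q d0
  proof
    show "(\<lambda>m. t * q m / real m) \<longlonglongrightarrow> pole_ratio d0"
      unfolding dz(3) using ev by (rule tendsto_eventually)
  qed (use dz t q \<alpha> in auto)
  have "filterlim (\<lambda>m. real m * d m) at_top sequentially"
    by (rule filterlim_at_top_mult_tendsto_pos[OF d_tendsto dz(1) filterlim_real_sequentially])
  then obtain C c where C: "C > 0" "c > 0"
    and up: "eventually (\<lambda>m. E m \<le> C * (exp (real m * saddle_rate (d m)) / sqrt (real m * d m))) sequentially"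
    and lo: "eventually (\<lambda>m. c * (d m)\<^sup>2 * (exp (real m * saddle_rate (d m)) / sqrt (real m * d m)) \<le> E m) sequentially"
    by (rule two_sided) blast
  let ?g = "\<lambda>m. real m powr (- 1 / 2) * H_e \<alpha> ^ m"
  have g: "eventually (\<lambda>m. ?g m \<ge> 0 \<and> d m = d0 \<and> exp (real m * saddle_rate (d m)) / sqrt (real m * d m) = ?g m / sqrt d0) sequentially"
    using ev eventually_gt_at_top[of 0]
  proof eventually_elim
    case (elim m)
    have "d m = d0" using elim by (simp add: d_def d0_def)
    moreover have "real m powr (- 1 / 2) = 1 / sqrt (real m)"
      using elim by (simp add: powr_minus powr_half_sqrt inverse_eq_divide)
    moreover have "H_e \<alpha> ^ m = exp (real m * saddle_rate d0)"
      unfolding H_e_eq_exp_saddle_rate[OF \<alpha>] d0_def by (simp add: exp_of_nat_mult)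
    ultimately show ?case by (simp add: real_sqrt_mult)
  qed
  show ?thesis
  proof (rule bigthetaI'[of "c * d0\<^sup>2 / sqrt d0" "C / sqrt d0"])
    show "c * d0\<^sup>2 / sqrt d0 > 0" "C / sqrt d0 > 0" using C dz(1) by simp_all
    show "eventually (\<lambda>m. c * d0\<^sup>2 / sqrt d0 * norm (?g m) \<le> norm (E m) \<and> norm (E m) \<le> C / sqrt d0 * norm (?g m)) sequentially"
      using up lo g
    proof eventually_elim
      case (elim m)
      then have eq: "exp (real m * saddle_rate (d m)) / sqrt (real m * d m) = ?g m / sqrt d0" "d m = d0" and g0: "?g m \<ge> 0"
        by blast+
      have h: "E m \<le> C * (?g m / sqrt d0)" "c * d0\<^sup>2 * (?g m / sqrt d0) \<le> E m" "?g m \<ge> 0"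
        using elim(1,2) g0 unfolding eq(1) unfolding eq(2) .
      have "c * d0\<^sup>2 * (?g m / sqrt d0) \<ge> 0" using C dz(1) by (intro mult_nonneg_nonneg divide_nonneg_nonneg[OF h(3)]) auto
      then have "norm (E m) = E m" using h(2) by simp
      moreover have "norm (?g m) = ?g m" using h(3) by simp
      ultimately show ?case using h(1,2) by simp
    qed
  qed
qed

text \<open>
  To leading order the logarithm of the error is \<open>m d\<close> times \<open>saddle_rate d / d\<close>, where \<open>d\<close> tends to 0 and the quotient tends
  to \<open>- 3 / 4\<close>. The relation \<open>(m d)^3 = 2 (4 - d\<^sup>2) t m\<^sup>2 q\<close> shows that \<open>m d\<close> is asymptotic to
  \<open>2 (t c)^(1/3) m^((2 + \<gamma>)/3)\<close>.
\<close>
lemma error_subproportional_pole: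
  fixes t c \<gamma> :: real and q :: "nat \<Rightarrow> real"
  assumes t: "t > 0" and q: "\<And>m. m \<ge> 1 \<Longrightarrow> q m > 0"
    and c: "c > 0" and \<gamma>: "0 \<le> \<gamma>" "\<gamma> < 1"
    and equiv: "asymp_equiv q sequentially (\<lambda>m. c * real m powr \<gamma>)"
  shows "(\<lambda>m. ln (rat_error m t (q m)) / real m powr ((2 + \<gamma>) / 3)) \<longlonglongrightarrow> - (3 / 2) * (t * c) powr (1 / 3)"
proof -
  define e where "e = (2 + \<gamma>) / 3"
  define \<rho> where "\<rho> = (\<lambda>m. q m / real m powr \<gamma>)"
  have \<rho>: "\<rho> \<longlonglongrightarrow> c"
  proof -
    have "(\<lambda>m. c * (if q m = 0 \<and> c * real m powr \<gamma> = 0 then 1 else q m / (c * real m powr \<gamma>))) \<longlonglongrightarrow> c * 1"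
      using equiv unfolding asymp_equiv_def by (intro tendsto_intros)
    moreover have "eventually (\<lambda>m. c * (if q m = 0 \<and> c * real m powr \<gamma> = 0 then 1 else q m / (c * real m powr \<gamma>)) = \<rho> m) sequentially"
      using eventually_ge_at_top[of 1]
    proof eventually_elim
      case (elim m)
      then show ?case using q[of m] c by (simp add: \<rho>_def)
    qed
    ultimately have "\<rho> \<longlonglongrightarrow> c * 1" by (rule Lim_transform_eventually)
    then show ?thesis by simp
  qed
  have ratio: "(\<lambda>m. t * q m / real m) \<longlonglongrightarrow> 0"
  proof -
    have "(\<lambda>m. real m powr (\<gamma> - 1)) \<longlonglongrightarrow> 0"
      using \<gamma> by (intro tendsto_neg_powr filterlim_real_sequentially) auto
    then have "(\<lambda>m. t * \<rho> m * real m powr (\<gamma> - 1)) \<longlonglongrightarrow> t * c * 0"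
      by (intro tendsto_intros \<rho>)
    moreover have "eventually (\<lambda>m. t * \<rho> m * real m powr (\<gamma> - 1) = t * q m / real m) sequentially"
      using eventually_gt_at_top[of 0]
    proof eventually_elim
      case (elim m)
      then show ?case by (simp add: \<rho>_def powr_diff)
    qed
    ultimately have "(\<lambda>m. t * q m / real m) \<longlonglongrightarrow> t * c * 0" by (rule Lim_transform_eventually)
    then show ?thesis by simp
  qed
  interpret convergent_pole_ratio t q 0
    using t q ratio by unfold_locales (auto simp: pole_ratio_def)
  have scale: "(\<lambda>m. real m * d m / real m powr e) \<longlonglongrightarrow> 2 * (t * c) powr (1 / 3)"
  proof -
    have "(\<lambda>m. (2 * (4 - (d m)\<^sup>2) * (t * \<rho> m)) powr (1 / 3)) \<longlonglongrightarrow> (2 * (4 - 0\<^sup>2) * (t * c)) powr (1 / 3)"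
      using t c by (intro tendsto_intros d_tendsto \<rho>) auto
    also have "(2 * (4 - 0\<^sup>2) * (t * c)) powr (1 / 3) = 2 * (t * c) powr (1 / 3)"
    proof -
      have "(8::real) powr (1 / 3) = (2 powr 3) powr (1 / 3)" by simp
      also have "\<dots> = 2" unfolding powr_powr by simp
      finally show ?thesis using t c by (simp add: powr_mult)
    qed
    finally have lim: "(\<lambda>m. (2 * (4 - (d m)\<^sup>2) * (t * \<rho> m)) powr (1 / 3)) \<longlonglongrightarrow> 2 * (t * c) powr (1 / 3)" .
    have "eventually (\<lambda>m. (2 * (4 - (d m)\<^sup>2) * (t * \<rho> m)) powr (1 / 3) = real m * d m / real m powr e) sequentially"
      using d_props
    proof eventually_elim
      case (elim m)
      let ?x = "real m * d m / real m powr e"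
      have m: "real m > 0" using elim by simp
      have x: "?x > 0" using elim m by simp
      have d3: "(d m)\<^sup>2 < 3" using elim below_sqrt3 by simp
      have me: "(real m powr e) ^ 3 = real m ^ 2 * real m powr \<gamma>"
      proof -
        have "(real m powr e) ^ 3 = (real m powr e) powr 3" using m by simp
        also have "\<dots> = real m powr (2 + \<gamma>)"
        proof -
          have "e * 3 = 2 + \<gamma>" by (simp add: e_def)
          then show ?thesis by (simp only: powr_powr)
        qed
        also have "\<dots> = real m ^ 2 * real m powr \<gamma>" using m by (simp add: powr_add)
        finally show ?thesis .
      qed
      have "(d m) ^ 3 = 2 * (4 - (d m)\<^sup>2) * pole_ratio (d m)" using d3 by (simp add: pole_ratio_def)
      also have "pole_ratio (d m) = t * q m / real m" using elim m by simp
      finally have "?x ^ 3 = 2 * (4 - (d m)\<^sup>2) * (t * \<rho> m)"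
        unfolding power_divide power_mult_distrib me \<rho>_def using m
        by (simp add: power3_eq_cube power2_eq_square)
      then have cube: "2 * (4 - (d m)\<^sup>2) * (t * \<rho> m) = ?x ^ 3" by (rule sym)
      have "(X ^ 3) powr (1 / 3) = X" if "X > 0" for X :: real
      proof -
        have "X ^ 3 = X powr 3" using that by simp
        then show ?thesis using that by (simp only: powr_powr) simp
      qed
      from this[OF x] show ?case unfolding cube .
    qed
    with lim show ?thesis by (rule Lim_transform_eventually)
  qed
  have e: "e > 0" "e \<ge> 2 / 3" using \<gamma> by (auto simp: e_def)
  have me_top: "filterlim (\<lambda>m. real m powr e) at_top sequentially"
    using e by real_asymp
  have me_pos: "eventually (\<lambda>m. real m powr e > 0 \<and> d m > 0) sequentially"
    using d_props by eventually_elim auto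
  have N: "filterlim (\<lambda>m. real m * d m) at_top sequentially"
  proof -
    have "filterlim (\<lambda>m. real m * d m / real m powr e * real m powr e) at_top sequentially"
      using t c by (intro filterlim_tendsto_pos_mult_at_top[OF scale _ me_top]) simp
    moreover have "eventually (\<lambda>m. real m * d m / real m powr e * real m powr e = real m * d m) sequentially"
      using me_pos by eventually_elim simp
    ultimately show ?thesis by (simp cong: filterlim_cong)
  qed
  obtain K where K: "eventually (\<lambda>m. E m > 0 \<and> \<bar>ln (E m) - real m * saddle_rate (d m)\<bar> \<le> K + 3 * ln (real m)) sequentially"
    by (rule log_error[OF N])
  have small: "(\<lambda>m. (ln (E m) - real m * saddle_rate (d m)) / real m powr e) \<longlonglongrightarrow> 0"
  proof (rule Lim_null_comparison)
    show "eventually (\<lambda>m. norm ((ln (E m) - real m * saddle_rate (d m)) / real m powr e) \<le> (K + 3 * ln (real m)) / real m powr e) sequentially"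
      using K by eventually_elim (simp add: divide_right_mono)
    show "(\<lambda>m. (K + 3 * ln (real m)) / real m powr e) \<longlonglongrightarrow> 0"
      using e by real_asymp
  qed
  have "((\<lambda>d. saddle_rate d / d) \<longlongrightarrow> - 3 / 4) (at_right 0)"
    unfolding saddle_rate_def by real_asymp
  moreover have "filterlim d (at_right 0) sequentially"
    unfolding filterlim_at using d_tendsto me_pos by (auto elim!: eventually_mono)
  ultimately have "(\<lambda>m. saddle_rate (d m) / d m) \<longlonglongrightarrow> - 3 / 4"
    by (rule filterlim_compose)
  then have "(\<lambda>m. (ln (E m) - real m * saddle_rate (d m)) / real m powr e + saddle_rate (d m) / d m * (real m * d m / real m powr e))
      \<longlonglongrightarrow> 0 + - 3 / 4 * (2 * (t * c) powr (1 / 3))"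
    by (intro tendsto_add[OF small] tendsto_mult[OF _ scale])
  moreover have "eventually (\<lambda>m. (ln (E m) - real m * saddle_rate (d m)) / real m powr e + saddle_rate (d m) / d m * (real m * d m / real m powr e)
      = ln (E m) / real m powr e) sequentially"
    using me_pos by eventually_elim (simp add: diff_divide_distrib)
  ultimately have "(\<lambda>m. ln (E m) / real m powr e) \<longlonglongrightarrow> 0 + - 3 / 4 * (2 * (t * c) powr (1 / 3))"
    by (rule Lim_transform_eventually)
  then show ?thesis by (simp add: e_def)
qed

text \<open>
  The saddle parameter is \<open>d = \<surd>2\<close>. Here \<open>\<zeta>\<close> is a primitive eighth root of unity, so \<open>Re (\<zeta>\<^sup>2) = 0\<close> and the exponential
  factor of \<open>H_e\<close> is 1.
\<close>
lemma H_e_inverse_sqrt2: "1 / sqrt 2 < alpha_c" "H_e (1 / sqrt 2) = sqrt 2 - 1"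
proof -
  have s2: "sqrt 2 * sqrt 2 = (2::real)" by simp
  have lt: "sqrt 2 < sqrt (3::real)" by simp
  have a: "pole_ratio (sqrt 2) = 1 / sqrt 2"
    by (simp add: pole_ratio_def power3_eq_cube field_simps)
  have pos: "0 < 1 / sqrt (2::real)" by simp
  have "pole_ratio (sqrt 2) < pole_ratio (sqrt 3)" by (intro pole_ratio_strict_mono) auto
  then show lt': "1 / sqrt 2 < alpha_c" unfolding a by (simp add: pole_ratio_def alpha_c_def power3_eq_cube)
  have s1: "sqrt 2 > (1::real)" "sqrt 2 < (2::real)" by (simp_all add: real_less_lsqrt)
  have "H_e (1 / sqrt 2) = exp (saddle_rate (sqrt 2))"
    unfolding H_e_eq_exp_saddle_rate[OF pos lt'] using saddle_param_pole_ratio[of "sqrt 2"] lt a by simp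
  also have "saddle_rate (sqrt 2) = ln (sqrt 2 - 1)"
  proof -
    have "4 - 2 * sqrt 2 = (sqrt 2 - 1)\<^sup>2 * (4 + 2 * sqrt (2::real))"
      by (simp add: power2_eq_square algebra_simps s2)
    moreover have nz: "4 + 2 * sqrt 2 \<noteq> (0::real)" using s1 by linarith
    ultimately have "ln (4 - 2 * sqrt 2) = 2 * ln (sqrt 2 - 1) + ln (4 + 2 * sqrt 2)"
      using s1 ln_mult[of "(sqrt 2 - 1)\<^sup>2" "4 + 2 * sqrt 2"] nz by (simp add: ln_realpow)
    then show ?thesis by (simp add: saddle_rate_def)
  qed
  finally show "H_e (1 / sqrt 2) = sqrt 2 - 1" using s1 by simp
qed

theorem corollary5p9:
  fixes t :: real and q :: "nat \<Rightarrow> real"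
  assumes "t > 0" and "\<And>m. m \<ge> 1 \<Longrightarrow> q m > 0"
  shows "(\<forall>c \<gamma> :: real. c > 0 \<and> 0 \<le> \<gamma> \<and> \<gamma> < 1
            \<and> asymp_equiv q sequentially (\<lambda>m. c * real m powr \<gamma>) \<longrightarrow>
            (\<lambda>m. ln (rat_error m t (q m)) / real m powr ((2 + \<gamma>) / 3))
              \<longlonglongrightarrow> - (3 / 2) * (t * c) powr (1 / 3))
       \<and> (\<forall>\<alpha> :: real. 0 < \<alpha> \<and> \<alpha> < alpha_c
            \<and> (\<lambda>m. t * q m / real m) \<longlonglongrightarrow> \<alpha> \<longrightarrow>
            (\<lambda>m. rat_error m t (q m) powr (1 / real m)) \<longlonglongrightarrow> H_e \<alpha>)
       \<and> (\<forall>\<alpha> :: real. 0 < \<alpha> \<and> \<alpha> < alpha_c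
            \<and> (\<forall>m\<ge>1. q m = \<alpha> / t * real m) \<longrightarrow>
            (\<lambda>m. rat_error m t (q m)) \<in> \<Theta>(\<lambda>m. real m powr (- 1 / 2) * H_e \<alpha> ^ m))
       \<and> ((\<forall>m\<ge>1. q m = real m / (sqrt 2 * t)) \<longrightarrow>
            (\<lambda>m. rat_error m t (q m)) \<in> \<Theta>(\<lambda>m. real m powr (- 1 / 2) * (sqrt 2 - 1) ^ m))"
proof (intro conjI allI impI)
  fix c \<gamma> :: real
  assume "c > 0 \<and> 0 \<le> \<gamma> \<and> \<gamma> < 1 \<and> asymp_equiv q sequentially (\<lambda>m. c * real m powr \<gamma>)"
  then show "(\<lambda>m. ln (rat_error m t (q m)) / real m powr ((2 + \<gamma>) / 3)) \<longlonglongrightarrow> - (3 / 2) * (t * c) powr (1 / 3)"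
    using assms by (intro error_subproportional_pole) auto
next
  fix \<alpha> :: real
  assume \<alpha>: "0 < \<alpha> \<and> \<alpha> < alpha_c \<and> (\<lambda>m. t * q m / real m) \<longlonglongrightarrow> \<alpha>"
  interpret convergent_pole_ratio t q "saddle_param \<alpha>"
    using \<alpha> saddle_param[of \<alpha>] assms by unfold_locales auto
  show "(\<lambda>m. rat_error m t (q m) powr (1 / real m)) \<longlonglongrightarrow> H_e \<alpha>"
    using error_root_limit saddle_param(1)[of \<alpha>] H_e_eq_exp_saddle_rate[of \<alpha>] \<alpha> by simp
next
  fix \<alpha> :: real
  assume "0 < \<alpha> \<and> \<alpha> < alpha_c \<and> (\<forall>m\<ge>1. q m = \<alpha> / t * real m)"
  then show "(\<lambda>m. rat_error m t (q m)) \<in> \<Theta>(\<lambda>m. real m powr (- 1 / 2) * H_e \<alpha> ^ m)"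
    using assms by (intro error_proportional_pole) auto
next
  assume "\<forall>m\<ge>1. q m = real m / (sqrt 2 * t)"
  then have "(\<lambda>m. rat_error m t (q m)) \<in> \<Theta>(\<lambda>m. real m powr (- 1 / 2) * H_e (1 / sqrt 2) ^ m)"
    using assms H_e_inverse_sqrt2(1) by (intro error_proportional_pole) auto
  then show "(\<lambda>m. rat_error m t (q m)) \<in> \<Theta>(\<lambda>m. real m powr (- 1 / 2) * (sqrt 2 - 1) ^ m)"
    unfolding H_e_inverse_sqrt2(2) .
qed


end
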